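(* Let $T>0$, let $a\in L^\infty([0,T])$ with $a\ge0$ a.e. and $a\not\equiv0$, let $k\in\mathbb{N}$, $k\geq1$, and assume that the coefficients $a_k,b_k,c_k,d_k,e_k$ satisfy $$a_k=3c_k,\qquad b_k=d_k,\qquad a_k=e_k,\qquad b_k\ne0 .$$ (Then $a_k\pm2b_k>0$.) Set $$(\bar z_{1,k},\bar w_{1,k})=\Big(\tfrac{1}{\sqrt{2(a_k+2b_k)}},\tfrac{1}{\sqrt{2(a_k+2b_k)}}\Big),\quad (\bar z_{2,k},\bar w_{2,k})=-(\bar z_{1,k},\bar w_{1,k}),$$ $$(\bar z_{3,k},\bar w_{3,k})=\Big(\tfrac{1}{\sqrt{2(a_k-2b_k)}},\tfrac{-1}{\sqrt{2(a_k-2b_k)}}\Big),\quad (\bar z_{4,k},\bar w_{4,k})=-(\bar z_{3,k},\bar w_{3,k}).$$ Then, for each $i\in\{1,2,3,4\}$, there exist $\varepsilon_i>0$, a neighborhood $\mathcal{U}_{i,k}\subset\mathbb{R}^2$ of $(\bar z_{i,k},\bar w_{i,k})$, and a $\mathcal{C}^1$ function $g_{i,k}:(\sigma_k-\varepsilon_i,\sigma_k]\to\mathcal{U}_{i,k}$, $g_{i,k}(\lambda)=(z_{i,k}(\lambda),w_{i,k}(\lambda))$, such that $$g_{i,k}(\sigma_k)=(\bar z_{i,k},\bar w_{i,k}),\qquad f(\lambda,z_{i,k}(\lambda),w_{i,k}(\lambda))=0\quad\text{for all }\lambda\in(\sigma_k-\varepsilon_i,\sigma_k].$$ As a consequence,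 the system $\mathfrak{H}(\lambda,x,y)=0$ admits, in a neighborhood of $(\sigma_k,0,0)$ and with $\lambda<\sigma_k$, exactly four branches of nontrivial solutions: $$(x_{i,k}(\lambda),y_{i,k}(\lambda))=\sqrt{\sigma_k-\lambda}\,(z_{i,k}(\lambda),w_{i,k}(\lambda)),\qquad i\in\{1,2,3,4\}.$$
   Context: $\mathbb{T}=\mathbb{R}/(T\mathbb{Z})$; $H^s(\mathbb{T})$ is the space of real $u\in H^s([0,T])$ with $D^\alpha u(0)=D^\alpha u(T)$ for integers $0\le\alpha<s$, with inner product $(u,v)_{H^s}=\sum_{0\le\alpha\le s}\int_0^TD^\alpha u\,D^\alpha v\,dt$; $L^2(\mathbb{T})=H^0(\mathbb{T})$. $\mathfrak{F}:\mathbb{R}\times H^2(\mathbb{T})\to L^2(\mathbb{T})$, $\mathfrak{F}(\lambda,u)=u''+\lambda u+a(t)u^3$. $\sigma_k=(2\pi k/T)^2$, $\varphi_k(t)=\sqrt{2/T}\cos(2\pi kt/T)$, $\phi_k(t)=\sqrt{2/T}\sin(2\pi kt/T)$. Coefficients: $$a_k=\int_0^Ta\varphi_k^4,\quad b_k=\int_0^Ta\varphi_k^3\phi_k,\quad c_k=\int_0^Ta\varphi_k^2\phi_k^2,\quad d_k=\int_0^Ta\varphi_k\phi_k^3,\quad e_k=\int_0^Ta\phi_k^4 .$$ Lyapunov–Schmidt reduction: let $N=\mathrm{span}\{\varphi_k,\phi_k\}$ (the kernel of $v\mapsto v''+\sigma_kv$ on $H^2(\mathbb{T})$), $N^\perp$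 its orthogonal complement in $H^2(\mathbb{T})$, $Q_k[v]=(v,\varphi_k)_{L^2}\varphi_k+(v,\phi_k)_{L^2}\phi_k$. By the implicit function theorem there are open neighborhoods $I_k\subset\mathbb{R}$ of $\sigma_k$ and $\mathcal{N}_k\subset N$ of $0$ and a $\mathcal{C}^\infty$ map $\psi:I_k\times\mathcal{N}_k\to N^\perp$ with $\psi(\sigma_k,0)=0$ and $(I-Q_k)\mathfrak{F}(\lambda,x+\psi(\lambda,x))=0$ on $I_k\times\mathcal{N}_k$, and locally $y=\psi(\lambda,x)$ is the unique solution $y\in N^\perp$ near $0$ of $(I-Q_k)\mathfrak{F}(\lambda,x+y)=0$. With $L(x,y)=x\varphi_k+y\phi_k$ and $\Omega_k=L^{-1}(\mathcal{N}_k)$, $\mathfrak{H}=(h_1,h_2):I_k\times\Omega_k\to\mathbb{R}^2$ is $$h_1=(Q_k\mathfrak{F}(\lambda,L(x,y)+\psi(\lambda,L(x,y))),\varphi_k)_{L^2},\quad h_2=(Q_k\mathfrak{F}(\lambda,L(x,y)+\psi(\lambda,L(x,y))),\phi_k)_{L^2}.$$ Under the hypotheses on the coefficients, the cubic part of $\mathfrak{H}$ at $(\sigma_k,0,0)$ is $$\mathscr{C}_k(x,y)=\big(a_kx^3+3b_kx^2y+a_kxy^2+b_ky^3,\ b_kx^3+a_kx^2y+3b_kxy^2+a_ky^3\big).$$ The rescaled function $f$ is defined by $f(\lambda,z,w)=(\sigma_k-\lambda)^{-3/2}\,\mathfrak{H}\big(\lambda,\sqrt{\sigma_k-\lambda}\,z,\sqrt{\sigma_k-\lambda}\,w\big)$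 for $\lambda<\sigma_k$ and $f(\sigma_k,z,w)=-(z,w)+\mathscr{C}_k(z,w)$. "Nontrivial" means $(x,y)\ne(0,0)$. *)

theory Defs
  imports "HOL-Analysis.Analysis"
begin

section \<open>Function spaces on the circle of length \<open>T\<close>\<close>

text \<open>
  Elements of the spaces below are functions \<^typ>\<open>real \<Rightarrow> real\<close> of which only the values on
  \<open>[0,T]\<close>, up to Lebesgue null sets, matter. Equality in these spaces is therefore equality
  almost everywhere on \<open>[0,T]\<close>.
\<close>

abbreviation leb :: "real \<Rightarrow> real measure"
  where "leb T \<equiv> lebesgue_on {0..T}"

definition L2 :: "real \<Rightarrow> (real \<Rightarrow> real) set"
  where "L2 T = {u. u \<in> borel_measurable (leb T) \<and> integrable (leb T) (\<lambda>t. (u t)\<^sup>2)}"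

definition Linf :: "real \<Rightarrow> (real \<Rightarrow> real) set"
  where "Linf T = {u. u \<in> borel_measurable (leb T) \<and> (\<exists>C. AE t in leb T. \<bar>u t\<bar> \<le> C)}"

definition L2_inner :: "real \<Rightarrow> (real \<Rightarrow> real) \<Rightarrow> (real \<Rightarrow> real) \<Rightarrow> real"
  where "L2_inner T u v = (LINT t|leb T. u t * v t)"

text \<open>
  \<open>C\<^sup>1\<close> functions with compact support in \<open>(0,T)\<close>; these define the same weak derivatives as
  \<open>C\<^sup>\<infinity>\<close> test functions.
\<close>

definition test_funs :: "real \<Rightarrow> (real \<Rightarrow> real) set"
  where "test_funs T = {\<eta>. \<eta> C1_differentiable_on UNIV \<and> closure {t. \<eta> t \<noteq> 0} \<subseteq> {0<..<T}}"

text \<open>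
  \<open>has_weak_D T n u v\<close>: the function \<open>v \<in> L\<^sup>2\<close> is (a representative of) the \<open>n\<close>-th weak derivative
  of \<open>u\<close> on \<open>(0,T)\<close>, all intermediate derivatives being in \<open>L\<^sup>2\<close> as well.
\<close>

primrec has_weak_D :: "real \<Rightarrow> nat \<Rightarrow> (real \<Rightarrow> real) \<Rightarrow> (real \<Rightarrow> real) \<Rightarrow> bool"
  where
    "has_weak_D T 0 u v \<longleftrightarrow> u \<in> L2 T \<and> v \<in> L2 T \<and> (AE t in leb T. v t = u t)"
  | "has_weak_D T (Suc n) u v \<longleftrightarrow>
       (\<exists>w. has_weak_D T n u w \<and> v \<in> L2 T \<and>
            (\<forall>\<eta>\<in>test_funs T. L2_inner T w (deriv \<eta>) = - L2_inner T v \<eta>))"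

text \<open>Weak derivatives are unique almost everywhere; \<open>weak_D\<close> picks a representative.\<close>

definition weak_D :: "real \<Rightarrow> nat \<Rightarrow> (real \<Rightarrow> real) \<Rightarrow> (real \<Rightarrow> real)"
  where "weak_D T n u = (SOME v. has_weak_D T n u v)"

text \<open>
  The periodicity conditions \<open>D\<^sup>\<alpha> u(0) = D\<^sup>\<alpha> u(T)\<close> refer to the continuous representatives on
  \<open>[0,T]\<close> of the derivatives of order below \<open>s\<close>.
\<close>

definition Hs :: "real \<Rightarrow> nat \<Rightarrow> (real \<Rightarrow> real) set"
  where "Hs T s = {u. (\<exists>v. has_weak_D T s u v) \<and>
     (\<forall>\<alpha><s. \<exists>v. has_weak_D T \<alpha> u v \<and> continuous_on {0..T} v \<and> v 0 = v T)}"

definition Hs_inner :: "real \<Rightarrow> nat \<Rightarrow> (real \<Rightarrow> real) \<Rightarrow> (real \<Rightarrow> real) \<Rightarrow> real"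
  where "Hs_inner T s u v = (\<Sum>\<alpha>\<le>s. L2_inner T (weak_D T \<alpha> u) (weak_D T \<alpha> v))"

definition Hs_norm :: "real \<Rightarrow> nat \<Rightarrow> (real \<Rightarrow> real) \<Rightarrow> real"
  where "Hs_norm T s u = sqrt (Hs_inner T s u u)"

section \<open>Smooth maps with values in the Sobolev space\<close>

text \<open>
  \<open>Cn_into T s n S \<Psi>\<close>: the map \<open>\<Psi>\<close> from the open subset \<open>S\<close> of a Euclidean space into
  \<open>H\<^sup>s\<close> is of class \<open>C\<^sup>n\<close>. In the recursion, \<open>D b p\<close> is the partial derivative of \<open>\<Psi>\<close> at \<open>p\<close> in
  the direction of the basis vector \<open>b\<close>, so that the Frechet derivative of \<open>\<Psi>\<close> at \<open>p\<close> sends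
  \<open>h\<close> to \<open>\<Sum>b. (h \<bullet> b) D b p\<close>.
\<close>

primrec Cn_into ::
    "real \<Rightarrow> nat \<Rightarrow> nat \<Rightarrow> ('p::euclidean_space) set \<Rightarrow> ('p \<Rightarrow> real \<Rightarrow> real) \<Rightarrow> bool"
  where
    "Cn_into T s 0 S \<Psi> \<longleftrightarrow> (\<forall>p\<in>S. \<Psi> p \<in> Hs T s \<and>
       ((\<lambda>q. Hs_norm T s (\<lambda>t. \<Psi> q t - \<Psi> p t)) \<longlongrightarrow> 0) (at p within S))"
  | "Cn_into T s (Suc n) S \<Psi> \<longleftrightarrow> (\<forall>p\<in>S. \<Psi> p \<in> Hs T s) \<and>
       (\<exists>D. (\<forall>p\<in>S. ((\<lambda>q. Hs_norm T s
                 (\<lambda>t. \<Psi> q t - \<Psi> p t - (\<Sum>b\<in>Basis. ((q - p) \<bullet> b) * D b p t)) / norm (q - p))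
               \<longlongrightarrow> 0) (at p within S)) \<and>
            (\<forall>b\<in>Basis. Cn_into T s n S (D b)))"

definition smooth_into ::
    "real \<Rightarrow> nat \<Rightarrow> ('p::euclidean_space) set \<Rightarrow> ('p \<Rightarrow> real \<Rightarrow> real) \<Rightarrow> bool"
  where "smooth_into T s S \<Psi> \<longleftrightarrow> (\<forall>n. Cn_into T s n S \<Psi>)"

section \<open>The equation and its coefficients\<close>

text \<open>
  The bifurcation parameter, usually called lambda, is written \<open>\<mu>\<close> throughout. The operator is
  \<open>FF T a \<mu> u = u'' + \<mu> u + a u\<^sup>3\<close>.
\<close>

definition FF :: "real \<Rightarrow> (real \<Rightarrow> real) \<Rightarrow> real \<Rightarrow> (real \<Rightarrow> real) \<Rightarrow> (real \<Rightarrow> real)"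
  where "FF T a \<mu> u = (\<lambda>t. weak_D T 2 u t + \<mu> * u t + a t * u t ^ 3)"

definition sigma :: "real \<Rightarrow> nat \<Rightarrow> real"
  where "sigma T k = (2 * pi * real k / T)\<^sup>2"

definition phi_cos :: "real \<Rightarrow> nat \<Rightarrow> real \<Rightarrow> real"
  where "phi_cos T k t = sqrt (2 / T) * cos (2 * pi * real k * t / T)"

definition phi_sin :: "real \<Rightarrow> nat \<Rightarrow> real \<Rightarrow> real"
  where "phi_sin T k t = sqrt (2 / T) * sin (2 * pi * real k * t / T)"

definition coef_a :: "real \<Rightarrow> (real \<Rightarrow> real) \<Rightarrow> nat \<Rightarrow> real"
  where "coef_a T a k = (LINT t|leb T. a t * phi_cos T k t ^ 4)"

definition coef_b :: "real \<Rightarrow> (real \<Rightarrow> real) \<Rightarrow> nat \<Rightarrow> real"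
  where "coef_b T a k = (LINT t|leb T. a t * phi_cos T k t ^ 3 * phi_sin T k t)"

definition coef_c :: "real \<Rightarrow> (real \<Rightarrow> real) \<Rightarrow> nat \<Rightarrow> real"
  where "coef_c T a k = (LINT t|leb T. a t * phi_cos T k t ^ 2 * phi_sin T k t ^ 2)"

definition coef_d :: "real \<Rightarrow> (real \<Rightarrow> real) \<Rightarrow> nat \<Rightarrow> real"
  where "coef_d T a k = (LINT t|leb T. a t * phi_cos T k t * phi_sin T k t ^ 3)"

definition coef_e :: "real \<Rightarrow> (real \<Rightarrow> real) \<Rightarrow> nat \<Rightarrow> real"
  where "coef_e T a k = (LINT t|leb T. a t * phi_sin T k t ^ 4)"

section \<open>Lyapunov--Schmidt reduction\<close>

definition Lmap :: "real \<Rightarrow> nat \<Rightarrow> real \<times> real \<Rightarrow> (real \<Rightarrow> real)"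
  where "Lmap T k p = (\<lambda>t. fst p * phi_cos T k t + snd p * phi_sin T k t)"

text \<open>\<open>Nspace T k\<close> is the linear span of \<open>phi_cos T k\<close> and \<open>phi_sin T k\<close>.\<close>

definition Nspace :: "real \<Rightarrow> nat \<Rightarrow> (real \<Rightarrow> real) set"
  where "Nspace T k = range (Lmap T k)"

definition Nperp :: "real \<Rightarrow> nat \<Rightarrow> (real \<Rightarrow> real) set"
  where "Nperp T k = {v \<in> Hs T 2. \<forall>n\<in>Nspace T k. Hs_inner T 2 v n = 0}"

definition Qproj :: "real \<Rightarrow> nat \<Rightarrow> (real \<Rightarrow> real) \<Rightarrow> (real \<Rightarrow> real)"
  where "Qproj T k v = (\<lambda>t. L2_inner T v (phi_cos T k) * phi_cos T k t
                           + L2_inner T v (phi_sin T k) * phi_sin T k t)"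

text \<open>\<open>aux_eq T a k \<mu> x y\<close> is the auxiliary equation \<open>(I - Q\<^sub>k) F(\<mu>, x + y) = 0\<close> in \<open>L\<^sup>2\<close>.\<close>

definition aux_eq ::
    "real \<Rightarrow> (real \<Rightarrow> real) \<Rightarrow> nat \<Rightarrow> real \<Rightarrow> (real \<Rightarrow> real) \<Rightarrow> (real \<Rightarrow> real) \<Rightarrow> bool"
  where "aux_eq T a k \<mu> x y \<longleftrightarrow>
     (AE t in leb T. FF T a \<mu> (\<lambda>t. x t + y t) t - Qproj T k (FF T a \<mu> (\<lambda>t. x t + y t)) t = 0)"

definition Omega :: "real \<Rightarrow> nat \<Rightarrow> (real \<Rightarrow> real) set \<Rightarrow> (real \<times> real) set"
  where "Omega T k NN = Lmap T k -` NN"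

definition open_in_N :: "real \<Rightarrow> nat \<Rightarrow> (real \<Rightarrow> real) set \<Rightarrow> bool"
  where "open_in_N T k NN \<longleftrightarrow> NN \<subseteq> Nspace T k \<and>
     (\<forall>v\<in>NN. \<exists>r>0. \<forall>w\<in>Nspace T k. Hs_norm T 2 (\<lambda>t. w t - v t) < r \<longrightarrow> w \<in> NN)"

text \<open>
  The data \<open>(I\<^sub>k, N\<^sub>k, \<psi>)\<close> produced by the implicit function theorem. Smoothness of \<open>\<psi>\<close> on
  \<open>I\<^sub>k \<times> N\<^sub>k\<close> is expressed in the linear coordinates on the two-dimensional space \<open>N\<close> given by
  \<open>Lmap\<close>. The last conjunct is the local uniqueness of the solution near \<open>(\<sigma>\<^sub>k, 0, 0)\<close>.
\<close>

definition LS_reduction ::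
    "real \<Rightarrow> (real \<Rightarrow> real) \<Rightarrow> nat \<Rightarrow> real set \<Rightarrow> (real \<Rightarrow> real) set
      \<Rightarrow> (real \<Rightarrow> (real \<Rightarrow> real) \<Rightarrow> (real \<Rightarrow> real)) \<Rightarrow> bool"
  where "LS_reduction T a k I NN \<psi> \<longleftrightarrow>
     open I \<and> sigma T k \<in> I \<and>
     open_in_N T k NN \<and> (\<lambda>t. 0) \<in> NN \<and>
     (\<forall>\<mu>\<in>I. \<forall>x\<in>NN. \<psi> \<mu> x \<in> Nperp T k) \<and>
     smooth_into T 2 (I \<times> Omega T k NN) (\<lambda>(\<mu>, p). \<psi> \<mu> (Lmap T k p)) \<and>
     (AE t in leb T. \<psi> (sigma T k) (\<lambda>t. 0) t = 0) \<and>
     (\<forall>\<mu>\<in>I. \<forall>x\<in>NN. aux_eq T a k \<mu> x (\<psi> \<mu> x)) \<and>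
     (\<exists>r>0. \<forall>\<mu>\<in>I. \<forall>x\<in>NN. \<forall>y\<in>Nperp T k.
        \<bar>\<mu> - sigma T k\<bar> < r \<and> Hs_norm T 2 x < r \<and> Hs_norm T 2 y < r \<and> aux_eq T a k \<mu> x y
          \<longrightarrow> (AE t in leb T. y t = \<psi> \<mu> x t))"

definition HH ::
    "real \<Rightarrow> (real \<Rightarrow> real) \<Rightarrow> nat \<Rightarrow> (real \<Rightarrow> (real \<Rightarrow> real) \<Rightarrow> (real \<Rightarrow> real))
      \<Rightarrow> real \<Rightarrow> real \<times> real \<Rightarrow> real \<times> real"
  where "HH T a k \<psi> \<mu> p =
     (let v = Qproj T k (FF T a \<mu> (\<lambda>t. Lmap T k p t + \<psi> \<mu> (Lmap T k p) t))
      in (L2_inner T v (phi_cos T k), L2_inner T v (phi_sin T k)))"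

definition cubic_part :: "real \<Rightarrow> (real \<Rightarrow> real) \<Rightarrow> nat \<Rightarrow> real \<times> real \<Rightarrow> real \<times> real"
  where "cubic_part T a k = (\<lambda>(x, y).
     let A = coef_a T a k; B = coef_b T a k
     in (A * x^3 + 3 * B * x^2 * y + A * x * y^2 + B * y^3,
         B * x^3 + A * x^2 * y + 3 * B * x * y^2 + A * y^3))"

text \<open>
  The rescaled function. It is only meaningful for \<open>\<mu> \<le> \<sigma>\<^sub>k\<close> and, if \<open>\<mu> < \<sigma>\<^sub>k\<close>, when
  \<open>\<mu> \<in> I\<^sub>k\<close> and \<open>sqrt (\<sigma>\<^sub>k - \<mu>) p \<in> \<Omega>\<^sub>k\<close>.
\<close>

definition ff ::
    "real \<Rightarrow> (real \<Rightarrow> real) \<Rightarrow> nat \<Rightarrow> (real \<Rightarrow> (real \<Rightarrow> real) \<Rightarrow> (real \<Rightarrow> real))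
      \<Rightarrow> real \<Rightarrow> real \<times> real \<Rightarrow> real \<times> real"
  where "ff T a k \<psi> \<mu> p =
     (if \<mu> < sigma T k
      then (sigma T k - \<mu>) powr (- 3 / 2) *\<^sub>R HH T a k \<psi> \<mu> (sqrt (sigma T k - \<mu>) *\<^sub>R p)
      else - p + cubic_part T a k p)"

definition zw_bar :: "real \<Rightarrow> (real \<Rightarrow> real) \<Rightarrow> nat \<Rightarrow> nat \<Rightarrow> real \<times> real"
  where "zw_bar T a k i =
     (let p = 1 / sqrt (2 * (coef_a T a k + 2 * coef_b T a k));
          m = 1 / sqrt (2 * (coef_a T a k - 2 * coef_b T a k))
      in if i = 1 then (p, p) else if i = 2 then - (p, p)
         else if i = 3 then (m, - m) else - (m, - m))"

text \<open>
  Class \<open>C\<^sup>1\<close> on a half-open interval: derivatives are taken within the set, hence one-sided at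
  the endpoint (unlike in \<open>C1_differentiable_on\<close>).
\<close>

definition C1_within :: "real set \<Rightarrow> (real \<Rightarrow> real \<times> real) \<Rightarrow> bool"
  where "C1_within S g \<longleftrightarrow> (\<exists>D. continuous_on S D \<and>
     (\<forall>\<mu>\<in>S. (g has_vector_derivative D \<mu>) (at \<mu> within S)))"

end

theory Submission
  imports Defs
begin

text \<open>
  Write \<open>\<tau> = \<sigma>\<^sub>k - \<mu>\<close>. Variation of constants gives an explicit inverse \<open>K\<close> of
  \<open>- (\<partial>\<^sup>2 + \<sigma>\<^sub>k)\<close> on the complement of the kernel, and the auxiliary equation becomes the fixed
  point problem \<open>y = K (a (L p + y)\<^sup>3) - \<tau> K y\<close> in the Banach algebra of bounded continuous
  functions. It has a unique small solution, which the local uniqueness in the reduction identifies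
  with \<open>\<psi>\<close>. After the rescaling \<open>p = s z\<close>, \<open>y = s\<^sup>3 Y\<close>,
  \<open>\<tau> = s\<^sup>2\<close> the auxiliary and the bifurcation equation together form a polynomial system in
  \<open>(\<tau>, z, Y)\<close> that is regular across \<open>\<tau> = 0\<close>, where it reduces to the cubic equation for \<open>z\<close>. The
  implicit function theorem at its four nondegenerate nonzero solutions yields the branches as
  \<open>C\<^sup>1\<close> functions of \<open>\<tau>\<close>. Coercivity of the cubic part bounds every other small zero in
  the rescaled variables, so by compactness and local uniqueness no further branches exist.
\<close>

section \<open>Implicit curves in Banach spaces\<close>

text \<open>The obstacle is the endpoint. Written through \<psi>, the rescaled function contains the
  square root of \<sigma> - \<mu>, so an implicit function argument for it in the variable \<mu>
  does not directly give branches that are C1 up to \<mu> = \<sigma>. Cubic homogeneity helps: once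
  \<open>Y\<close> is kept as an unknown next to \<open>z\<close>, the root enters only through its
  square, and the curve exists on a two-sided interval around \<tau> = 0, of which one half is the
  branch. The sup norm is convenient because cubes are estimated directly in it. A weight that is
  merely bounded and measurable then has to stay inside \<open>K\<close>, where integration restores
  continuity. The passage to \<psi> requires that the fixed point lie in \<open>Nperp\<close> and be
  small in the H2 norm; both follow from explicit formulas for the first two derivatives of
  \<open>K h\<close>. Nondegeneracy has a simple source: at each of the four points the radial
  eigenvalue is 2 by homogeneity, and the transverse one is a nonzero multiple of \<open>B\<close>.
  The signs of \<open>A + 2 * B\<close> and \<open>A - 2 * B\<close> come from integrating the
  weight against fourth powers of \<phi> + \<theta> and \<phi> - \<theta>.\<close>

definition C1_map :: "('a::real_normed_vector \<Rightarrow> 'b::real_normed_vector) \<Rightarrow> bool"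
  where "C1_map f \<longleftrightarrow>
    (\<exists>f'. (\<forall>x. (f has_derivative blinfun_apply (f' x)) (at x)) \<and> continuous_on UNIV f')"

lemma C1_mapI:
  assumes "\<And>x. (f has_derivative blinfun_apply (f' x)) (at x)" and "continuous_on UNIV f'"
  shows "C1_map f"
  using assms unfolding C1_map_def by blast

lemma C1_map_const: "C1_map (\<lambda>x. c)"
  by (rule C1_mapI[where f' = "\<lambda>_. 0"]) (auto simp: zero_blinfun.rep_eq)

lemma C1_map_linear_compose:
  assumes g: "bounded_linear g" and f: "C1_map f"
  shows "C1_map (\<lambda>x. g (f x))"
proof -
  from f obtain f' where f': "\<And>x. (f has_derivative blinfun_apply (f' x)) (at x)"
    and cont: "continuous_on UNIV f'"
    unfolding C1_map_def by blast
  show ?thesis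
  proof (rule C1_mapI[where f' = "\<lambda>x. Blinfun g o\<^sub>L f' x"])
    fix x
    have "((\<lambda>x. g (f x)) has_derivative (\<lambda>h. g (f' x h))) (at x)"
      by (rule bounded_linear.has_derivative[OF g f'])
    then show "((\<lambda>x. g (f x)) has_derivative blinfun_apply (Blinfun g o\<^sub>L f' x)) (at x)"
      by (simp add: bounded_linear_Blinfun_apply[OF g] blinfun_compose.rep_eq o_def)
  next
    show "continuous_on UNIV (\<lambda>x. Blinfun g o\<^sub>L f' x)"
      by (intro continuous_intros cont)
  qed
qed

lemma C1_map_linear:
  assumes "bounded_linear g"
  shows "C1_map g"
proof (rule C1_mapI[where f' = "\<lambda>x. Blinfun g"])
  fix x
  show "(g has_derivative blinfun_apply (Blinfun g)) (at x)"
    using assms by (simp add: bounded_linear_Blinfun_apply bounded_linear_imp_has_derivative)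
qed auto

lemma C1_map_add:
  assumes f: "C1_map f" and g: "C1_map g"
  shows "C1_map (\<lambda>x. f x + g x)"
proof -
  from f obtain f' where f': "\<And>x. (f has_derivative blinfun_apply (f' x)) (at x)"
    "continuous_on UNIV f'"
    unfolding C1_map_def by blast
  from g obtain g' where g': "\<And>x. (g has_derivative blinfun_apply (g' x)) (at x)"
    "continuous_on UNIV g'"
    unfolding C1_map_def by blast
  show ?thesis
  proof (rule C1_mapI[where f' = "\<lambda>x. f' x + g' x"])
    fix x
    show "((\<lambda>x. f x + g x) has_derivative blinfun_apply (f' x + g' x)) (at x)"
      using has_derivative_add[OF f'(1)[of x] g'(1)[of x]] by (simp add: plus_blinfun.rep_eq)
  qed (intro continuous_intros f' g')
qed

text \<open>Leibniz rule. Writing the derivative with the operator-valued linear maps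
  \<open>prod_left\<close> and \<open>prod_right\<close> makes its continuity in operator norm
  immediate. Algebra products and scalar multiples are both instances.\<close>

lemma C1_map_bilinear:
  assumes bl: "bounded_bilinear pr" and f: "C1_map f" and g: "C1_map g"
  shows "C1_map (\<lambda>x. pr (f x) (g x))"
proof -
  interpret bounded_bilinear pr by (rule bl)
  from f obtain f' where f': "\<And>x. (f has_derivative blinfun_apply (f' x)) (at x)"
    "continuous_on UNIV f'"
    unfolding C1_map_def by blast
  from g obtain g' where g': "\<And>x. (g has_derivative blinfun_apply (g' x)) (at x)"
    "continuous_on UNIV g'"
    unfolding C1_map_def by blast
  have cont: "continuous_on UNIV f" "continuous_on UNIV g"
    using f' g' by (meson continuous_at_imp_continuous_on has_derivative_continuous)+
  show ?thesis
  proof (rule C1_mapI[where f' = "\<lambda>x. (prod_right (f x) o\<^sub>L g' x) + (prod_left (g x) o\<^sub>L f' x)"])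
    fix x
    show "((\<lambda>x. pr (f x) (g x)) has_derivative
        blinfun_apply ((prod_right (f x) o\<^sub>L g' x) + (prod_left (g x) o\<^sub>L f' x))) (at x)"
      using FDERIV[OF f'(1) g'(1)]
      by (simp add: plus_blinfun.rep_eq blinfun_compose.rep_eq prod_left.rep_eq prod_right.rep_eq o_def)
  next
    have lr: "continuous_on UNIV (\<lambda>x. prod_right (f x))" "continuous_on UNIV (\<lambda>x. prod_left (g x))"
      using cont by (auto intro: bounded_linear.continuous_on[OF bounded_linear_prod_right]
          bounded_linear.continuous_on[OF bounded_linear_prod_left])
    show "continuous_on UNIV (\<lambda>x. (prod_right (f x) o\<^sub>L g' x) + (prod_left (g x) o\<^sub>L f' x))"
      by (intro continuous_intros lr f' g')
  qed
qed

lemma C1_map_mult: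
  fixes f g :: "'a::real_normed_vector \<Rightarrow> 'b::real_normed_algebra"
  shows "C1_map f \<Longrightarrow> C1_map g \<Longrightarrow> C1_map (\<lambda>x. f x * g x)"
  by (rule C1_map_bilinear[OF bounded_bilinear_mult])

lemma C1_map_scaleR: "C1_map f \<Longrightarrow> C1_map g \<Longrightarrow> C1_map (\<lambda>x. f x *\<^sub>R g x)"
  by (rule C1_map_bilinear[OF bounded_bilinear_scaleR])

lemma C1_map_diff: "C1_map f \<Longrightarrow> C1_map g \<Longrightarrow> C1_map (\<lambda>x. f x - g x)"
  using C1_map_add[of f "\<lambda>x. - g x"]
    C1_map_linear_compose[OF bounded_linear_minus[OF bounded_linear_ident], of g] by simp

lemma C1_map_power:
  fixes f :: "'a::real_normed_vector \<Rightarrow> 'b::real_normed_algebra_1"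
  assumes "C1_map f"
  shows "C1_map (\<lambda>x. f x ^ n)"
  by (induction n) (auto intro: C1_map_const C1_map_mult assms)

lemma C1_map_Pair:
  assumes "C1_map f" "C1_map g"
  shows "C1_map (\<lambda>x. (f x, g x))"
proof -
  have "C1_map (\<lambda>x. (f x, 0) + (0, g x))"
    using assms
    by (intro C1_map_add C1_map_linear_compose[of "\<lambda>y. (y, 0)"] C1_map_linear_compose[of "\<lambda>y. (0, y)"]
        bounded_linear_Pair bounded_linear_ident bounded_linear_zero)
  then show ?thesis by simp
qed

text \<open>The fixed point moves by at most twice the displacement of a frozen fixed point under a
  change of parameter. The contraction estimate is asked only between fixed points, so the lemma
  serves both the implicit curve and its velocity.\<close>

lemma fixed_points_continuous:
  fixes T :: "'a::metric_space \<Rightarrow> 'b::real_normed_vector \<Rightarrow> 'b"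
  assumes fp: "\<And>x. x \<in> S \<Longrightarrow> T x (w x) = w x"
    and lip: "\<And>x y. x \<in> S \<Longrightarrow> y \<in> S \<Longrightarrow> norm (T x (w x) - T x (w y)) \<le> norm (w x - w y) / 2"
    and cont: "\<And>y. y \<in> S \<Longrightarrow> continuous_on S (\<lambda>x. T x (w y))"
  shows "continuous_on S w"
proof (rule continuous_onI)
  fix y and e :: real assume y: "y \<in> S" and e: "e > 0"
  obtain d where "d > 0" and d: "\<And>x. x \<in> S \<Longrightarrow> dist x y < d \<Longrightarrow> dist (T x (w y)) (T y (w y)) < e/2"
    using cont[OF y] y e unfolding continuous_on_iff by (metis half_gt_zero)
  show "\<exists>d>0. \<forall>x'\<in>S. dist x' y < d \<longrightarrow> dist (w x') (w y) \<le> e"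
  proof (intro exI conjI ballI impI)
    show "d > 0" by fact
    fix x assume x: "x \<in> S" "dist x y < d"
    have "w x - w y = (T x (w x) - T x (w y)) + (T x (w y) - T y (w y))"
      using fp x y by simp
    then have "norm (w x - w y) \<le> norm (w x - w y) / 2 + norm (T x (w y) - T y (w y))"
      using lip[OF x(1) y] norm_triangle_ineq[of "T x (w x) - T x (w y)" "T x (w y) - T y (w y)"]
      by simp
    then show "dist (w x) (w y) \<le> e"
      using d[OF x] by (simp add: dist_norm)
  qed
qed

text \<open>Contraction argument for x - B (G (\<tau>, x)) on a closed ball. \<open>B\<close> is a
  left inverse of the partial derivative, and its injectivity turns fixed points back into zeros.
  The uniqueness clause refers to a ball whose radius does not depend on \<tau>; the count of the
  branches rests on it.\<close>

theorem implicit_curve: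
  fixes G :: "real \<times> 'w::banach \<Rightarrow> 'w" and w0 :: 'w
  assumes deriv: "\<And>x. (G has_derivative blinfun_apply (G' x)) (at x)"
    and cont': "continuous_on UNIV G'"
    and zero: "G (0, w0) = 0"
    and B: "bounded_linear B" and B0: "\<And>x. B x = 0 \<Longrightarrow> x = 0"
    and inv: "\<And>h. B (G' (0, w0) (0, h)) = h"
  obtains \<epsilon> \<rho> w v where "\<epsilon> > 0" "\<rho> > 0" "w 0 = w0"
    "\<And>\<tau>. \<bar>\<tau>\<bar> < \<epsilon> \<Longrightarrow> G (\<tau>, w \<tau>) = 0"
    "\<And>\<tau> x. \<bar>\<tau>\<bar> < \<epsilon> \<Longrightarrow> norm (x - w0) \<le> \<rho> \<Longrightarrow> G (\<tau>, x) = 0 \<Longrightarrow> x = w \<tau>"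
    "\<And>\<tau>. \<bar>\<tau>\<bar> < \<epsilon> \<Longrightarrow> (w has_vector_derivative v \<tau>) (at \<tau>)"
    "continuous_on {-\<epsilon><..<\<epsilon>} v"
proof -
  define T where "T q = snd q - B (G q)" for q
  define T' where "T' q = snd_blinfun - (Blinfun B o\<^sub>L G' q)" for q
  have T'_apply: "T' q h = snd h - B (G' q h)" for q h
    by (simp add: T'_def minus_blinfun.rep_eq bounded_linear_Blinfun_apply[OF B] snd_blinfun.rep_eq)
  have derT: "(T has_derivative blinfun_apply (T' q)) (at q)" for q
    unfolding T_def T'_apply
    by (intro derivative_intros bounded_linear.has_derivative[OF B] deriv)
  have contT': "continuous_on UNIV T'"
    unfolding T'_def by (intro continuous_intros cont')
  have contT: "continuous_on UNIV T"
    by (meson continuous_at_imp_continuous_on derT has_derivative_continuous)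
  have fixT: "T (\<tau>, x) = x \<longleftrightarrow> G (\<tau>, x) = 0" for \<tau> x
    using B0 bounded_linear.linear[OF B] by (auto simp: T_def linear_0)
  have T'0: "T' (0, w0) (0, h) = 0" for h
    by (simp add: T'_apply inv)
  obtain d where "d > 0" and d: "\<And>q. dist q (0, w0) < d \<Longrightarrow> dist (T' q) (T' (0, w0)) < 1/2"
    using contT' unfolding continuous_on_iff by (metis UNIV_I half_gt_zero zero_less_one)
  \<comment> \<open>Parameter and unknown may each deviate by a third of \<open>d\<close>, so their
    sum stays below \<open>d\<close>.\<close>
  define \<rho> where "\<rho> = d/3"
  have "\<rho> > 0" using \<open>d > 0\<close> by (simp add: \<rho>_def)
  have near: "norm (T' (\<tau>, x) - T' (0, w0)) \<le> 1/2" if "\<bar>\<tau>\<bar> \<le> \<rho>" "norm (x - w0) \<le> \<rho>" for \<tau> x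
  proof -
    have "dist (\<tau>, x) (0, w0) \<le> \<bar>\<tau>\<bar> + norm (x - w0)"
      using norm_Pair_le[of \<tau> "x - w0"] by (simp add: dist_norm)
    also have "\<dots> < d" using that \<open>d > 0\<close> by (simp add: \<rho>_def)
    finally show ?thesis using d[of "(\<tau>, x)"] by (simp add: dist_norm)
  qed
  have half: "norm (T' (\<tau>, x) (0, h)) \<le> norm h / 2" if "\<bar>\<tau>\<bar> \<le> \<rho>" "norm (x - w0) \<le> \<rho>" for \<tau> x h
  proof -
    have "norm (T' (\<tau>, x) (0, h)) = norm ((T' (\<tau>, x) - T' (0, w0)) (0, h))"
      by (simp add: T'0 minus_blinfun.rep_eq)
    also have "\<dots> \<le> norm (T' (\<tau>, x) - T' (0, w0)) * norm (0::real, h)"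
      by (rule norm_blinfun)
    also have "\<dots> \<le> 1/2 * norm h"
      by (intro mult_mono near that) auto
    finally show ?thesis by simp
  qed
  have lip: "norm (T (\<tau>, x) - T (\<tau>, y)) \<le> norm (x - y) / 2"
    if "\<bar>\<tau>\<bar> \<le> \<rho>" "norm (x - w0) \<le> \<rho>" "norm (y - w0) \<le> \<rho>" for \<tau> x y
  proof -
    have "norm ((\<lambda>z. T (\<tau>, z)) x - (\<lambda>z. T (\<tau>, z)) y) \<le> 1/2 * norm (x - y)"
    proof (rule differentiable_bound[where S = "cball w0 \<rho>" and f' = "\<lambda>z h. T' (\<tau>, z) (0, h)"])
      fix z assume "z \<in> cball w0 \<rho>"
      then have z: "norm (z - w0) \<le> \<rho>" by (simp add: dist_norm norm_minus_commute)
      show "((\<lambda>z. T (\<tau>, z)) has_derivative (\<lambda>h. T' (\<tau>, z) (0, h))) (at z within cball w0 \<rho>)"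
        by (rule has_derivative_compose[of "\<lambda>z. (\<tau>, z)" "\<lambda>h. (0, h)", OF _ derT])
          (auto intro!: derivative_eq_intros)
      show "onorm (\<lambda>h. T' (\<tau>, z) (0, h)) \<le> 1/2"
        by (rule onorm_bound) (use half[OF that(1) z] in auto)
    qed (use that in \<open>auto simp: dist_norm norm_minus_commute\<close>)
    then show ?thesis by simp
  qed
  have "T (0, w0) = w0" using zero fixT by blast
  moreover have "continuous_on UNIV (\<lambda>\<tau>. T (\<tau>, w0))"
    by (rule continuous_on_compose2[OF contT]) (auto intro!: continuous_intros)
  ultimately obtain e where "e > 0" and e: "\<And>\<tau>. \<bar>\<tau>\<bar> < e \<Longrightarrow> norm (T (\<tau>, w0) - w0) < \<rho>/2"
    using \<open>\<rho> > 0\<close> unfolding continuous_on_iff dist_norm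
    by (metis UNIV_I diff_zero half_gt_zero real_norm_def)
  define \<epsilon> where "\<epsilon> = min e \<rho>"
  have "\<epsilon> > 0" using \<open>e > 0\<close> \<open>\<rho> > 0\<close> by (simp add: \<epsilon>_def)
  have ex: "\<exists>!x. x \<in> cball w0 \<rho> \<and> T (\<tau>, x) = x" if \<tau>: "\<bar>\<tau>\<bar> < \<epsilon>" for \<tau>
  proof (rule Banach_fix[where c = "1/2"])
    show "(\<lambda>x. T (\<tau>, x)) ` cball w0 \<rho> \<subseteq> cball w0 \<rho>"
    proof clarify
      fix x assume "x \<in> cball w0 \<rho>"
      then have x: "norm (x - w0) \<le> \<rho>" by (simp add: dist_norm norm_minus_commute)
      have "norm (T (\<tau>, x) - w0) \<le> norm (T (\<tau>, x) - T (\<tau>, w0)) + norm (T (\<tau>, w0) - w0)"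
        using norm_triangle_ineq[of "T (\<tau>, x) - T (\<tau>, w0)" "T (\<tau>, w0) - w0"] by simp
      also have "\<dots> \<le> \<rho>/2 + \<rho>/2"
        using lip[of \<tau> x w0] e[of \<tau>] x \<tau> \<open>\<rho> > 0\<close> by (intro add_mono) (auto simp: \<epsilon>_def)
      finally show "T (\<tau>, x) \<in> cball w0 \<rho>" by (simp add: dist_norm norm_minus_commute)
    qed
    fix x y assume "x \<in> cball w0 \<rho>" "y \<in> cball w0 \<rho>"
    then show "dist (T (\<tau>, x)) (T (\<tau>, y)) \<le> 1/2 * dist x y"
      using lip[of \<tau> x y] \<tau> by (auto simp: dist_norm norm_minus_commute \<epsilon>_def)
  qed (use \<open>\<rho> > 0\<close> in \<open>auto simp: complete_eq_closed\<close>)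
  define w where "w \<tau> = (THE x. x \<in> cball w0 \<rho> \<and> T (\<tau>, x) = x)" for \<tau>
  have w: "w \<tau> \<in> cball w0 \<rho>" "T (\<tau>, w \<tau>) = w \<tau>" if "\<bar>\<tau>\<bar> < \<epsilon>" for \<tau>
    using theI'[OF ex[OF that]] unfolding w_def by auto
  then have wn: "norm (w \<tau> - w0) \<le> \<rho>" if "\<bar>\<tau>\<bar> < \<epsilon>" for \<tau>
    using that by (fastforce simp: dist_norm norm_minus_commute)
  have uniq: "x = w \<tau>" if "\<bar>\<tau>\<bar> < \<epsilon>" "norm (x - w0) \<le> \<rho>" "G (\<tau>, x) = 0" for \<tau> x
  proof -
    have "x \<in> cball w0 \<rho> \<and> T (\<tau>, x) = x"
      using that fixT by (simp add: dist_norm norm_minus_commute)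
    then show ?thesis using ex[OF that(1)] w[OF that(1)] by blast
  qed
  have \<epsilon>\<rho>: "\<bar>\<tau>\<bar> \<le> \<rho>" if "\<bar>\<tau>\<bar> < \<epsilon>" for \<tau> using that by (simp add: \<epsilon>_def)
  define S where "S = {-\<epsilon><..<\<epsilon>}"
  have S: "\<tau> \<in> S \<longleftrightarrow> \<bar>\<tau>\<bar> < \<epsilon>" for \<tau> by (auto simp: S_def)
  have contw: "continuous_on S w"
  proof (rule fixed_points_continuous[where T = "\<lambda>\<tau> x. T (\<tau>, x)"])
    show "continuous_on S (\<lambda>\<tau>. T (\<tau>, w \<sigma>))" for \<sigma>
      by (rule continuous_on_compose2[OF contT]) (auto intro!: continuous_intros)
    show "norm (T (\<tau>, w \<tau>) - T (\<tau>, w \<sigma>)) \<le> norm (w \<tau> - w \<sigma>) / 2" if "\<tau> \<in> S" "\<sigma> \<in> S" for \<tau> \<sigma>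
      using that by (intro lip wn \<epsilon>\<rho>) (auto simp: S)
  qed (use w in \<open>auto simp: S\<close>)
  \<comment> \<open>Differentiating w = T (\<tau>, w) formally gives v = T' (1, v). This affine
    equation is again a contraction, so the velocity is obtained as a fixed point before
    differentiability of \<open>w\<close> is known.\<close>
  have vex: "\<exists>!x. T' (\<tau>, w \<tau>) (1, x) = x" if \<tau>: "\<bar>\<tau>\<bar> < \<epsilon>" for \<tau>
  proof (rule banach_fix_type[where c = "1/2"])
    have "T' (\<tau>, w \<tau>) (1, x) - T' (\<tau>, w \<tau>) (1, y) = T' (\<tau>, w \<tau>) (0, x - y)" for x y
      by (simp flip: blinfun.diff_right)
    then show "\<forall>x y. dist (T' (\<tau>, w \<tau>) (1, x)) (T' (\<tau>, w \<tau>) (1, y)) \<le> 1/2 * dist x y"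
      using half[OF \<epsilon>\<rho>[OF \<tau>] wn[OF \<tau>]] by (simp add: dist_norm)
  qed auto
  define v where "v \<tau> = (THE x. T' (\<tau>, w \<tau>) (1, x) = x)" for \<tau>
  have v: "T' (\<tau>, w \<tau>) (1, v \<tau>) = v \<tau>" if "\<bar>\<tau>\<bar> < \<epsilon>" for \<tau>
    using theI'[OF vex[OF that]] unfolding v_def by auto
  have contv: "continuous_on S v"
  proof (rule fixed_points_continuous[where T = "\<lambda>\<tau> x. T' (\<tau>, w \<tau>) (1, x)"])
    fix \<sigma> assume "\<sigma> \<in> S"
    show "continuous_on S (\<lambda>\<tau>. T' (\<tau>, w \<tau>) (1, v \<sigma>))"
      by (intro continuous_intros continuous_on_compose2[OF contT', of S "\<lambda>\<tau>. (\<tau>, w \<tau>)"] contw) auto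
    fix \<tau> assume \<tau>: "\<tau> \<in> S"
    have "T' (\<tau>, w \<tau>) (1, v \<tau>) - T' (\<tau>, w \<tau>) (1, v \<sigma>) = T' (\<tau>, w \<tau>) (0, v \<tau> - v \<sigma>)"
      by (simp flip: blinfun.diff_right)
    then show "norm (T' (\<tau>, w \<tau>) (1, v \<tau>) - T' (\<tau>, w \<tau>) (1, v \<sigma>)) \<le> norm (v \<tau> - v \<sigma>) / 2"
      using half[of \<tau> "w \<tau>", OF \<epsilon>\<rho> wn] \<tau> by (simp add: S)
  qed (use v in \<open>auto simp: S\<close>)
  have derw: "(w has_vector_derivative v \<tau>) (at \<tau>)" if \<tau>: "\<bar>\<tau>\<bar> < \<epsilon>" for \<tau>
    unfolding has_vector_derivative_def has_derivative_at_alt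
  proof (intro conjI allI impI)
    show "bounded_linear (\<lambda>x. x *\<^sub>R v \<tau>)" by (rule bounded_linear_scaleR_left)
    fix e :: real assume "e > 0"
    \<comment> \<open>The error \<open>n\<close> below satisfies n/2 <= e' * (n + (1 + norm v) *
      |h|). The bound 1/4 lets n/4 be absorbed on the left; the other bound leaves (e/4) * |h| on
      the right.\<close>
    define e' where "e' = min (1/4) (e / (4 * (1 + norm (v \<tau>))))"
    have "e' > 0" using \<open>e > 0\<close> by (auto simp: e'_def intro!: divide_pos_pos add_pos_nonneg)
    obtain d where "d > 0" and d: "\<And>q. norm (q - (\<tau>, w \<tau>)) < d \<Longrightarrow>
        norm (T q - T (\<tau>, w \<tau>) - T' (\<tau>, w \<tau>) (q - (\<tau>, w \<tau>))) \<le> e' * norm (q - (\<tau>, w \<tau>))"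
      using derT[of "(\<tau>, w \<tau>)"] \<open>e' > 0\<close> unfolding has_derivative_at_alt by blast
    have "isCont w \<tau>"
      using contw S \<tau> by (simp add: S_def continuous_on_eq_continuous_at)
    then obtain d1 where "d1 > 0" and d1: "\<And>s. \<bar>s - \<tau>\<bar> < d1 \<Longrightarrow> norm (w s - w \<tau>) < d/2"
      using \<open>d > 0\<close> unfolding continuous_at_eps_delta dist_norm real_norm_def
      by (metis half_gt_zero)
    define d2 where "d2 = Min {d1, d/2, \<epsilon> - \<bar>\<tau>\<bar>}"
    show "\<exists>d>0. \<forall>y. norm (y - \<tau>) < d \<longrightarrow> norm (w y - w \<tau> - (y - \<tau>) *\<^sub>R v \<tau>) \<le> e * norm (y - \<tau>)"
    proof (intro exI conjI allI impI)
      show "d2 > 0" using \<open>d1 > 0\<close> \<open>d > 0\<close> \<tau> by (simp add: d2_def)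
      fix s assume s: "norm (s - \<tau>) < d2"
      then have s\<epsilon>: "\<bar>s\<bar> < \<epsilon>" by (auto simp: d2_def)
      define h \<Delta> where "h = s - \<tau>" and "\<Delta> = w s - w \<tau>"
      have nq: "norm (h, \<Delta>) \<le> \<bar>h\<bar> + norm \<Delta>" using norm_Pair_le[of h \<Delta>] by simp
      have "norm (h, \<Delta>) < d"
        using nq s d1[of s] by (auto simp: h_def \<Delta>_def d2_def)
      then have *: "norm (T (s, w s) - T (\<tau>, w \<tau>) - T' (\<tau>, w \<tau>) (h, \<Delta>)) \<le> e' * norm (h, \<Delta>)"
        using d[of "(s, w s)"] by (simp add: h_def \<Delta>_def)
      have **: "T' (\<tau>, w \<tau>) (h, \<Delta>) = T' (\<tau>, w \<tau>) (0, \<Delta> - h *\<^sub>R v \<tau>) + h *\<^sub>R v \<tau>"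
      proof -
        have "(h, \<Delta>) = (0, \<Delta> - h *\<^sub>R v \<tau>) + h *\<^sub>R (1, v \<tau>)" by simp
        then show ?thesis using v[OF \<tau>] by (simp only: blinfun.add_right blinfun.scaleR_right)
      qed
      define n where "n = norm (\<Delta> - h *\<^sub>R v \<tau>)"
      have "\<Delta> - h *\<^sub>R v \<tau> = (T (s, w s) - T (\<tau>, w \<tau>) - T' (\<tau>, w \<tau>) (h, \<Delta>))
          + T' (\<tau>, w \<tau>) (0, \<Delta> - h *\<^sub>R v \<tau>)"
        using w[OF \<tau>] w[OF s\<epsilon>] ** by (simp add: \<Delta>_def)
      then have "n \<le> e' * norm (h, \<Delta>) + norm (T' (\<tau>, w \<tau>) (0, \<Delta> - h *\<^sub>R v \<tau>))"
        using * unfolding n_def by (metis add_mono norm_triangle_mono order_refl)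
      also have "\<dots> \<le> e' * norm (h, \<Delta>) + n/2"
        using half[OF \<epsilon>\<rho>[OF \<tau>] wn[OF \<tau>], of "\<Delta> - h *\<^sub>R v \<tau>"] by (simp add: n_def)
      finally have "n/2 \<le> e' * norm (h, \<Delta>)" by simp
      also have "norm \<Delta> \<le> n + \<bar>h\<bar> * norm (v \<tau>)"
        unfolding n_def using norm_triangle_ineq[of "\<Delta> - h *\<^sub>R v \<tau>" "h *\<^sub>R v \<tau>"] by simp
      then have "e' * norm (h, \<Delta>) \<le> e' * (\<bar>h\<bar> + (n + \<bar>h\<bar> * norm (v \<tau>)))"
        using nq \<open>e' > 0\<close> by (intro mult_left_mono) auto
      also have "\<dots> = e' * n + e' * (1 + norm (v \<tau>)) * \<bar>h\<bar>" by (simp add: algebra_simps)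
      also have "\<dots> \<le> 1/4 * n + e / 4 * \<bar>h\<bar>"
      proof (intro add_mono mult_right_mono)
        have p: "1 + norm (v \<tau>) > 0" by (simp add: add_pos_nonneg)
        have "e' * (1 + norm (v \<tau>)) \<le> e / (4 * (1 + norm (v \<tau>))) * (1 + norm (v \<tau>))"
          using p by (intro mult_right_mono) (auto simp: e'_def)
        also have "\<dots> = e / 4" using p by (simp add: field_simps)
        finally show "e' * (1 + norm (v \<tau>)) \<le> e / 4" .
        show "e' \<le> 1/4" unfolding e'_def by (rule min.cobounded1)
      qed (auto simp: n_def)
      finally have "n \<le> e * \<bar>h\<bar>" by simp
      then show "norm (w s - w \<tau> - (s - \<tau>) *\<^sub>R v \<tau>) \<le> e * norm (s - \<tau>)"
        by (simp add: n_def h_def \<Delta>_def)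
    qed
  qed
  have "w 0 = w0"
    using uniq[of 0 w0] \<open>\<epsilon> > 0\<close> \<open>\<rho> > 0\<close> zero by simp
  then show thesis
    using that[OF \<open>\<epsilon> > 0\<close> \<open>\<rho> > 0\<close>, of w v] w fixT uniq derw contv by (simp add: S_def)
qed

section \<open>Branches of the abstract cubic system\<close>

lemma norm_cube_diff_le:
  fixes u v :: "'x::{real_normed_algebra_1, comm_ring_1}"
  assumes "norm u \<le> R" "norm v \<le> R"
  shows "norm (u^3 - v^3) \<le> 3 * R\<^sup>2 * norm (u - v)"
proof -
  have R: "0 \<le> R" using assms(1) norm_ge_zero order_trans by blast
  have "norm (u\<^sup>2 + u * v + v\<^sup>2) \<le> norm (u\<^sup>2) + norm (u * v) + norm (v\<^sup>2)"
    by (intro norm_triangle_le add_mono order_refl)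
  also have "\<dots> \<le> R * R + R * R + R * R"
    unfolding power2_eq_square
    by (intro add_mono order_trans[OF norm_mult_ineq] mult_mono assms R norm_ge_zero)
  finally have *: "norm (u\<^sup>2 + u * v + v\<^sup>2) \<le> 3 * R\<^sup>2" by (simp add: power2_eq_square)
  have "u^3 - v^3 = (u\<^sup>2 + u * v + v\<^sup>2) * (u - v)"
    by (simp add: power2_eq_square power3_eq_cube algebra_simps)
  then have "norm (u^3 - v^3) \<le> norm (u\<^sup>2 + u * v + v\<^sup>2) * norm (u - v)"
    using norm_mult_ineq[of "u\<^sup>2 + u * v + v\<^sup>2" "u - v"] by simp
  also have "\<dots> \<le> 3 * R\<^sup>2 * norm (u - v)"
    by (intro mult_right_mono *) auto
  finally show ?thesis .
qed

text \<open>\<open>L\<close> parametrizes the kernel, \<open>K1\<close> is the solution operator,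
  and \<open>K2\<close> and \<open>P\<close> are the solution operator and the kernel coordinates
  taken after multiplication by the weight. They are separate operators because the weight, being
  only measurable, is no element of the algebra of continuous functions.\<close>

locale cubic_system =
  fixes L :: "real \<times> real \<Rightarrow> 'x::{real_normed_algebra_1, comm_ring_1, banach}"
    and K1 K2 :: "'x \<Rightarrow> 'x" and P :: "'x \<Rightarrow> real \<times> real" and A B :: real
  assumes L: "bounded_linear L" and K1: "bounded_linear K1" and K2: "bounded_linear K2"
    and P: "bounded_linear P"
    and P_cube: "\<And>x y. P (L (x, y) ^ 3) =
      (A * x^3 + 3 * B * x^2 * y + A * x * y^2 + B * y^3,
       B * x^3 + A * x^2 * y + 3 * B * x * y^2 + A * y^3)"
    and pos1: "A + 2 * B > 0" and pos2: "A - 2 * B > 0" and B_nonzero: "B \<noteq> 0"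
begin

lemma A_pos: "A > 0"
  using pos1 pos2 by linarith

text \<open>\<open>aux\<close> is the fixed point form of the auxiliary equation.
  \<open>red\<close>, below, is the kernel component of the full equation: on the kernel the linear
  part at parameter \<sigma> - \<tau> acts as multiplication by -\<tau>.\<close>

definition aux :: "real \<Rightarrow> real \<times> real \<Rightarrow> 'x \<Rightarrow> bool"
  where "aux \<tau> p y \<longleftrightarrow> y = K2 ((L p + y) ^ 3) - \<tau> *\<^sub>R K1 y"

definition red :: "real \<Rightarrow> real \<times> real \<Rightarrow> 'x \<Rightarrow> real \<times> real"
  where "red \<tau> p y = P ((L p + y) ^ 3) - \<tau> *\<^sub>R p"

definition G :: "real \<times> (real \<times> real) \<times> 'x \<Rightarrow> (real \<times> real) \<times> 'x"
  where "G = (\<lambda>(\<tau>, z, Y).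
    (P ((L z + \<tau> *\<^sub>R Y) ^ 3) - z, Y + \<tau> *\<^sub>R K1 Y - K2 ((L z + \<tau> *\<^sub>R Y) ^ 3)))"

lemma common_bound:
  obtains M where "M \<ge> 1" "\<And>p. norm (L p) \<le> M * norm p" "\<And>y. norm (K1 y) \<le> M * norm y"
    "\<And>y. norm (K2 y) \<le> M * norm y" "\<And>y. norm (P y) \<le> M * norm y"
proof -
  obtain l where l: "\<And>p. norm (L p) \<le> norm p * l" using bounded_linear.bounded[OF L] by blast
  obtain k1 where k1: "\<And>y. norm (K1 y) \<le> norm y * k1" using bounded_linear.bounded[OF K1] by blast
  obtain k2 where k2: "\<And>y. norm (K2 y) \<le> norm y * k2" using bounded_linear.bounded[OF K2] by blast
  obtain q where q: "\<And>y. norm (P y) \<le> norm y * q" using bounded_linear.bounded[OF P] by blast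
  define M where "M = Max {1, l, k1, k2, q}"
  have M: "1 \<le> M" "l \<le> M" "k1 \<le> M" "k2 \<le> M" "q \<le> M" by (auto simp: M_def)
  have le: "t * c \<le> M * t" if "c \<le> M" "0 \<le> t" for c t
    using mult_right_mono[OF that] by (simp add: mult.commute)
  show thesis
    by (rule that[of M])
      (use M in \<open>auto intro: order_trans[OF l le] order_trans[OF k1 le] order_trans[OF k2 le]
        order_trans[OF q le]\<close>)
qed

text \<open>The ball has radius \<open>norm p\<close> instead of a fixed radius, so that
  \<open>L p + y\<close> is of size \<open>norm p\<close> and the cube is small compared with the
  radius. The equation itself then improves the size of \<open>y\<close> to third order, which is
  what makes \<open>Y\<close> bounded after rescaling.\<close>

lemma small_solution:
  obtains C r where "C > 0" "r > 0"
    "\<And>\<tau> p. \<bar>\<tau>\<bar> < r \<Longrightarrow> norm p < r \<Longrightarrow> \<exists>!y. norm y \<le> norm p \<and> aux \<tau> p y"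
    "\<And>\<tau> p y. \<bar>\<tau>\<bar> < r \<Longrightarrow> norm p < r \<Longrightarrow> norm y \<le> norm p \<Longrightarrow> aux \<tau> p y \<Longrightarrow> norm y \<le> C * norm p ^ 3"
proof -
  obtain M where M: "M \<ge> 1" "\<And>p. norm (L p) \<le> M * norm p" "\<And>y. norm (K1 y) \<le> M * norm y"
    "\<And>y. norm (K2 y) \<le> M * norm y"
    using common_bound by metis
  define N where "N = M + 1"
  \<comment> \<open>The linear term contributes at most norm y / 12 and is absorbed, leaving the
    factor 12/11, rounded up to 2.\<close>
  define C where "C = 2 * M * N^3"
  \<comment> \<open>The factor 12 leaves room for the sum of cubic and linear contributions: 1/12 +
    1/12 for mapping the ball into itself, and 3/12 + 1/12 <= 1/2 for the contraction. The bound 1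
    allows \<open>norm p ^ 2\<close> to be replaced by \<open>r\<close>.\<close>
  define r where "r = min 1 (1 / (12 * M * N^3))"
  have N: "N \<ge> 2" "N > 0" using M by (auto simp: N_def)
  have C: "C > 0" and r: "r > 0" using M N by (auto simp: C_def r_def)
  have "r * (12 * M * N^3) \<le> 1"
    using M N by (simp add: r_def min_def field_simps)
  moreover have "M * 1 \<le> M * N^3" "M * N\<^sup>2 \<le> M * N^3"
    using M N by (intro mult_left_mono; simp add: power_increasing)+
  ultimately have "r * (12 * (M * 1)) \<le> 1" "r * (12 * (M * N\<^sup>2)) \<le> 1" "r * (12 * (M * N^3)) \<le> 1"
    using r mult_left_mono[of "12 * (M * 1)" "12 * (M * N^3)" r]
      mult_left_mono[of "12 * (M * N\<^sup>2)" "12 * (M * N^3)" r]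
    by (simp_all only: mult.assoc) linarith+
  then have rM: "r * M \<le> 1/12" "r * (M * N\<^sup>2) \<le> 1/12" "r * (M * N^3) \<le> 1/12" by simp_all
  have sum: "norm (L p + y) \<le> N * norm p" if "norm y \<le> norm p" for p y
    using norm_triangle_ineq[of "L p" y] M(2)[of p] that by (simp add: N_def algebra_simps)
  have cube: "norm (K2 ((L p + y)^3)) \<le> M * N^3 * norm p ^ 3" if "norm y \<le> norm p" for p y
  proof -
    have "norm ((L p + y)^3) \<le> norm (L p + y) ^ 3" by (rule norm_power_ineq)
    also have "\<dots> \<le> (N * norm p) ^ 3" by (intro power_mono sum that) auto
    finally have "M * norm ((L p + y)^3) \<le> M * (N * norm p)^3"
      using M by (intro mult_left_mono) auto
    then show ?thesis using M(4)[of "(L p + y)^3"] by (simp add: power_mult_distrib)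
  qed
  have lin: "norm (\<tau> *\<^sub>R K1 y) \<le> norm y / 12" if "\<bar>\<tau>\<bar> < r" for \<tau> y
  proof -
    have "norm (\<tau> *\<^sub>R K1 y) \<le> r * (M * norm y)"
      using that M by (simp add: mult_mono)
    also have "\<dots> \<le> 1/12 * norm y"
      using mult_right_mono[OF rM(1), of "norm y"] by (simp add: mult.assoc)
    finally show ?thesis by simp
  qed
  define \<Phi> where "\<Phi> \<tau> p y = K2 ((L p + y) ^ 3) - \<tau> *\<^sub>R K1 y" for \<tau> p y
  have self: "norm (\<Phi> \<tau> p y) \<le> norm p" if "\<bar>\<tau>\<bar> < r" "norm p < r" "norm y \<le> norm p" for \<tau> p y
  proof -
    have "M * N^3 * norm p ^ 3 = norm p ^ 2 * (M * N^3) * norm p"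
      by (simp add: power2_eq_square power3_eq_cube)
    also have "norm p ^ 2 \<le> r"
      using that r power_mono[of "norm p" r 2] mult_left_mono[of r 1 r]
      by (simp add: power2_eq_square r_def)
    then have "norm p ^ 2 * (M * N^3) * norm p \<le> r * (M * N^3) * norm p"
      using M N by (intro mult_right_mono) auto
    also have "\<dots> \<le> 1/12 * norm p" by (intro mult_right_mono rM) auto
    finally have "M * N^3 * norm p ^ 3 \<le> norm p / 12" by simp
    then show ?thesis
      using norm_triangle_ineq4[of "K2 ((L p + y) ^ 3)" "\<tau> *\<^sub>R K1 y"] cube[OF that(3)] lin[OF that(1), of y] that(3)
        norm_ge_zero[of p]
      unfolding \<Phi>_def by linarith
  qed
  have lip: "norm (\<Phi> \<tau> p x - \<Phi> \<tau> p y) \<le> 1/2 * norm (x - y)"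
    if "\<bar>\<tau>\<bar> < r" "norm p < r" "norm x \<le> norm p" "norm y \<le> norm p" for \<tau> p x y
  proof -
    have "norm ((L p + x)^3 - (L p + y)^3) \<le> 3 * (N * norm p)\<^sup>2 * norm (x - y)"
      using norm_cube_diff_le[OF sum[OF that(3)] sum[OF that(4)]] by simp
    then have "norm (K2 ((L p + x)^3 - (L p + y)^3)) \<le> M * (3 * (N * norm p)\<^sup>2 * norm (x - y))"
      using M by (meson mult_left_mono order_trans zero_le_one)
    also have "\<dots> = 3 * (norm p ^ 2 * (M * N\<^sup>2)) * norm (x - y)"
      by (simp add: power_mult_distrib)
    also have "norm p ^ 2 \<le> r"
      using that r power_mono[of "norm p" r 2] mult_left_mono[of r 1 r]
      by (simp add: power2_eq_square r_def)
    then have "3 * (norm p ^ 2 * (M * N\<^sup>2)) * norm (x - y) \<le> 3 * (r * (M * N\<^sup>2)) * norm (x - y)"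
      using M N by (intro mult_right_mono mult_left_mono) auto
    also have "\<dots> \<le> 3 * (1/12) * norm (x - y)"
      by (intro mult_right_mono mult_left_mono rM) auto
    finally have *: "norm (K2 ((L p + x)^3 - (L p + y)^3)) \<le> norm (x - y) / 4" by simp
    have "\<Phi> \<tau> p x - \<Phi> \<tau> p y = K2 ((L p + x)^3 - (L p + y)^3) - \<tau> *\<^sub>R K1 (x - y)"
      by (simp add: \<Phi>_def linear_diff[OF bounded_linear.linear[OF K1]]
          linear_diff[OF bounded_linear.linear[OF K2]] algebra_simps)
    then have "norm (\<Phi> \<tau> p x - \<Phi> \<tau> p y)
        \<le> norm (K2 ((L p + x)^3 - (L p + y)^3)) + norm (\<tau> *\<^sub>R K1 (x - y))"
      using norm_triangle_ineq4 by metis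
    then show ?thesis using * lin[OF that(1), of "x - y"] norm_ge_zero[of "x - y"] by linarith
  qed
  show thesis
  proof (rule that[OF C r])
    fix \<tau> p assume tp: "\<bar>\<tau>\<bar> < r" "norm (p :: real \<times> real) < r"
    have "\<exists>!y. y \<in> cball 0 (norm p) \<and> \<Phi> \<tau> p y = y"
      by (rule Banach_fix[where c = "1/2"])
        (use self[OF tp] lip[OF tp] in \<open>auto simp: complete_eq_closed dist_norm\<close>)
    then show "\<exists>!y. norm y \<le> norm p \<and> aux \<tau> p y"
      by (simp add: aux_def \<Phi>_def dist_norm eq_commute)
  next
    fix \<tau> p y assume h: "\<bar>\<tau>\<bar> < r" "norm (p :: real \<times> real) < r" "norm y \<le> norm p" "aux \<tau> p y"
    have "norm y \<le> M * N^3 * norm p ^ 3 + norm y / 12"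
      using norm_triangle_ineq4[of "K2 ((L p + y) ^ 3)" "\<tau> *\<^sub>R K1 y"] cube[OF h(3)] lin[OF h(1), of y] h(4)
      unfolding aux_def by simp
    moreover have "M * N^3 * norm p ^ 3 \<ge> 0" using M N by simp
    ultimately show "norm y \<le> C * norm p ^ 3" by (simp add: C_def)
  qed
qed

text \<open>Weight count: with y = s^3 Y the argument of the cube is s times (L z + s^2 Y), and
  every term of both equations carries exactly the factor s^3. After division \<open>s\<close>
  survives only as s^2.\<close>

lemma scaled_system:
  assumes "s > 0"
  shows "aux (s\<^sup>2) (s *\<^sub>R z) (s^3 *\<^sub>R Y) \<and> red (s\<^sup>2) (s *\<^sub>R z) (s^3 *\<^sub>R Y) = 0
    \<longleftrightarrow> G (s\<^sup>2, z, Y) = 0"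
proof -
  have "L (s *\<^sub>R z) + s^3 *\<^sub>R Y = s *\<^sub>R (L z + s\<^sup>2 *\<^sub>R Y)"
    by (simp add: linear_cmul[OF bounded_linear.linear[OF L]] scaleR_add_right power2_eq_square power3_eq_cube)
  then have *: "(L (s *\<^sub>R z) + s^3 *\<^sub>R Y)^3 = s^3 *\<^sub>R (L z + s\<^sup>2 *\<^sub>R Y)^3"
    by (simp add: scaleR_power)
  have aux: "aux (s\<^sup>2) (s *\<^sub>R z) (s^3 *\<^sub>R Y) \<longleftrightarrow>
      s^3 *\<^sub>R Y = s^3 *\<^sub>R (K2 ((L z + s\<^sup>2 *\<^sub>R Y)^3) - s\<^sup>2 *\<^sub>R K1 Y)"
    unfolding aux_def * linear_cmul[OF bounded_linear.linear[OF K2]]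
      linear_cmul[OF bounded_linear.linear[OF K1]]
    by (simp add: scaleR_diff_right mult.commute)
  have red: "red (s\<^sup>2) (s *\<^sub>R z) (s^3 *\<^sub>R Y) = s^3 *\<^sub>R (P ((L z + s\<^sup>2 *\<^sub>R Y)^3) - z)"
    unfolding red_def * linear_cmul[OF bounded_linear.linear[OF P]]
    by (simp add: scaleR_diff_right power2_eq_square power3_eq_cube mult.assoc)
  have "s^3 \<noteq> 0" using assms by simp
  then have "aux (s\<^sup>2) (s *\<^sub>R z) (s^3 *\<^sub>R Y) \<and> red (s\<^sup>2) (s *\<^sub>R z) (s^3 *\<^sub>R Y) = 0 \<longleftrightarrow>
      Y = K2 ((L z + s\<^sup>2 *\<^sub>R Y)^3) - s\<^sup>2 *\<^sub>R K1 Y \<and> P ((L z + s\<^sup>2 *\<^sub>R Y)^3) - z = 0"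
    unfolding aux red scaleR_cancel_left scaleR_eq_0_iff by blast
  also have "\<dots> \<longleftrightarrow> G (s\<^sup>2, z, Y) = 0"
    unfolding G_def prod_eq_iff[of _ "0 :: (real \<times> real) \<times> 'x"]
    by (simp only: prod.case fst_conv snd_conv fst_zero snd_zero eq_diff_eq right_minus_eq) blast
  finally show ?thesis .
qed

lemma C1_map_G: "C1_map G"
proof -
  have fs: "C1_map (fst :: real \<times> (real \<times> real) \<times> 'x \<Rightarrow> _)"
    by (intro C1_map_linear bounded_linear_fst)
  have z: "C1_map (\<lambda>q :: real \<times> (real \<times> real) \<times> 'x. fst (snd q))"
    and Y: "C1_map (\<lambda>q :: real \<times> (real \<times> real) \<times> 'x. snd (snd q))"
    by (intro C1_map_linear bounded_linear_fst_comp bounded_linear_snd_comp bounded_linear_snd)+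
  have "C1_map (\<lambda>q :: real \<times> (real \<times> real) \<times> 'x. (P ((L (fst (snd q)) + fst q *\<^sub>R snd (snd q)) ^ 3) - fst (snd q),
      snd (snd q) + fst q *\<^sub>R K1 (snd (snd q)) - K2 ((L (fst (snd q)) + fst q *\<^sub>R snd (snd q)) ^ 3)))"
    by (intro C1_map_Pair C1_map_diff C1_map_add C1_map_scaleR C1_map_power fs z Y
        C1_map_linear_compose[OF L] C1_map_linear_compose[OF K1] C1_map_linear_compose[OF K2]
        C1_map_linear_compose[OF P])
  then show ?thesis by (simp add: G_def case_prod_beta')
qed

text \<open>Bundles the conclusion of the implicit curve theorem, so that data for four indices can
  be chosen at once. The second component of the starting point is forced: at \<tau> = 0 the second
  equation reads Y = K2 (L z ^ 3).\<close>

definition is_branch :: "real \<times> real \<Rightarrow> real \<Rightarrow> real \<Rightarrow> (real \<Rightarrow> (real \<times> real) \<times> 'x)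
    \<Rightarrow> (real \<Rightarrow> (real \<times> real) \<times> 'x) \<Rightarrow> bool"
  where "is_branch z0 \<epsilon> \<rho> w v \<longleftrightarrow> 0 < \<epsilon> \<and> 0 < \<rho> \<and> w 0 = (z0, K2 (L z0 ^ 3)) \<and>
    (\<forall>\<tau>. \<bar>\<tau>\<bar> < \<epsilon> \<longrightarrow> G (\<tau>, w \<tau>) = 0) \<and>
    (\<forall>\<tau> x. \<bar>\<tau>\<bar> < \<epsilon> \<longrightarrow> norm (x - (z0, K2 (L z0 ^ 3))) \<le> \<rho> \<longrightarrow> G (\<tau>, x) = 0 \<longrightarrow> x = w \<tau>) \<and>
    (\<forall>\<tau>. \<bar>\<tau>\<bar> < \<epsilon> \<longrightarrow> (w has_vector_derivative v \<tau>) (at \<tau>)) \<and> continuous_on {-\<epsilon><..<\<epsilon>} v"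

text \<open>\<open>e1\<close> and \<open>e2\<close> are the eigenvalues of the planar linearization
  along (1, 1) and (1, -1). At \<tau> = 0 the first equation does not involve \<open>Y\<close>, so
  the full linearization is block triangular and invertible as soon as both are nonzero.\<close>

lemma branch:
  fixes z0 :: "real \<times> real" and e1 e2 :: real
  assumes z0: "P (L z0 ^ 3) = z0" and e: "e1 \<noteq> 0" "e2 \<noteq> 0"
    and D: "((\<lambda>z. P (L z ^ 3) - z) has_derivative
      (\<lambda>h. ((e1 * (fst h + snd h) + e2 * (fst h - snd h)) / 2,
            (e1 * (fst h + snd h) - e2 * (fst h - snd h)) / 2))) (at z0)"
  shows "\<exists>\<epsilon> \<rho> w v. is_branch z0 \<epsilon> \<rho> w v"
proof -
  define w0 where "w0 = (z0, K2 (L z0 ^ 3))"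
  obtain G' where G': "\<And>x. (G has_derivative blinfun_apply (G' x)) (at x)" "continuous_on UNIV G'"
    using C1_map_G unfolding C1_map_def by blast
  have "C1_map (\<lambda>z. K2 (L z ^ 3))"
    by (intro C1_map_power C1_map_linear_compose[OF K2] C1_map_linear[OF L])
  then obtain d where d: "\<And>z. ((\<lambda>z. K2 (L z ^ 3)) has_derivative blinfun_apply (d z)) (at z)"
    unfolding C1_map_def by blast
  define E where "E h = ((e1 * (fst h + snd h) + e2 * (fst h - snd h)) / 2,
            (e1 * (fst h + snd h) - e2 * (fst h - snd h)) / 2)" for h :: "real \<times> real"
  define F where "F h = (((fst h + snd h) / e1 + (fst h - snd h) / e2) / 2,
            ((fst h + snd h) / e1 - (fst h - snd h) / e2) / 2)" for h :: "real \<times> real"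
  have EF: "E (F h) = h" "F (E h) = h" for h
    using e by (auto simp: E_def F_def field_simps prod_eq_iff)
  have linF: "bounded_linear F"
    unfolding linear_conv_bounded_linear[symmetric] F_def
    by (rule linearI) (simp_all add: add_divide_distrib diff_divide_distrib algebra_simps)
  \<comment> \<open>Inverse of the block triangular map (h, y) -> (E h, y - d h), by back
    substitution.\<close>
  define Bop where "Bop = (\<lambda>(h, y). (F h, y + d z0 (F h)))"
  have linB: "bounded_linear Bop"
    unfolding Bop_def case_prod_beta'
    by (intro bounded_linear_Pair bounded_linear_add bounded_linear_compose[OF linF] bounded_linear_snd bounded_linear_fst
        bounded_linear_compose[OF blinfun.bounded_linear_right])
  have G'0: "G' (0, w0) (0, h) = (E (fst h), snd h - d z0 (fst h))" for h
  proof -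
    have "((\<lambda>x. G (0, x)) has_derivative (\<lambda>h. G' (0, w0) (0, h))) (at w0)"
      by (rule has_derivative_compose[of "\<lambda>z. (0, z)" "\<lambda>h. (0, h)", OF _ G'(1)])
        (auto intro!: derivative_eq_intros)
    moreover have "((\<lambda>x. G (0, x)) has_derivative (\<lambda>h. (E (fst h), snd h - d z0 (fst h)))) (at w0)"
    proof -
      have D': "((\<lambda>z. P (L z ^ 3) - z) has_derivative E) (at (fst w0))"
        using D by (simp add: E_def[abs_def] w0_def)
      have d': "((\<lambda>z. K2 (L z ^ 3)) has_derivative d z0) (at (fst w0))"
        using d[of z0] by (simp add: w0_def)
      have f: "(fst has_derivative fst) (at w0)"
        by (rule bounded_linear_imp_has_derivative[OF bounded_linear_fst])
      have s: "(snd has_derivative snd) (at w0)"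
        by (rule bounded_linear_imp_has_derivative[OF bounded_linear_snd])
      have "((\<lambda>x. (P (L (fst x) ^ 3) - fst x, snd x - K2 (L (fst x) ^ 3))) has_derivative
          (\<lambda>h. (E (fst h), snd h - d z0 (fst h)))) (at w0)"
        by (intro has_derivative_Pair has_derivative_diff s has_derivative_compose[OF f D']
            has_derivative_compose[OF f d'])
      then show ?thesis by (simp add: G_def case_prod_beta')
    qed
    ultimately have "(\<lambda>h. G' (0, w0) (0, h)) = (\<lambda>h. (E (fst h), snd h - d z0 (fst h)))"
      by (rule has_derivative_unique)
    then show ?thesis by (rule fun_cong)
  qed
  have zero: "G (0, w0) = 0"
    by (simp add: G_def w0_def z0 zero_prod_def)
  have inj: "x = 0" if "Bop x = 0" for x
  proof -
    have "F (fst x) = 0" using that by (auto simp: Bop_def zero_prod_def split: prod.splits)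
    then have "fst x = 0" using EF(1)[of "fst x"] by (simp add: E_def zero_prod_def)
    moreover have "snd x = 0"
      using that \<open>F (fst x) = 0\<close> by (simp add: Bop_def case_prod_beta' prod_eq_iff blinfun.zero_right)
    ultimately show ?thesis by (simp add: prod_eq_iff)
  qed
  have inv: "Bop (G' (0, w0) (0, h)) = h" for h
    by (simp add: G'0 Bop_def EF)
  show ?thesis
    unfolding is_branch_def w0_def[symmetric]
    by (rule implicit_curve[OF G' zero linB inj inv], assumption) blast
qed


section \<open>The planar cubic map: fixed points, nondegeneracy, coercivity\<close>

definition zb :: "nat \<Rightarrow> real \<times> real"
  where "zb i =
     (let p = 1 / sqrt (2 * (A + 2 * B)); m = 1 / sqrt (2 * (A - 2 * B))
      in if i = 1 then (p, p) else if i = 2 then - (p, p)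
         else if i = 3 then (m, - m) else - (m, - m))"

lemma range4: "i \<in> {1..4} \<longleftrightarrow> i = 1 \<or> i = 2 \<or> i = 3 \<or> i = (4::nat)"
  by auto

text \<open>Points of opposite sign satisfy the same equation for \<open>x\<close>, so every later
  computation needs one case for each diagonal only.\<close>

lemma zb_cases:
  assumes "i \<in> {1..4}"
  obtains x where "zb i = (x, x)" "2 * (A + 2 * B) * x\<^sup>2 = 1"
  | x where "zb i = (x, - x)" "2 * (A - 2 * B) * x\<^sup>2 = 1"
proof -
  define p m where "p = 1 / sqrt (2 * (A + 2 * B))" and "m = 1 / sqrt (2 * (A - 2 * B))"
  have pm: "2 * (A + 2 * B) * p\<^sup>2 = 1" "2 * (A - 2 * B) * m\<^sup>2 = 1"
    using pos1 pos2 by (auto simp: p_def m_def power_divide real_sqrt_pow2)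
  have "zb i = (p, p) \<or> zb i = (- p, - p) \<or> zb i = (m, - m) \<or> zb i = (- m, - (- m))"
    by (simp add: zb_def p_def m_def Let_def)
  then show thesis
    using that(1)[of p] that(1)[of "- p"] that(2)[of m] that(2)[of "- m"] pm by auto
qed

lemma sqrt_solutions:
  fixes q x :: real
  assumes "q > 0" "q * x\<^sup>2 = 1"
  shows "x = 1 / sqrt q \<or> x = - (1 / sqrt q)"
proof -
  have "(x * sqrt q)\<^sup>2 = 1" using assms by (simp add: power_mult_distrib mult.commute)
  then have "x * sqrt q = 1 \<or> x * sqrt q = - 1" by (simp add: power2_eq_1_iff)
  then show ?thesis using assms(1) by (auto simp: field_simps)
qed

lemma in_zb_image:
  "2 * (A + 2 * B) * x\<^sup>2 = 1 \<Longrightarrow> (x, x) \<in> zb ` {1..4}"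
  "2 * (A - 2 * B) * x\<^sup>2 = 1 \<Longrightarrow> (x, - x) \<in> zb ` {1..4}"
proof -
  assume "2 * (A + 2 * B) * x\<^sup>2 = 1"
  then have "(x, x) = zb 1 \<or> (x, x) = zb 2"
    using sqrt_solutions[of "2 * (A + 2 * B)" x] pos1 by (auto simp: zb_def Let_def)
  then show "(x, x) \<in> zb ` {1..4}" by (elim disjE) (simp_all add: image_eqI[where x = 1] image_eqI[where x = 2])
next
  assume "2 * (A - 2 * B) * x\<^sup>2 = 1"
  then have "(x, - x) = zb 3 \<or> (x, - x) = zb 4"
    using sqrt_solutions[of "2 * (A - 2 * B)" x] pos2 by (auto simp: zb_def Let_def)
  then show "(x, - x) \<in> zb ` {1..4}" by (elim disjE) (simp_all add: image_eqI[where x = 3] image_eqI[where x = 4])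
qed

lemma inj_on_zb: "inj_on zb {1..4}"
proof -
  have "1 / sqrt (2 * (A + 2 * B)) > 0" "1 / sqrt (2 * (A - 2 * B)) > 0"
    using pos1 pos2 by simp_all
  then show ?thesis
    unfolding inj_on_def range4 zb_def Let_def by auto
qed

lemma zb_nonzero: "i \<in> {1..4} \<Longrightarrow> zb i \<noteq> 0"
  by (erule zb_cases) (auto simp: zero_prod_def)

lemma zb_fixed:
  assumes "i \<in> {1..4}"
  shows "P (L (zb i) ^ 3) = zb i"
  using assms
proof (cases rule: zb_cases)
  case (1 x)
  have "A * x^3 + 3 * B * x^2 * x + A * x * x^2 + B * x^3 = (2 * (A + 2 * B) * x\<^sup>2) * x"
    by (simp add: power2_eq_square power3_eq_cube algebra_simps)
  moreover have "B * x^3 + A * x^2 * x + 3 * B * x * x^2 + A * x^3 = (2 * (A + 2 * B) * x\<^sup>2) * x"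
    by (simp add: power2_eq_square power3_eq_cube algebra_simps)
  ultimately show ?thesis using 1 by (simp add: P_cube)
next
  case (2 x)
  have "A * x^3 + 3 * B * x^2 * (- x) + A * x * (- x)^2 + B * (- x)^3 = (2 * (A - 2 * B) * x\<^sup>2) * x"
    by (simp add: power2_eq_square power3_eq_cube algebra_simps)
  moreover have "B * x^3 + A * x^2 * (- x) + 3 * B * x * (- x)^2 + A * (- x)^3 = - ((2 * (A - 2 * B) * x\<^sup>2) * x)"
    by (simp add: power2_eq_square power3_eq_cube algebra_simps)
  ultimately show ?thesis using 2 by (simp add: P_cube)
qed

(* In s = x + y and d = x - y each equation has a factor s or d; if neither vanishes, subtracting
   the remaining factors leaves B (s^2 + d^2) = 0. *)
lemma fixed_imp_zb:
  assumes fp: "P (L z ^ 3) = z" and nz: "z \<noteq> 0"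
  shows "z \<in> zb ` {1..4}"
proof -
  obtain x y where z: "z = (x, y)" by (cases z)
  define s d where "s = x + y" and "d = x - y"
  have e1: "A * x^3 + 3 * B * x^2 * y + A * x * y^2 + B * y^3 = x"
    and e2: "B * x^3 + A * x^2 * y + 3 * B * x * y^2 + A * y^3 = y"
    using fp by (simp_all add: z P_cube)
  have "(A * x^3 + 3 * B * x^2 * y + A * x * y^2 + B * y^3)
      + (B * x^3 + A * x^2 * y + 3 * B * x * y^2 + A * y^3)
      = s * ((A + 2 * B) / 2 * s\<^sup>2 + A / 2 * d\<^sup>2)"
    by (simp add: s_def d_def power2_eq_square power3_eq_cube field_simps)
  then have s: "s * ((A + 2 * B) / 2 * s\<^sup>2 + A / 2 * d\<^sup>2) = s"
    using e1 e2 by (simp add: s_def)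
  have "(A * x^3 + 3 * B * x^2 * y + A * x * y^2 + B * y^3)
      - (B * x^3 + A * x^2 * y + 3 * B * x * y^2 + A * y^3)
      = d * (A / 2 * s\<^sup>2 + (A - 2 * B) / 2 * d\<^sup>2)"
    by (simp add: s_def d_def power2_eq_square power3_eq_cube field_simps)
  then have d: "d * (A / 2 * s\<^sup>2 + (A - 2 * B) / 2 * d\<^sup>2) = d"
    using e1 e2 by (simp add: d_def)
  consider "s = 0" "d = 0" | "s = 0" "d \<noteq> 0" | "s \<noteq> 0" "d = 0" | "s \<noteq> 0" "d \<noteq> 0" by blast
  then show ?thesis
  proof cases
    case 1
    then show ?thesis using nz by (auto simp: z s_def d_def zero_prod_def)
  next
    case 2
    then have "y = - x" "d = 2 * x" by (auto simp: s_def d_def)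
    moreover have "(A - 2 * B) / 2 * d\<^sup>2 = 1" using d 2 by simp
    ultimately have "2 * (A - 2 * B) * x\<^sup>2 = 1" by (simp add: power_mult_distrib algebra_simps)
    then show ?thesis using in_zb_image(2) \<open>y = - x\<close> by (simp add: z)
  next
    case 3
    then have "y = x" "s = 2 * x" by (auto simp: s_def d_def)
    moreover have "(A + 2 * B) / 2 * s\<^sup>2 = 1" using s 3 by simp
    ultimately have "2 * (A + 2 * B) * x\<^sup>2 = 1" by (simp add: power_mult_distrib algebra_simps)
    then show ?thesis using in_zb_image(1) \<open>y = x\<close> by (simp add: z)
  next
    case 4
    then have "(A + 2 * B) / 2 * s\<^sup>2 + A / 2 * d\<^sup>2 = 1" "A / 2 * s\<^sup>2 + (A - 2 * B) / 2 * d\<^sup>2 = 1"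
      using s d by simp_all
    then have "((A + 2 * B) / 2 * s\<^sup>2 + A / 2 * d\<^sup>2) - (A / 2 * s\<^sup>2 + (A - 2 * B) / 2 * d\<^sup>2) = 0" by simp
    also have "((A + 2 * B) / 2 * s\<^sup>2 + A / 2 * d\<^sup>2) - (A / 2 * s\<^sup>2 + (A - 2 * B) / 2 * d\<^sup>2)
        = B * (s\<^sup>2 + d\<^sup>2)"
      by (simp add: field_simps)
    finally show ?thesis using B_nonzero 4 by (simp add: sum_power2_eq_zero_iff)
  qed
qed

text \<open>The matrix is symmetric because the cubic map is the gradient of the quartic form A/4
  x^4 + B x^3 y + A/2 x^2 y^2 + B x y^3 + A/4 y^4.\<close>

lemma cube_has_derivative:
  "((\<lambda>z. P (L z ^ 3) - z) has_derivative
    (\<lambda>h. ((3 * A * x\<^sup>2 + 6 * B * x * y + A * y\<^sup>2 - 1) * fst h + (3 * B * x\<^sup>2 + 2 * A * x * y + 3 * B * y\<^sup>2) * snd h,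
          (3 * B * x\<^sup>2 + 2 * A * x * y + 3 * B * y\<^sup>2) * fst h + (A * x\<^sup>2 + 6 * B * x * y + 3 * A * y\<^sup>2 - 1) * snd h)))
    (at (x, y))"
proof -
  have "P (L z ^ 3) - z =
      (A * fst z^3 + 3 * B * fst z^2 * snd z + A * fst z * snd z^2 + B * snd z^3 - fst z,
       B * fst z^3 + A * fst z^2 * snd z + 3 * B * fst z * snd z^2 + A * snd z^3 - snd z)" for z
    using P_cube[of "fst z" "snd z"] by (simp add: prod_eq_iff)
  then show ?thesis
    by (simp only:) (auto intro!: has_derivative_Pair derivative_eq_intros has_derivative_fst has_derivative_snd simp: fun_eq_iff power2_eq_square algebra_simps)
qed

text \<open>On a diagonal both diagonal entries of the Jacobian agree, so (1, 1) and (1, -1) are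
  eigenvectors. The radial eigenvalue is 3 - 1 = 2 by homogeneity; the transverse one,
  \<open>e\<close>, equals -4 B x^2 or 4 B x^2 according to the diagonal. This is where
  \<open>B\<close> must not vanish.\<close>

lemma zb_branch:
  assumes "i \<in> {1..4}"
  shows "\<exists>\<epsilon> \<rho> w v. is_branch (zb i) \<epsilon> \<rho> w v"
  using assms
proof (cases rule: zb_cases)
  case (1 x)
  define e where "e = 2 * A * x\<^sup>2 - 1"
  have x: "3 * A * x\<^sup>2 + 6 * B * x * x + A * x\<^sup>2 - 1 = (2 + e) / 2"
    "3 * B * x\<^sup>2 + 2 * A * x * x + 3 * B * x\<^sup>2 = (2 - e) / 2"
    "A * x\<^sup>2 + 6 * B * x * x + 3 * A * x\<^sup>2 - 1 = (2 + e) / 2"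
    using 1(2) by (simp_all add: e_def power2_eq_square field_simps)
  have "e = - 4 * B * x\<^sup>2" "x \<noteq> 0" using 1(2) by (auto simp: e_def algebra_simps)
  then have "e \<noteq> 0" using B_nonzero by simp
  then show ?thesis
    by (rule branch[OF zb_fixed[OF assms], of 2 e, rotated])
      (unfold 1(1), rule has_derivative_eq_rhs[OF cube_has_derivative[of x x, unfolded x]],
        simp_all add: fun_eq_iff field_simps)
next
  case (2 x)
  define e where "e = 2 * A * x\<^sup>2 - 1"
  have x: "3 * A * x\<^sup>2 + 6 * B * x * (- x) + A * (- x)\<^sup>2 - 1 = (e + 2) / 2"
    "3 * B * x\<^sup>2 + 2 * A * x * (- x) + 3 * B * (- x)\<^sup>2 = (e - 2) / 2"
    "A * x\<^sup>2 + 6 * B * x * (- x) + 3 * A * (- x)\<^sup>2 - 1 = (e + 2) / 2"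
    using 2(2) by (simp_all add: e_def power2_eq_square field_simps)
  have "e = 4 * B * x\<^sup>2" "x \<noteq> 0" using 2(2) by (auto simp: e_def algebra_simps)
  then have "e \<noteq> 0" using B_nonzero by simp
  then show ?thesis
    by (rule branch[OF zb_fixed[OF assms], of e 2])
      (unfold 2(1), simp, rule has_derivative_eq_rhs[OF cube_has_derivative[of x "- x", unfolded x]],
        simp_all add: fun_eq_iff field_simps)
qed

text \<open>Pairing the cubic map with \<open>p\<close> gives a quartic form which, in the
  coordinates s = x + y and d = x - y, has only nonnegative terms: its coefficients are (A + 2B)/4,
  (A - 2B)/4 and A/2.\<close>

lemma cubic_coercive:
  obtains c where "c > 0" "\<And>p. c * norm p ^ 3 \<le> norm (P (L p ^ 3))"
proof -
  define m where "m = min (A + 2 * B) (A - 2 * B) / 4"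
  have m: "m > 0" "m \<le> (A + 2 * B) / 4" "m \<le> (A - 2 * B) / 4"
    using pos1 pos2 by (auto simp: m_def)
  have "2 * m * norm p ^ 3 \<le> norm (P (L p ^ 3))" for p
  proof (cases "p = 0")
    case False
    obtain x y where p: "p = (x, y)" by (cases p)
    define s d where "s = x + y" and "d = x - y"
    have "(s\<^sup>2 + d\<^sup>2)\<^sup>2 \<le> 2 * (s^4 + d^4)"
      using sum_squares_ge_zero[of "s\<^sup>2 - d\<^sup>2" 0] by (simp add: power2_eq_square power4_eq_xxxx algebra_simps)
    moreover have "s\<^sup>2 + d\<^sup>2 = 2 * (norm p)\<^sup>2"
      by (simp add: s_def d_def p norm_Pair power2_eq_square algebra_simps)
    ultimately have "2 * (norm p)^4 \<le> s^4 + d^4"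
      by (simp add: power_mult_distrib flip: power_mult)
    then have "m * (2 * (norm p)^4) \<le> m * (s^4 + d^4)" using m by simp
    also have "\<dots> \<le> (A + 2 * B) / 4 * s^4 + (A - 2 * B) / 4 * d^4"
      using mult_right_mono[OF m(2), of "s^4"] mult_right_mono[OF m(3), of "d^4"]
      by (simp add: distrib_left)
    also have "\<dots> \<le> (A + 2 * B) / 4 * s^4 + (A - 2 * B) / 4 * d^4 + A / 2 * (s\<^sup>2 * d\<^sup>2)"
      using A_pos by simp
    also have "\<dots> = p \<bullet> P (L p ^ 3)"
      unfolding p P_cube inner_Pair inner_real_def s_def d_def
      by (simp add: power2_eq_square power3_eq_cube power4_eq_xxxx field_simps)
    also have "\<dots> \<le> norm p * norm (P (L p ^ 3))" by (rule norm_cauchy_schwarz)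
    finally have "norm p * (2 * m * norm p ^ 3) \<le> norm p * norm (P (L p ^ 3))"
      by (simp add: power3_eq_cube power4_eq_xxxx mult_ac)
    then show ?thesis using False by simp
  qed auto
  then show thesis using that[of "2 * m"] m by simp
qed

text \<open>Compactness, by contradiction with a sequence \<tau> -> 0. Bounded \<open>z\<close> have
  a convergent subsequence in the plane. No compactness is available for \<open>Y\<close>, but the
  second equation expresses \<open>Y\<close> through convergent quantities. The limit is a fixed
  point of the cubic map, and it is not zero.\<close>

lemma zeros_converge_to_zb:
  assumes "C \<ge> 0" "R \<ge> 0" "\<rho> > 0"
  obtains \<delta> where "\<delta> > 0"
    "\<And>\<tau> z Y. 0 < \<tau> \<Longrightarrow> \<tau> < \<delta> \<Longrightarrow> z \<noteq> 0 \<Longrightarrow> norm z \<le> R \<Longrightarrow> norm Y \<le> C * norm z ^ 3 \<Longrightarrow>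
      G (\<tau>, z, Y) = 0 \<Longrightarrow> \<exists>i\<in>{1..4}. norm ((z, Y) - (zb i, K2 (L (zb i) ^ 3))) \<le> \<rho>"
proof (rule ccontr)
  assume "\<not> thesis"
  have "\<exists>\<tau> z Y. 0 < \<tau> \<and> \<tau> < 1 / Suc n \<and> z \<noteq> 0 \<and> norm z \<le> R \<and> norm Y \<le> C * norm z ^ 3 \<and>
      G (\<tau>, z, Y) = 0 \<and> (\<forall>i\<in>{1..4}. norm ((z, Y) - (zb i, K2 (L (zb i) ^ 3))) > \<rho>)" for n :: nat
  proof -
    have "0 < 1 / real (Suc n)" by simp
    from that[OF this] \<open>\<not> thesis\<close> show ?thesis by (meson not_le)
  qed
  then obtain t z Y where t: "\<And>n. 0 < t n" "\<And>n::nat. t n < 1 / Suc n"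
    and z: "\<And>n. z n \<noteq> 0" "\<And>n. norm (z n) \<le> R" and Y: "\<And>n. norm (Y n) \<le> C * norm (z n) ^ 3"
    and G0: "\<And>n. G (t n, z n, Y n) = 0"
    and far: "\<And>n i. i \<in> {1..4} \<Longrightarrow> norm ((z n, Y n) - (zb i, K2 (L (zb i) ^ 3))) > \<rho>"
    by metis
  obtain M where M: "M \<ge> 1" "\<And>p. norm (L p) \<le> M * norm p" "\<And>y. norm (P y) \<le> M * norm y"
    using common_bound by metis
  have z_eq: "z n = P ((L (z n) + t n *\<^sub>R Y n) ^ 3)" for n
    using G0[of n] by (simp add: G_def prod_eq_iff)
  \<comment> \<open>The scalar is moved inside \<open>K1\<close>, since
    \<open>t n *\<^sub>R Y n\<close> tends to zero before anything is known about the convergence of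
    \<open>Y n\<close>.\<close>
  have Y_eq: "Y n = K2 ((L (z n) + t n *\<^sub>R Y n) ^ 3) - K1 (t n *\<^sub>R Y n)" for n
    using G0[of n] linear_cmul[OF bounded_linear.linear[OF K1], of "t n" "Y n"]
    by (simp add: G_def prod_eq_iff algebra_simps)
  have "\<exists>l\<in>cball 0 R. \<exists>r. strict_mono (r :: nat \<Rightarrow> nat) \<and> (z \<circ> r) \<longlonglongrightarrow> l"
    using compact_cball[of "0 :: real \<times> real" R] z(2) unfolding compact_def by (auto simp: dist_norm)
  then obtain l r where r: "strict_mono r" and "(z \<circ> r) \<longlonglongrightarrow> l"
    by blast
  then have zl: "(\<lambda>n. z (r n)) \<longlonglongrightarrow> l" by (simp add: o_def)
  have "(\<lambda>n. t n) \<longlonglongrightarrow> 0"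
    by (rule tendsto_sandwich[OF _ _ tendsto_const LIMSEQ_Suc[OF lim_1_over_n]])
      (use t in \<open>auto intro!: always_eventually less_imp_le simp: less_imp_le\<close>)
  then have t0: "(\<lambda>n. t (r n)) \<longlonglongrightarrow> 0" using LIMSEQ_subseq_LIMSEQ[OF _ r, of t 0] by (simp add: o_def)
  have Y_bound: "norm (Y n) \<le> C * R ^ 3" for n
    by (rule order_trans[OF Y]) (intro mult_left_mono power_mono z assms norm_ge_zero)
  have tY: "(\<lambda>n. t (r n) *\<^sub>R Y (r n)) \<longlonglongrightarrow> 0"
  proof (rule Lim_null_comparison)
    show "\<forall>\<^sub>F n in sequentially. norm (t (r n) *\<^sub>R Y (r n)) \<le> t (r n) * (C * R^3)"
      using t Y_bound by (intro always_eventually allI) (simp add: mult_left_mono less_imp_le)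
    show "(\<lambda>n. t (r n) * (C * R^3)) \<longlonglongrightarrow> 0"
      using tendsto_mult_left_zero[OF t0] by simp
  qed
  have u: "(\<lambda>n. (L (z (r n)) + t (r n) *\<^sub>R Y (r n)) ^ 3) \<longlonglongrightarrow> L l ^ 3"
    using tendsto_power[OF tendsto_add[OF bounded_linear.tendsto[OF L zl] tY], of 3] by simp
  have "(\<lambda>n. z (r n)) \<longlonglongrightarrow> P (L l ^ 3)"
    using bounded_linear.tendsto[OF P u] z_eq by simp
  then have fp: "P (L l ^ 3) = l" using zl LIMSEQ_unique by blast
  have "(\<lambda>n. Y (r n)) \<longlonglongrightarrow> K2 (L l ^ 3) - K1 0"
    by (subst Y_eq) (intro tendsto_diff bounded_linear.tendsto[OF K2 u] bounded_linear.tendsto[OF K1 tY])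
  then have Yl: "(\<lambda>n. Y (r n)) \<longlonglongrightarrow> K2 (L l ^ 3)"
    by (simp add: linear_0[OF bounded_linear.linear[OF K1]])
  \<comment> \<open>From the first equation norm z <= D * norm z ^ 3; dividing by norm z keeps the
    sequence away from the origin, hence also its limit.\<close>
  define D where "D = M * (M + C * R\<^sup>2) ^ 3"
  have "1 \<le> D * norm (z n) ^ 2" for n
  proof -
    have "t n \<le> 1" using t(2)[of n] by (rule order_trans[OF less_imp_le]) (simp add: field_simps)
    then have "norm (t n *\<^sub>R Y n) \<le> norm (Y n)" using t(1)[of n] by (simp add: mult_left_le_one_le)
    also have "\<dots> \<le> C * norm (z n) ^ 3" by (rule Y)
    also have "\<dots> = C * norm (z n) ^ 2 * norm (z n)" by (simp add: power2_eq_square power3_eq_cube)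
    also have "\<dots> \<le> C * R\<^sup>2 * norm (z n)"
      by (intro mult_right_mono mult_left_mono power_mono z assms norm_ge_zero)
    finally have "norm (L (z n) + t n *\<^sub>R Y n) \<le> (M + C * R\<^sup>2) * norm (z n)"
      using norm_triangle_ineq[of "L (z n)" "t n *\<^sub>R Y n"] M(2)[of "z n"] by (simp add: distrib_right)
    then have "norm ((L (z n) + t n *\<^sub>R Y n) ^ 3) \<le> ((M + C * R\<^sup>2) * norm (z n)) ^ 3"
      by (intro order_trans[OF norm_power_ineq] power_mono) auto
    then have "norm (z n) \<le> M * ((M + C * R\<^sup>2) * norm (z n)) ^ 3"
      using M(3)[of "(L (z n) + t n *\<^sub>R Y n) ^ 3"] M(1) z_eq[of n]
      by (smt (verit) mult_left_mono)
    then have "1 * norm (z n) \<le> (D * norm (z n) ^ 2) * norm (z n)"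
      by (simp add: D_def power_mult_distrib power2_eq_square power3_eq_cube mult_ac)
    then show ?thesis using z(1)[of n] by (simp only: mult_le_cancel_right) auto
  qed
  then have "1 \<le> D * norm l ^ 2"
    by (intro tendsto_lowerbound[OF tendsto_mult[OF tendsto_const tendsto_power[OF tendsto_norm[OF zl]]]]) auto
  then have "l \<noteq> 0" by auto
  then obtain i where i: "i \<in> {1..4}" "l = zb i" using fixed_imp_zb[OF fp] by auto
  have "(\<lambda>n. norm ((z (r n), Y (r n)) - (zb i, K2 (L (zb i) ^ 3)))) \<longlonglongrightarrow> norm ((l, K2 (L l ^ 3)) - (zb i, K2 (L (zb i) ^ 3)))"
    by (intro tendsto_intros zl Yl)
  then have "\<rho> \<le> norm ((l, K2 (L l ^ 3)) - (zb i, K2 (L (zb i) ^ 3)))"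
    by (rule tendsto_lowerbound) (use far[OF i(1)] in \<open>auto intro!: always_eventually simp: less_imp_le\<close>)
  then show False using i(2) assms(3) by simp
qed

text \<open>The radius \<open>r\<close> is independent of \<tau>, so the count concerns a full
  neighbourhood of the origin and not one shrinking with \<tau>. The bound \<open>r0\<close> lets
  both ranges be fitted into the domain of a given reduction. The condition
  \<open>norm y \<le> norm p\<close> singles out the small solution of the auxiliary
  equation.\<close>

theorem four_branches:
  assumes "r0 > 0"
  obtains r \<epsilon> z v where "0 < r" "r \<le> r0" "0 < \<epsilon>" "\<epsilon> \<le> r0"
    "\<And>i. i \<in> {1..4} \<Longrightarrow> z i 0 = zb i"
    "\<And>i \<tau>. i \<in> {1..4} \<Longrightarrow> \<bar>\<tau>\<bar> < \<epsilon> \<Longrightarrow> (z i has_vector_derivative v i \<tau>) (at \<tau>)"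
    "\<And>i. i \<in> {1..4} \<Longrightarrow> continuous_on {-\<epsilon><..<\<epsilon>} (v i)"
    "\<And>\<tau>. 0 < \<tau> \<Longrightarrow> \<tau> < \<epsilon> \<Longrightarrow>
      {p. norm p < r \<and> p \<noteq> 0 \<and> (\<exists>y. norm y \<le> norm p \<and> aux \<tau> p y \<and> red \<tau> p y = 0)}
        = (\<lambda>i. sqrt \<tau> *\<^sub>R z i \<tau>) ` {1..4}"
    "\<And>\<tau>. 0 < \<tau> \<Longrightarrow> \<tau> < \<epsilon> \<Longrightarrow> inj_on (\<lambda>i. sqrt \<tau> *\<^sub>R z i \<tau>) {1..4}"
proof -
  define wb where "wb i = (zb i, K2 (L (zb i) ^ 3))" for i
  obtain C r1 where C: "C > 0" and r1: "r1 > 0"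
    and small: "\<And>\<tau> p y. \<bar>\<tau>\<bar> < r1 \<Longrightarrow> norm p < r1 \<Longrightarrow> norm y \<le> norm p \<Longrightarrow> aux \<tau> p y \<Longrightarrow> norm y \<le> C * norm p ^ 3"
    using small_solution by metis
  obtain c where c: "c > 0" "\<And>p. c * norm p ^ 3 \<le> norm (P (L p ^ 3))"
    using cubic_coercive by metis
  obtain M where M: "M \<ge> 1" "\<And>p. norm (L p) \<le> M * norm p" "\<And>y. norm (P y) \<le> M * norm y"
    using common_bound by metis
  \<comment> \<open>Replacing \<open>L p + y\<close> by \<open>L p\<close> in the cubic term costs
    at most E * norm p ^ 5.\<close>
  define E where "E = M * (3 * (M + 1)\<^sup>2 * C)"
  have E: "E > 0" using M C by (simp add: E_def)
  \<comment> \<open>The entry c / (2 * E) makes that error at most half of the coercivity bound c *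
    norm p ^ 3; the entry 1 is used for n^2 <= n.\<close>
  define r where "r = Min {r0, r1, 1, c / (2 * E)}"
  have r: "0 < r" "r \<le> r0" "r \<le> r1" "r \<le> 1" "r \<le> c / (2 * E)"
    using assms r1 c E by (auto simp: r_def)
  \<comment> \<open>Since P of the cube equals \<tau> p at a zero, the remaining half of coercivity
    gives (c/2) * norm p ^ 2 <= \<tau>, that is, norm z <= sqrt (2 / c).\<close>
  define R where "R = sqrt (2 / c)"
  have "R \<ge> 0" using c by (simp add: R_def)
  obtain e \<rho> w v where Q: "\<And>i. i \<in> {1..4} \<Longrightarrow> is_branch (zb i) (e i) (\<rho> i) (w i) (v i)"
    using zb_branch by metis
  have e: "e i > 0" and \<rho>: "\<rho> i > 0" and w0: "w i 0 = wb i"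
    and wG: "\<And>\<tau>. \<bar>\<tau>\<bar> < e i \<Longrightarrow> G (\<tau>, w i \<tau>) = 0"
    and uniq: "\<And>\<tau> x. \<bar>\<tau>\<bar> < e i \<Longrightarrow> norm (x - wb i) \<le> \<rho> i \<Longrightarrow> G (\<tau>, x) = 0 \<Longrightarrow> x = w i \<tau>"
    and deriv: "\<And>\<tau>. \<bar>\<tau>\<bar> < e i \<Longrightarrow> (w i has_vector_derivative v i \<tau>) (at \<tau>)"
    and cont: "continuous_on {-e i<..<e i} (v i)"
    if "i \<in> {1..4}" for i
    using Q[OF that] unfolding is_branch_def wb_def by blast+
  have fin: "finite {1..4::nat}" and ne: "{1..4::nat} \<noteq> {}" by auto
  define \<rho>0 where "\<rho>0 = Min (\<rho> ` {1..4})"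
  have \<rho>0: "\<rho>0 > 0" "\<And>i. i \<in> {1..4} \<Longrightarrow> \<rho>0 \<le> \<rho> i"
    using \<rho> by (auto simp: \<rho>0_def Min_gr_iff)
  define e0 where "e0 = Min (e ` {1..4})"
  have e0: "e0 > 0" "\<And>i. i \<in> {1..4} \<Longrightarrow> e0 \<le> e i"
    using e by (auto simp: e0_def Min_gr_iff)
  obtain \<delta> where \<delta>: "\<delta> > 0" "\<And>\<tau> z Y. 0 < \<tau> \<Longrightarrow> \<tau> < \<delta> \<Longrightarrow> z \<noteq> 0 \<Longrightarrow> norm z \<le> R \<Longrightarrow>
      norm Y \<le> C * norm z ^ 3 \<Longrightarrow> G (\<tau>, z, Y) = 0 \<Longrightarrow> \<exists>i\<in>{1..4}. norm ((z, Y) - wb i) \<le> \<rho>0"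
    using zeros_converge_to_zb[OF less_imp_le[OF C] \<open>R \<ge> 0\<close> \<rho>0(1)] unfolding wb_def by metis
  have lim_w: "(w i \<longlongrightarrow> wb i) (at_right 0)" if "i \<in> {1..4}" for i
  proof -
    have "isCont (w i) 0"
      by (rule has_vector_derivative_continuous[OF deriv]) (use e that in auto)
    then show ?thesis using w0[OF that] by (metis isCont_def tendsto_within_subset subset_UNIV)
  qed
  have lim_z: "((\<lambda>\<tau>. fst (w i \<tau>)) \<longlongrightarrow> zb i) (at_right 0)"
    and lim_Y: "((\<lambda>\<tau>. snd (w i \<tau>)) \<longlongrightarrow> K2 (L (zb i) ^ 3)) (at_right 0)" if "i \<in> {1..4}" for i
    using tendsto_fst[OF lim_w[OF that]] tendsto_snd[OF lim_w[OF that]] by (simp_all add: wb_def)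
  have lim_sqrt: "((\<lambda>\<tau>. sqrt \<tau>) \<longlongrightarrow> 0) (at_right 0)"
    using isCont_real_sqrt[of 0] by (simp add: isCont_def filterlim_at_split)
  have ev1: "\<forall>\<^sub>F \<tau> in at_right 0. norm (sqrt \<tau> *\<^sub>R fst (w i \<tau>)) < r" if "i \<in> {1..4}" for i
    by (rule order_tendstoD[OF tendsto_norm[OF tendsto_scaleR[OF lim_sqrt lim_z[OF that]]]])
      (simp add: r)
  \<comment> \<open>After scaling back, this is the condition norm y <= norm p, because s^3 * norm Y
    <= s * norm z amounts to \<tau> * norm Y <= norm z. It also excludes z = 0.\<close>
  have ev2: "\<forall>\<^sub>F \<tau> in at_right 0. 0 < norm (fst (w i \<tau>)) - \<bar>\<tau>\<bar> * norm (snd (w i \<tau>))" if "i \<in> {1..4}" for i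
    by (rule order_tendstoD[OF tendsto_diff[OF tendsto_norm[OF lim_z[OF that]]
          tendsto_mult[OF tendsto_rabs[OF tendsto_ident_at] tendsto_norm[OF lim_Y[OF that]]]]])
      (simp add: zb_nonzero[OF that])
  have ev3: "\<forall>\<^sub>F \<tau> in at_right 0. 0 < norm (fst (w i \<tau>) - fst (w j \<tau>))"
    if "i \<in> {1..4}" "j \<in> {1..4}" "i \<noteq> j" for i j
    by (rule order_tendstoD[OF tendsto_norm[OF tendsto_diff[OF lim_z[OF that(1)] lim_z[OF that(2)]]]])
      (use inj_on_zb that in \<open>auto simp: inj_on_def\<close>)
  have "\<forall>\<^sub>F \<tau> in at_right 0. \<forall>i\<in>{1..4}. norm (sqrt \<tau> *\<^sub>R fst (w i \<tau>)) < r \<and>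
      0 < norm (fst (w i \<tau>)) - \<bar>\<tau>\<bar> * norm (snd (w i \<tau>)) \<and>
      (\<forall>j\<in>{1..4}. i \<noteq> j \<longrightarrow> 0 < norm (fst (w i \<tau>) - fst (w j \<tau>)))"
    using ev1 ev2 ev3 by (intro eventually_ball_finite fin ballI eventually_conj) auto
  then obtain b where b: "b > 0" "\<And>\<tau> i. 0 < \<tau> \<Longrightarrow> \<tau> < b \<Longrightarrow> i \<in> {1..4} \<Longrightarrow>
      norm (sqrt \<tau> *\<^sub>R fst (w i \<tau>)) < r \<and>
      0 < norm (fst (w i \<tau>)) - \<bar>\<tau>\<bar> * norm (snd (w i \<tau>)) \<and>
      (\<forall>j\<in>{1..4}. i \<noteq> j \<longrightarrow> 0 < norm (fst (w i \<tau>) - fst (w j \<tau>)))"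
    unfolding eventually_at_right_field by blast
  define \<epsilon> where "\<epsilon> = Min {b, \<delta>, e0, r1, r0}"
  have \<epsilon>: "\<epsilon> > 0" "\<epsilon> \<le> b" "\<epsilon> \<le> \<delta>" "\<epsilon> \<le> e0" "\<epsilon> \<le> r1" "\<epsilon> \<le> r0"
    using b \<delta> e0 r1 assms by (auto simp: \<epsilon>_def)
  show thesis
  proof (rule that[of r \<epsilon> "\<lambda>i \<tau>. fst (w i \<tau>)" "\<lambda>i \<tau>. fst (v i \<tau>)"])
    fix i \<tau> assume i: "i \<in> {1..4::nat}"
    show "fst (w i 0) = zb i" using w0[OF i] by (simp add: wb_def)
    show "continuous_on {-\<epsilon><..<\<epsilon>} (\<lambda>\<tau>. fst (v i \<tau>))"
      using \<epsilon>(4) e0(2)[OF i] by (intro continuous_on_fst continuous_on_subset[OF cont[OF i]]) auto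
    show "((\<lambda>\<tau>. fst (w i \<tau>)) has_vector_derivative fst (v i \<tau>)) (at \<tau>)" if "\<bar>\<tau>\<bar> < \<epsilon>"
      using \<epsilon>(4) e0(2)[OF i] that
      by (intro bounded_linear.has_vector_derivative[OF bounded_linear_fst] deriv i) auto
  next
    fix \<tau> assume \<tau>: "0 < \<tau>" "\<tau> < \<epsilon>"
    define s where "s = sqrt \<tau>"
    have s: "s > 0" "s\<^sup>2 = \<tau>" using \<tau> by (auto simp: s_def)
    show "{p. norm p < r \<and> p \<noteq> 0 \<and> (\<exists>y. norm y \<le> norm p \<and> aux \<tau> p y \<and> red \<tau> p y = 0)}
        = (\<lambda>i. sqrt \<tau> *\<^sub>R fst (w i \<tau>)) ` {1..4}"
    proof (intro equalityI subsetI)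
      fix p assume "p \<in> {p. norm p < r \<and> p \<noteq> 0 \<and> (\<exists>y. norm y \<le> norm p \<and> aux \<tau> p y \<and> red \<tau> p y = 0)}"
      then obtain y where p: "norm p < r" "p \<noteq> 0" and y: "norm y \<le> norm p" "aux \<tau> p y" "red \<tau> p y = 0"
        by blast
      have yC: "norm y \<le> C * norm p ^ 3"
        using small[of \<tau> p y] y p \<tau> \<epsilon> r by simp
      define n where "n = norm p"
      have n: "n > 0" "n < r" using p by (auto simp: n_def)
      have "norm (L p + y) \<le> (M + 1) * n" "norm (L p) \<le> (M + 1) * n"
        using norm_triangle_ineq[of "L p" y] M(2)[of p] y(1) norm_ge_zero[of p]
        unfolding n_def distrib_right mult_1 by linarith+
      then have "norm ((L p + y)^3 - (L p)^3) \<le> 3 * ((M + 1) * n)\<^sup>2 * norm (L p + y - L p)"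
        by (rule norm_cube_diff_le)
      also have "\<dots> \<le> 3 * ((M + 1) * n)\<^sup>2 * (C * n^3)"
        using yC by (intro mult_left_mono) (auto simp: n_def)
      finally have "norm (P ((L p + y)^3 - (L p)^3)) \<le> M * (3 * ((M + 1) * n)\<^sup>2 * (C * n^3))"
        using M(3)[of "(L p + y)^3 - (L p)^3"] M(1) by (smt (verit) mult_left_mono)
      also have "\<dots> = (E * n\<^sup>2) * n^3" by (simp add: E_def power_mult_distrib)
      also have "E * n\<^sup>2 \<le> c / 2"
      proof -
        have "n\<^sup>2 \<le> n" using n r by (simp add: power2_eq_square mult_left_le)
        then have "E * n\<^sup>2 \<le> E * (c / (2 * E))" using n r E by (intro mult_left_mono) auto
        then show ?thesis using E by simp
      qed
      then have "(E * n\<^sup>2) * n^3 \<le> c / 2 * n^3" using n by (intro mult_right_mono) auto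
      finally have "norm (P ((L p + y)^3) - P ((L p)^3)) \<le> c / 2 * n^3"
        by (simp add: linear_diff[OF bounded_linear.linear[OF P]])
      moreover have "P ((L p + y)^3) = \<tau> *\<^sub>R p" using y(3) by (simp add: red_def)
      ultimately have "norm (P ((L p)^3)) \<le> c / 2 * n^3 + \<tau> * n"
        using norm_triangle_ineq2[of "P ((L p)^3)" "\<tau> *\<^sub>R p"] \<tau> by (simp add: n_def norm_minus_commute)
      then have "c / 2 * n^3 \<le> \<tau> * n" using c(2)[of p] by (simp add: n_def)
      then have "(c / 2 * n\<^sup>2) * n \<le> \<tau> * n" by (simp add: power2_eq_square power3_eq_cube mult.assoc)
      then have "c / 2 * n\<^sup>2 \<le> \<tau>" using n by (simp only: mult_le_cancel_right)
      then have "(n / s)\<^sup>2 \<le> 2 / c" using c(1) s \<tau> by (simp add: power_divide field_simps)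
      then have nR: "n / s \<le> R" unfolding R_def by (rule real_le_rsqrt)
      define z Y where "z = (1 / s) *\<^sub>R p" and "Y = (1 / s^3) *\<^sub>R y"
      have py: "p = s *\<^sub>R z" "y = s^3 *\<^sub>R Y" using s by (auto simp: z_def Y_def)
      have G0: "G (\<tau>, z, Y) = 0"
        using scaled_system[OF s(1), of z Y] y s by (simp add: py)
      have "\<exists>i\<in>{1..4}. norm ((z, Y) - wb i) \<le> \<rho>0"
      proof (rule \<delta>(2)[OF \<tau>(1) _ _ _ _ G0])
        show "\<tau> < \<delta>" using \<tau> \<epsilon> by simp
        show "z \<noteq> 0" using p s by (simp add: z_def)
        show "norm z \<le> R" using nR s by (simp add: z_def n_def)
        show "norm Y \<le> C * norm z ^ 3"
          using yC s by (simp add: z_def Y_def power_divide field_simps)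
      qed
      then obtain i where i: "i \<in> {1..4}" "norm ((z, Y) - wb i) \<le> \<rho>0" by blast
      moreover have "\<bar>\<tau>\<bar> < e i" using \<tau> \<epsilon> e0(2)[OF i(1)] by simp
      ultimately have "(z, Y) = w i \<tau>"
        using uniq[OF i(1)] \<rho>0(2)[OF i(1)] G0 order_trans by blast
      then have "p = sqrt \<tau> *\<^sub>R fst (w i \<tau>)" using py(1) by (metis fst_conv s_def)
      then show "p \<in> (\<lambda>i. sqrt \<tau> *\<^sub>R fst (w i \<tau>)) ` {1..4}" using i(1) by blast
    next
      fix p assume "p \<in> (\<lambda>i. sqrt \<tau> *\<^sub>R fst (w i \<tau>)) ` {1..4}"
      then obtain i where i: "i \<in> {1..4}" and p: "p = s *\<^sub>R fst (w i \<tau>)" by (auto simp: s_def)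
      define y where "y = s^3 *\<^sub>R snd (w i \<tau>)"
      have "\<tau> < b" using \<tau> \<epsilon> by simp
      note bi = b(2)[OF \<tau>(1) this i]
      have nz: "\<tau> * norm (snd (w i \<tau>)) < norm (fst (w i \<tau>))" using bi \<tau> by simp
      have "\<bar>\<tau>\<bar> < e i" using \<tau> \<epsilon> e0(2)[OF i(1)] by simp
      then have "G (\<tau>, fst (w i \<tau>), snd (w i \<tau>)) = 0" using wG[OF i] by simp
      then have sys: "aux \<tau> p y \<and> red \<tau> p y = 0"
        using scaled_system[OF s(1), of "fst (w i \<tau>)" "snd (w i \<tau>)"] s by (simp add: p y_def)
      have "norm y = s * (\<tau> * norm (snd (w i \<tau>)))"
        using s by (simp add: y_def power2_eq_square power3_eq_cube flip: s(2))
      also have "\<dots> \<le> norm p"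
        using nz s by (simp add: p)
      finally have "norm y \<le> norm p" .
      moreover have "fst (w i \<tau>) \<noteq> 0"
        using nz \<tau> by (smt (verit) mult_nonneg_nonneg norm_ge_zero norm_zero)
      then have "p \<noteq> 0" using s by (simp add: p)
      moreover have "norm p < r" using bi by (simp add: p s_def)
      ultimately show "p \<in> {p. norm p < r \<and> p \<noteq> 0 \<and> (\<exists>y. norm y \<le> norm p \<and> aux \<tau> p y \<and> red \<tau> p y = 0)}"
        using sys by blast
    qed
    show "inj_on (\<lambda>i. sqrt \<tau> *\<^sub>R fst (w i \<tau>)) {1..4}"
    proof (rule inj_onI, rule ccontr)
      fix i j assume ij: "i \<in> {1..4::nat}" "j \<in> {1..4::nat}" "i \<noteq> j"
        "sqrt \<tau> *\<^sub>R fst (w i \<tau>) = sqrt \<tau> *\<^sub>R fst (w j \<tau>)"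
      have "\<tau> < b" using \<tau> \<epsilon> by simp
      from b(2)[OF \<tau>(1) this ij(1)] ij(2,3) have "0 < norm (fst (w i \<tau>) - fst (w j \<tau>))" by blast
      then show False using ij(4) \<tau> by simp
    qed
  qed (use r \<epsilon> in auto)
qed

end

section \<open>The Banach algebra of bounded continuous functions\<close>

lemma Bcontfun_apply:
  assumes "continuous_on UNIV f" "\<And>x. norm (f x) \<le> B"
  shows "apply_bcontfun (Bcontfun f) = f"
  by (rule Bcontfun_inverse) (rule bcontfun_normI[OF assms])

text \<open>The pointwise product; with it, real-valued bounded continuous functions satisfy the
  class constraints under which the cubic system is posed.\<close>

instantiation bcontfun :: (topological_space, real_normed_algebra_1) real_normed_algebra_1
begin

definition one_bcontfun :: "('a, 'b) bcontfun"
  where "one_bcontfun = const_bcontfun 1"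

definition times_bcontfun :: "('a, 'b) bcontfun \<Rightarrow> ('a, 'b) bcontfun \<Rightarrow> ('a, 'b) bcontfun"
  where "times_bcontfun f g = Bcontfun (\<lambda>x. apply_bcontfun f x * apply_bcontfun g x)"

lemma one_bcontfun_apply [simp]: "apply_bcontfun (1 :: ('a, 'b) bcontfun) = (\<lambda>_. 1)"
  by (simp add: one_bcontfun_def const_bcontfun.rep_eq)

lemma times_bcontfun_apply [simp]:
  fixes f g :: "('a, 'b) bcontfun"
  shows "apply_bcontfun (f * g) = (\<lambda>x. apply_bcontfun f x * apply_bcontfun g x)"
  unfolding times_bcontfun_def
proof (rule Bcontfun_apply)
  show "norm (apply_bcontfun f x * apply_bcontfun g x) \<le> norm f * norm g" for x
    by (intro order_trans[OF norm_mult_ineq] mult_mono norm_bounded norm_ge_zero)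
qed (intro continuous_intros continuous_on_apply_bcontfun)

instance
proof
  fix f g h :: "('a, 'b) bcontfun" and r :: real
  show "f * g * h = f * (g * h)" by (rule bcontfun_eqI) (simp add: mult.assoc)
  show "1 * f = f" "f * 1 = f"
    by (rule bcontfun_eqI; simp)+
  show "(f + g) * h = f * h + g * h" "f * (g + h) = f * g + f * h"
    by (rule bcontfun_eqI; simp add: algebra_simps)+
  show "r *\<^sub>R f * g = r *\<^sub>R (f * g)" "f * r *\<^sub>R g = r *\<^sub>R (f * g)"
    by (rule bcontfun_eqI; simp)+
  \<comment> \<open>Every type is inhabited, so \<open>undefined\<close> serves as a point at which
    0 and 1 are told apart.\<close>
  have "apply_bcontfun (1 :: ('a, 'b) bcontfun) undefined \<noteq> apply_bcontfun 0 undefined"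
    by (simp add: zero_bcontfun.rep_eq)
  then show "(0 :: ('a, 'b) bcontfun) \<noteq> 1" by metis
  show "norm (f * g) \<le> norm f * norm g"
  proof (rule norm_bound)
    fix x
    have "norm (apply_bcontfun f x * apply_bcontfun g x) \<le> norm f * norm g"
      by (intro order_trans[OF norm_mult_ineq] mult_mono norm_bounded norm_ge_zero)
    then show "norm (apply_bcontfun (f * g) x) \<le> norm f * norm g"
      by simp
  qed
  have "norm (1 :: ('a, 'b) bcontfun) \<le> 1"
    by (rule norm_bound) simp
  moreover have "1 \<le> norm (1 :: ('a, 'b) bcontfun)"
    using norm_bounded[of "1 :: ('a, 'b) bcontfun" undefined] by simp
  ultimately show "norm (1 :: ('a, 'b) bcontfun) = 1" by simp
qed

end

instance bcontfun :: (topological_space, "{real_normed_algebra_1, comm_ring_1}") comm_ring_1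
proof
  fix f g h :: "('a, 'b) bcontfun"
  show "f * g = g * f" by (rule bcontfun_eqI) (simp add: mult.commute)
qed (simp_all add: algebra_simps)

instance bcontfun :: (metric_space, banach) banach ..

lemma power_bcontfun_apply:
  fixes f :: "'a::topological_space \<Rightarrow>\<^sub>C 'b::real_normed_algebra_1"
  shows "apply_bcontfun (f ^ n) x = apply_bcontfun f x ^ n"
  by (induction n) simp_all

section \<open>Bounded measurable functions on an interval\<close>

lemma C1_differentiable_on_UNIV_iff:
  fixes f :: "real \<Rightarrow> real"
  shows "f C1_differentiable_on UNIV \<longleftrightarrow>
    (\<forall>x. (f has_real_derivative deriv f x) (at x)) \<and> continuous_on UNIV (deriv f)"
proof
  assume "f C1_differentiable_on UNIV"
  then obtain D where D: "\<And>x. (f has_vector_derivative D x) (at x)" "continuous_on UNIV D"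
    unfolding C1_differentiable_on_def by auto
  then have "(f has_real_derivative D x) (at x)" for x
    by (simp add: has_real_derivative_iff_has_vector_derivative)
  moreover from this have "deriv f = D" by (auto simp: DERIV_imp_deriv)
  ultimately show "(\<forall>x. (f has_real_derivative deriv f x) (at x)) \<and> continuous_on UNIV (deriv f)"
    using D(2) by simp
next
  assume "(\<forall>x. (f has_real_derivative deriv f x) (at x)) \<and> continuous_on UNIV (deriv f)"
  then show "f C1_differentiable_on UNIV"
    unfolding C1_differentiable_on_def has_real_derivative_iff_has_vector_derivative by blast
qed

lemma C1_differentiable_on_UNIV_I:
  fixes f f' :: "real \<Rightarrow> real"
  assumes "\<And>x. (f has_real_derivative f' x) (at x)" "continuous_on UNIV f'"
  shows "f C1_differentiable_on UNIV" "deriv f = f'"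
proof -
  show "deriv f = f'" using assms(1) by (auto simp: DERIV_imp_deriv)
  then show "f C1_differentiable_on UNIV" using assms by (simp add: C1_differentiable_on_UNIV_iff)
qed

lemma C1_imp_continuous_on:
  fixes f :: "real \<Rightarrow> real"
  assumes "f C1_differentiable_on UNIV"
  shows "continuous_on A f"
  using assms C1_differentiable_on_UNIV_iff
  by (metis DERIV_isCont continuous_at_imp_continuous_on)

lemma finite_measure_leb: "finite_measure (leb T)"
  by (rule finite_measure_lebesgue_on) simp

lemma id_measurable_leb: "(\<lambda>x. x) \<in> borel_measurable (leb T)"
  by (rule continuous_imp_measurable_on_sets_lebesgue) (auto intro: continuous_intros)

lemma borel_measurable_leb: "f \<in> borel_measurable borel \<Longrightarrow> f \<in> borel_measurable (leb T)"
  by (rule measurable_compose[OF id_measurable_leb])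

lemma integral_leb_Icc:
  assumes "0 \<le> c" "d \<le> T" "continuous_on {0..T} f"
  shows "(LINT t|leb T. (if t \<in> {c..d} then f t else 0)) = integral {c..d} (f :: real \<Rightarrow> real)"
proof -
  have sub: "{c..d} \<inter> {0..T} = {c..d}" using assms by auto
  have "integrable (lebesgue_on {c..d}) f"
    by (rule continuous_imp_integrable_real) (rule continuous_on_subset[OF assms(3)], use assms in auto)
  then have "(LINT t|lebesgue_on {c..d}. f t) = integral {c..d} f"
    by (rule lebesgue_integral_eq_integral) simp
  moreover have "(LINT t|leb T. (if t \<in> {c..d} then f t else 0)) = integral\<^sup>L (lebesgue_on ({c..d} \<inter> {0..T})) f"
    by (rule Lebesgue_Measure.integral_restrict_Int) auto
  ultimately show ?thesis unfolding sub by simp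
qed

text \<open>The bound holds at every point of the interval and not only almost everywhere, so the
  sup estimates for the integral operators involve no null sets.\<close>

definition bdd_meas :: "real \<Rightarrow> (real \<Rightarrow> real) \<Rightarrow> bool"
  where "bdd_meas T h \<longleftrightarrow> h \<in> borel_measurable (leb T) \<and> (\<exists>B. \<forall>t\<in>{0..T}. \<bar>h t\<bar> \<le> B)"

lemma bdd_measE:
  assumes "bdd_meas T h"
  obtains B where "B \<ge> 0" "h \<in> borel_measurable (leb T)" "\<And>t. t \<in> {0..T} \<Longrightarrow> \<bar>h t\<bar> \<le> B"
proof -
  obtain B where "h \<in> borel_measurable (leb T)" "\<And>t. t \<in> {0..T} \<Longrightarrow> \<bar>h t\<bar> \<le> B"
    using assms unfolding bdd_meas_def by blast
  then show thesis by (intro that[of "max 0 B"]) (auto simp: le_max_iff_disj)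
qed

lemma bdd_measI:
  assumes "h \<in> borel_measurable (leb T)" "\<And>t. t \<in> {0..T} \<Longrightarrow> \<bar>h t\<bar> \<le> B"
  shows "bdd_meas T h"
  using assms unfolding bdd_meas_def by blast

lemma bdd_meas_continuous:
  assumes "continuous_on {0..T} h"
  shows "bdd_meas T h"
proof -
  have "bounded (h ` {0..T})"
    by (intro compact_imp_bounded compact_continuous_image assms compact_Icc)
  then obtain B where "\<forall>x\<in>h ` {0..T}. norm x \<le> B"
    unfolding bounded_iff by blast
  then show ?thesis
    by (intro bdd_measI[where B = B] continuous_imp_measurable_on_sets_lebesgue assms) auto
qed

lemma bdd_meas_add:
  assumes "bdd_meas T f" "bdd_meas T g"
  shows "bdd_meas T (\<lambda>t. f t + g t)"
proof -
  obtain a where a: "f \<in> borel_measurable (leb T)" "\<And>t. t \<in> {0..T} \<Longrightarrow> \<bar>f t\<bar> \<le> a"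
    using bdd_measE[OF assms(1)] by metis
  obtain b where b: "g \<in> borel_measurable (leb T)" "\<And>t. t \<in> {0..T} \<Longrightarrow> \<bar>g t\<bar> \<le> b"
    using bdd_measE[OF assms(2)] by metis
  have "\<bar>f t + g t\<bar> \<le> a + b" if "t \<in> {0..T}" for t using a(2)[OF that] b(2)[OF that] by linarith
  then show ?thesis using a b by (intro bdd_measI) auto
qed

lemma bdd_meas_mult:
  assumes "bdd_meas T f" "bdd_meas T g"
  shows "bdd_meas T (\<lambda>t. f t * g t)"
proof -
  obtain a where a: "a \<ge> 0" "f \<in> borel_measurable (leb T)" "\<And>t. t \<in> {0..T} \<Longrightarrow> \<bar>f t\<bar> \<le> a"
    using bdd_measE[OF assms(1)] by metis
  obtain b where b: "g \<in> borel_measurable (leb T)" "\<And>t. t \<in> {0..T} \<Longrightarrow> \<bar>g t\<bar> \<le> b"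
    using bdd_measE[OF assms(2)] by metis
  have "\<bar>f t * g t\<bar> \<le> a * b" if "t \<in> {0..T}" for t
    unfolding abs_mult by (intro mult_mono a(3) b(2) that a(1) abs_ge_zero)
  then show ?thesis using a b by (intro bdd_measI) auto
qed

lemma bdd_meas_const: "bdd_meas T (\<lambda>t. c)"
  by (rule bdd_meas_continuous) auto

lemma bdd_meas_uminus: "bdd_meas T f \<Longrightarrow> bdd_meas T (\<lambda>t. - f t)"
  using bdd_meas_mult[OF bdd_meas_const[of T "-1"], of f] by simp

lemma bdd_meas_diff: "bdd_meas T f \<Longrightarrow> bdd_meas T g \<Longrightarrow> bdd_meas T (\<lambda>t. f t - g t)"
  using bdd_meas_add[OF _ bdd_meas_uminus, of T f g] by simp

lemma bdd_meas_power: "bdd_meas T f \<Longrightarrow> bdd_meas T (\<lambda>t. f t ^ n)"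
  by (induction n) (auto intro: bdd_meas_const bdd_meas_mult)

lemma bdd_meas_bcontfun: "bdd_meas T (apply_bcontfun f)"
  by (rule bdd_meas_continuous) simp

lemmas bdd_meas_intros = bdd_meas_add bdd_meas_mult bdd_meas_const bdd_meas_uminus bdd_meas_diff
  bdd_meas_power bdd_meas_bcontfun

lemma bdd_meas_integrable:
  assumes "bdd_meas T f"
  shows "integrable (leb T) f"
proof -
  obtain a where a: "f \<in> borel_measurable (leb T)" "\<And>t. t \<in> {0..T} \<Longrightarrow> \<bar>f t\<bar> \<le> a"
    using bdd_measE[OF assms(1)] by metis
  then show ?thesis
    by (intro finite_measure.integrable_const_bound[OF finite_measure_leb, where B = a]) auto
qed

lemma bdd_meas_L2: "bdd_meas T f \<Longrightarrow> f \<in> L2 T"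
  using bdd_meas_integrable[OF bdd_meas_power[of T f 2]] by (auto simp: L2_def bdd_meas_def)

lemma integral_bdd_meas_le:
  assumes "T \<ge> 0" "f \<in> borel_measurable (leb T)" "\<And>t. t \<in> {0..T} \<Longrightarrow> \<bar>f t\<bar> \<le> B"
  shows "\<bar>LINT t|leb T. f t\<bar> \<le> B * T"
proof -
  have "\<bar>LINT t|leb T. f t\<bar> \<le> (LINT t|leb T. \<bar>f t\<bar>)" by (rule integral_abs_bound)
  also have "\<dots> \<le> (LINT t|leb T. B)"
    using assms by (intro integral_mono bdd_meas_integrable bdd_measI[where B = B] bdd_meas_const) auto
  also have "\<dots> = B * T"
    using assms(1) by (simp add: measure_restrict_space mult.commute)
  finally show ?thesis .
qed

lemma L2_integrable_mult:
  assumes "f \<in> L2 T" "g \<in> L2 T"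
  shows "integrable (leb T) (\<lambda>t. f t * g t)"
proof (rule Bochner_Integration.integrable_bound)
  show "integrable (leb T) (\<lambda>t. (f t)\<^sup>2 + (g t)\<^sup>2)" using assms by (simp add: L2_def)
  show "(\<lambda>t. f t * g t) \<in> borel_measurable (leb T)" using assms by (auto simp: L2_def)
  have "\<bar>x * y\<bar> \<le> x\<^sup>2 + y\<^sup>2" for x y :: real
  proof -
    have "2 * (\<bar>x\<bar> * \<bar>y\<bar>) \<le> x\<^sup>2 + y\<^sup>2"
      using sum_squares_bound[of "\<bar>x\<bar>" "\<bar>y\<bar>"] by (simp add: mult.assoc)
    moreover have "0 \<le> \<bar>x\<bar> * \<bar>y\<bar>" by simp
    ultimately show ?thesis unfolding abs_mult by linarith
  qed
  then show "AE t in leb T. norm (f t * g t) \<le> norm ((f t)\<^sup>2 + (g t)\<^sup>2)" by simp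
qed

lemma L2_add:
  assumes "f \<in> L2 T" "g \<in> L2 T"
  shows "(\<lambda>t. f t + g t) \<in> L2 T"
proof -
  have "integrable (leb T) (\<lambda>t. (f t)\<^sup>2 + (g t)\<^sup>2 + 2 * (f t * g t))"
    using assms L2_integrable_mult[OF assms] by (simp add: L2_def)
  moreover have "(\<lambda>t. f t + g t) \<in> borel_measurable (leb T)"
    using assms by (intro borel_measurable_add) (auto simp: L2_def)
  ultimately show ?thesis by (simp add: L2_def power2_sum mult.assoc)
qed

section \<open>Uniqueness of weak derivatives\<close>

lemma has_real_derivative_max_0_square:
  "((\<lambda>x. (max 0 x)\<^sup>2) has_real_derivative 2 * max 0 x) (at (x::real))"
proof -
  consider "x < 0" | "x = 0" | "x > 0" by linarith
  then show ?thesis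
  proof cases
    case 1
    have "((\<lambda>x. 0) has_real_derivative 2 * max 0 x) (at x)" using 1 by simp
    then show ?thesis
      by (rule has_field_derivative_transform_within_open[where S = "{..<0}"]) (use 1 in auto)
  next
    case 2
    have "((\<lambda>h. max 0 h) \<longlongrightarrow> max 0 (0::real)) (at 0)"
      by (intro tendsto_intros)
    then have "((\<lambda>h. max 0 h) \<longlongrightarrow> 0) (at (0::real))" by simp
    then have "((\<lambda>h. (max 0 (0 + h) ^ 2 - (max 0 0) ^ 2) / h) \<longlongrightarrow> 0) (at (0::real))"
      by (rule Lim_transform_eventually)
        (auto simp: eventually_at_filter max_def power2_eq_square)
    then show ?thesis using 2 by (simp add: DERIV_def)
  next
    case 3
    have "((\<lambda>x. x\<^sup>2) has_real_derivative 2 * max 0 x) (at x)"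
      using 3 by (auto intro!: derivative_eq_intros)
    then show ?thesis
      by (rule has_field_derivative_transform_within_open[where S = "{0<..}"]) (use 3 in auto)
  qed
qed

text \<open>A C1 substitute for a mollified indicator, built from the C1 function (max 0 x)^2. The
  shift by 1/n pushes the support strictly inside the interval; the factor \<open>n\<close> drives
  the value to 1 wherever (t - c) * (d - t) is positive.\<close>

definition bump :: "real \<Rightarrow> real \<Rightarrow> nat \<Rightarrow> real \<Rightarrow> real"
  where "bump c d n t = 1 - inverse (1 + real n * (max 0 ((t - c) * (d - t) - 1 / real n))\<^sup>2)"

lemma bump_range: "0 \<le> bump c d n t" "bump c d n t \<le> 1"
  unfolding bump_def by (auto simp: inverse_le_1_iff)

lemma bump_test_fun:
  assumes "0 \<le> c" "c < d" "d \<le> T" "n \<ge> 1"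
  shows "bump c d n \<in> test_funs T"
proof -
  define p where "p t = (t - c) * (d - t) - 1 / real n" for t
  have pos: "1 + real n * (max 0 (p t))\<^sup>2 > 0" for t by (simp add: add_pos_nonneg)
  have "(bump c d n has_real_derivative
      (real n * (2 * max 0 (p t) * (c + d - 2 * t))) / (1 + real n * (max 0 (p t))\<^sup>2)\<^sup>2) (at t)" for t
  proof -
    have p: "(p has_real_derivative (c + d - 2 * t)) (at t)"
      unfolding p_def by (auto intro!: derivative_eq_intros simp: algebra_simps)
    have q: "((\<lambda>t. (max 0 (p t))\<^sup>2) has_real_derivative 2 * max 0 (p t) * (c + d - 2 * t)) (at t)"
      by (rule DERIV_chain2[OF has_real_derivative_max_0_square p])
    have "((\<lambda>t. 1 + real n * (max 0 (p t))\<^sup>2) has_real_derivative real n * (2 * max 0 (p t) * (c + d - 2 * t))) (at t)"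
      by (rule derivative_eq_intros q refl)+ simp
    from DERIV_diff[OF DERIV_const[of 1] DERIV_inverse'[OF this less_imp_neq[OF pos, symmetric]]]
    have "((\<lambda>t. 1 - inverse (1 + real n * (max 0 (p t))\<^sup>2)) has_real_derivative
      (real n * (2 * max 0 (p t) * (c + d - 2 * t))) / (1 + real n * (max 0 (p t))\<^sup>2)\<^sup>2) (at t)"
      by (rule DERIV_cong) (simp add: power2_eq_square divide_inverse mult_ac)
    then show ?thesis by (simp add: bump_def[abs_def] p_def)
  qed
  moreover have "continuous_on UNIV (\<lambda>t. (real n * (2 * max 0 (p t) * (c + d - 2 * t))) / (1 + real n * (max 0 (p t))\<^sup>2)\<^sup>2)"
    unfolding p_def using pos by (intro continuous_intros) (auto simp: p_def less_imp_neq[symmetric])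
  ultimately have C1: "bump c d n C1_differentiable_on UNIV"
    by (rule C1_differentiable_on_UNIV_I)
  have "{t. bump c d n t \<noteq> 0} \<subseteq> {t. 1 / real n \<le> (t - c) * (d - t)}"
    by (auto simp: bump_def max_def)
  moreover have "closed {t. 1 / real n \<le> (t - c) * (d - t)}"
    by (intro closed_Collect_le continuous_intros)
  ultimately have "closure {t. bump c d n t \<noteq> 0} \<subseteq> {t. 1 / real n \<le> (t - c) * (d - t)}"
    by (rule closure_minimal)
  also have "\<dots> \<subseteq> {0<..<T}"
  proof
    fix t assume "t \<in> {t. 1 / real n \<le> (t - c) * (d - t)}"
    then have "0 < (t - c) * (d - t)" using assms(4) by (auto intro: less_le_trans[of 0 "1 / real n"])
    then have "c < t \<and> t < d" using assms(2) by (auto simp: zero_less_mult_iff)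
    then show "t \<in> {0<..<T}" using assms by auto
  qed
  finally show ?thesis using C1 by (simp add: test_funs_def)
qed

lemma bump_tendsto:
  assumes "c < d"
  shows "(\<lambda>n. bump c d n t) \<longlonglongrightarrow> indicator {c<..<d} t"
proof (cases "c < t \<and> t < d")
  case False
  then have "(t - c) * (d - t) \<le> 0" using assms by (auto simp: mult_le_0_iff)
  then have "(t - c) * (d - t) - 1 / real n \<le> 0" for n
    using zero_le_divide_1_iff[of "real n"] by linarith
  then have "bump c d n t = 0" for n
    by (simp add: bump_def max_absorb1)
  then show ?thesis using False by simp
next
  case True
  define q where "q = (t - c) * (d - t)"
  have "filterlim (\<lambda>n. real n * (max 0 (q - 1 / real n))\<^sup>2) at_top sequentially"
  proof (rule filterlim_at_top_mult_tendsto_pos)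
    have "(\<lambda>n. (max 0 (q - 1 / real n))\<^sup>2) \<longlonglongrightarrow> (max 0 (q - 0))\<^sup>2"
      by (intro tendsto_intros lim_1_over_n)
    then show "(\<lambda>n. (max 0 (q - 1 / real n))\<^sup>2) \<longlonglongrightarrow> q\<^sup>2" using True by (simp add: q_def)
    show "0 < q\<^sup>2" using True by (intro zero_less_power) (simp add: q_def)
    show "filterlim real at_top sequentially" by (rule filterlim_real_sequentially)
  qed
  then have "filterlim (\<lambda>n. 1 + real n * (max 0 (q - 1 / real n))\<^sup>2) at_top sequentially"
    by (rule filterlim_tendsto_add_at_top[OF tendsto_const])
  then have "(\<lambda>n. inverse (1 + real n * (max 0 (q - 1 / real n))\<^sup>2)) \<longlonglongrightarrow> 0"
    by (intro tendsto_inverse_0_at_top)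
  then have "(\<lambda>n. 1 - inverse (1 + real n * (max 0 (q - 1 / real n))\<^sup>2)) \<longlonglongrightarrow> 1 - 0"
    by (intro tendsto_diff tendsto_const)
  then show ?thesis using True by (simp add: bump_def q_def)
qed

lemma L2_orthogonal_test_funs_imp_interval:
  assumes v: "v \<in> L2 T" and orth: "\<And>\<eta>. \<eta> \<in> test_funs T \<Longrightarrow> L2_inner T v \<eta> = 0"
    and "0 \<le> c" "c < d" "d \<le> T"
  shows "(LINT t|leb T. v t * indicator {c<..<d} t) = 0"
proof -
  have meas: "bump c d n \<in> borel_measurable (leb T)" for n
    unfolding bump_def by (intro borel_measurable_leb) measurable
  have ind: "indicator {c<..<d} \<in> borel_measurable (leb T)"
    by (intro borel_measurable_leb borel_measurable_indicator) simp
  have int: "integrable (leb T) (\<lambda>t. \<bar>v t\<bar>)"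
    using L2_integrable_mult[OF v bdd_meas_L2[OF bdd_meas_const[of T 1]]] by simp
  have vm: "v \<in> borel_measurable (leb T)" using v by (simp add: L2_def)
  have "(\<lambda>n. LINT t|leb T. v t * bump c d n t)
      \<longlonglongrightarrow> (LINT t|leb T. v t * indicator {c<..<d} t)"
  proof (rule integral_dominated_convergence[where w = "\<lambda>t. \<bar>v t\<bar>"])
    show "AE t in leb T. (\<lambda>n. v t * bump c d n t) \<longlonglongrightarrow> v t * indicator {c<..<d} t"
      by (intro always_eventually allI tendsto_mult tendsto_const bump_tendsto assms)
    show "AE t in leb T. norm (v t * bump c d n t) \<le> \<bar>v t\<bar>" for n
      using bump_range[of c d n] by (simp add: abs_mult mult_left_le)
  qed (use vm meas ind int in \<open>auto intro: borel_measurable_times\<close>)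
  moreover have "(LINT t|leb T. v t * bump c d n t) = 0" if "n \<ge> 1" for n
    using orth[OF bump_test_fun[OF assms(3-5) that]] by (simp add: L2_inner_def)
  then have "\<forall>\<^sub>F n in sequentially. (LINT t|leb T. v t * bump c d n t) = 0"
    by (auto simp: eventually_sequentially)
  then have "(\<lambda>n. LINT t|leb T. v t * bump c d n t) \<longlonglongrightarrow> 0"
    by (rule tendsto_eventually)
  ultimately show ?thesis using LIMSEQ_unique by blast
qed

lemma AE_leb_neq: "AE t in leb T. t \<noteq> c"
proof -
  have "AE t in lborel. t \<noteq> c" by (rule AE_lborel_singleton)
  then have "AE t in lebesgue. t \<noteq> c" by (rule AE_completion)
  then show ?thesis by (subst AE_restrict_space_iff) auto
qed

text \<open>Orthogonality to the bumps gives vanishing integrals over intervals, an induction over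
  Borel sets extends this to all of them, and a function whose integrals over all Borel sets vanish
  is zero almost everywhere.\<close>

lemma L2_orthogonal_test_funs_imp_AE_zero:
  assumes v: "v \<in> L2 T" and orth: "\<And>\<eta>. \<eta> \<in> test_funs T \<Longrightarrow> L2_inner T v \<eta> = 0"
  shows "AE t in leb T. v t = 0"
proof -
  define V where "V t = indicator {0..T} t * v t" for t
  have vm: "v \<in> borel_measurable (leb T)" using v by (simp add: L2_def)
  have vint: "integrable (leb T) v"
    using L2_integrable_mult[OF v bdd_meas_L2[OF bdd_meas_const[of T 1]]] by simp
  have Vint: "integrable lebesgue V"
    using vint integrable_restrict_space[of "{0..T}" lebesgue v] by (simp add: V_def[abs_def])
  \<comment> \<open>A Borel representative is needed because the induction and the vanishing
    criterion refer to \<open>lborel\<close>, whereas \<open>v\<close> is only Lebesgue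
    measurable.\<close>
  obtain V' where V': "V' \<in> borel_measurable lborel" "AE t in lborel. V t = V' t"
    using completion_ex_borel_measurable_real[of V lborel] Vint by auto
  have V'_leb: "AE t in lebesgue. V t = V' t" using V'(2) by (rule AE_completion)
  have V'm: "V' \<in> borel_measurable lebesgue" using V'(1) by (rule measurable_completion)
  have "integrable lebesgue V'"
    using Vint V'm V'_leb by (subst integrable_cong_AE[where g = V]) auto
  then have V'int: "integrable lborel V'"
    using V'(1) integrable_completion by blast
  have set_int: "(LINT t:A|lborel. V' t) = (LINT t|leb T. v t * indicator A t)" if "A \<in> sets borel" for A
  proof -
    have "(LINT t:A|lborel. V' t) = (LINT t|lebesgue. indicator A t *\<^sub>R V' t)"
      unfolding set_lebesgue_integral_def using V'(1) that by (intro integral_completion[symmetric]) auto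
    also have "\<dots> = (LINT t|lebesgue. indicator {0..T} t *\<^sub>R (v t * indicator A t))"
    proof (rule integral_cong_AE)
      have Am: "A \<in> sets lebesgue" using that by simp
      show "(\<lambda>t. indicator A t *\<^sub>R V' t) \<in> borel_measurable lebesgue" using V'm Am by auto
      have "(\<lambda>t. V t * indicator A t) \<in> borel_measurable lebesgue"
        using Vint Am by (intro borel_measurable_times borel_measurable_indicator) auto
      then show "(\<lambda>t. indicator {0..T} t *\<^sub>R (v t * indicator A t)) \<in> borel_measurable lebesgue"
        by (simp add: V_def mult.assoc)
      show "AE t in lebesgue. indicator A t *\<^sub>R V' t = indicator {0..T} t *\<^sub>R (v t * indicator A t)"
        using V'_leb by eventually_elim (auto simp: V_def)
    qed
    also have "\<dots> = (LINT t|leb T. v t * indicator A t)"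
      by (rule integral_restrict_space[symmetric]) auto
    finally show ?thesis .
  qed
  have sum_A: "(LINT t:A|lborel. V' t) = 0" if "A \<in> sets borel" for A
    using that
  proof (induction rule: borel_set_induct)
    case empty
    then show ?case by (simp add: set_lebesgue_integral_def)
  next
    case (interval a b)
    \<comment> \<open>Clipping to the base interval; passing from the closed to the open interval
      changes only null sets.\<close>
    define c d where "c = max a 0" and "d = min b T"
    have cd: "AE t in leb T. indicator {a..b} t = (indicator {c<..<d} t :: real)"
      using AE_leb_neq[where T = T and c = c] AE_leb_neq[where T = T and c = d] AE_space[of "leb T"]
      by eventually_elim (auto simp: c_def d_def indicator_def)
    have "(LINT t|leb T. v t * indicator {a..b} t) = (LINT t|leb T. v t * indicator {c<..<d} t)"
    proof (rule integral_cong_AE)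
      show "(\<lambda>t. v t * indicator {a..b} t) \<in> borel_measurable (leb T)"
        "(\<lambda>t. v t * indicator {c<..<d} t) \<in> borel_measurable (leb T)"
        by (intro borel_measurable_times vm borel_measurable_leb borel_measurable_indicator; measurable)+
      show "AE t in leb T. v t * indicator {a..b} t = v t * indicator {c<..<d} t"
        using cd by eventually_elim simp
    qed
    also have "\<dots> = 0"
    proof (cases "c < d")
      case True
      then show ?thesis
        using L2_orthogonal_test_funs_imp_interval[OF v orth, of c d] by (simp add: c_def d_def)
    qed simp
    finally show ?case by (subst set_int) auto
  next
    \<comment> \<open>Complements require the integral over the whole line, which is again an
      interval integral, over the open base interval.\<close>
    case (compl A)
    have "(LINT t|leb T. v t * indicator UNIV t) = 0"
    proof (cases "T > 0")
      case True
      have ae: "AE t in leb T. v t * indicator UNIV t = v t * indicator {0<..<T} t"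
        using AE_leb_neq[where T = T and c = 0] AE_leb_neq[where T = T and c = T] AE_space[of "leb T"]
        by eventually_elim (auto simp: indicator_def)
      have "(LINT t|leb T. v t * indicator UNIV t) = (LINT t|leb T. v t * indicator {0<..<T} t)"
        by (rule integral_cong_AE[OF _ _ ae])
          (intro borel_measurable_times vm borel_measurable_leb borel_measurable_indicator; measurable)+
      then show ?thesis
        using L2_orthogonal_test_funs_imp_interval[OF v orth, of 0 T] True by simp
    next
      case False
      have "AE t in leb T. v t * indicator UNIV t = 0"
        using AE_leb_neq[where T = T and c = 0] AE_space[of "leb T"] by eventually_elim (use False in auto)
      then show ?thesis by (rule integral_eq_zero_AE)
    qed
    then have "(LINT t:UNIV|lborel. V' t) = 0" by (subst set_int) auto
    moreover have "(LINT t:(A \<union> -A)|lborel. V' t) = (LINT t:A|lborel. V' t) + (LINT t:(-A)|lborel. V' t)"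
      using compl(1) unfolding set_integrable_def[symmetric]
      by (intro set_integral_Un) (auto simp del: real_scaleR_def simp: set_integrable_def intro!: integrable_mult_indicator V'int)
    ultimately show ?case using compl by simp
  next
    case (union f)
    have "(LINT t:(\<Union>i. f i)|lborel. V' t) = (\<Sum>i. (LINT t:(f i)|lborel. V' t))"
    proof (rule lebesgue_integral_countable_add)
      show "f i \<inter> f j = {}" if "i \<noteq> j" for i j
        using union(1) that by (auto simp: disjoint_family_on_def)
      show "set_integrable lborel (\<Union>i. f i) V'"
        unfolding set_integrable_def using V'int union(2) by (intro integrable_mult_indicator) auto
    qed (use union(2) in auto)
    then show ?case using union(3) by simp
  qed
  have "AE t in lborel. V' t = 0"
    by (rule sigma_finite_measure.density_zero[OF lborel.sigma_finite_measure_axioms V'int]) (use sum_A in simp)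
  then have "AE t in lebesgue. V' t = 0" by (rule AE_completion)
  with V'_leb have "AE t in lebesgue. V t = 0" by eventually_elim simp
  then have "AE t in lebesgue. t \<in> {0..T} \<longrightarrow> v t = 0"
    by eventually_elim (auto simp: V_def)
  then show ?thesis by (subst AE_restrict_space_iff) auto
qed

lemma has_weak_D_in_L2: "has_weak_D T n u v \<Longrightarrow> v \<in> L2 T"
  by (cases n) auto

lemma C1_bdd_meas:
  assumes "g C1_differentiable_on UNIV"
  shows "bdd_meas T g" "bdd_meas T (deriv g)"
proof -
  show "bdd_meas T g" by (intro bdd_meas_continuous C1_imp_continuous_on assms)
  have "continuous_on UNIV (deriv g)" using assms by (simp add: C1_differentiable_on_UNIV_iff)
  then show "bdd_meas T (deriv g)" by (rule bdd_meas_continuous[OF continuous_on_subset]) simp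
qed

lemma test_fun_bdd_meas:
  assumes "\<eta> \<in> test_funs T"
  shows "bdd_meas T \<eta>" "bdd_meas T (deriv \<eta>)"
  using assms C1_bdd_meas by (auto simp: test_funs_def)

text \<open>Two derivations of the same order may pass through different intermediate derivatives.
  By induction these agree almost everywhere, so the difference of the final functions is orthogonal
  to all test functions.\<close>

lemma has_weak_D_unique:
  assumes "has_weak_D T n u v1" "has_weak_D T n u v2"
  shows "AE t in leb T. v1 t = v2 t"
  using assms
proof (induction n arbitrary: v1 v2)
  case 0
  then have "AE t in leb T. v1 t = u t" "AE t in leb T. v2 t = u t" by auto
  then show ?case by eventually_elim simp
next
  case (Suc n)
  from Suc.prems obtain w1 where w1: "has_weak_D T n u w1" "v1 \<in> L2 T"
    "\<And>\<eta>. \<eta> \<in> test_funs T \<Longrightarrow> L2_inner T w1 (deriv \<eta>) = - L2_inner T v1 \<eta>" by auto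
  from Suc.prems obtain w2 where w2: "has_weak_D T n u w2" "v2 \<in> L2 T"
    "\<And>\<eta>. \<eta> \<in> test_funs T \<Longrightarrow> L2_inner T w2 (deriv \<eta>) = - L2_inner T v2 \<eta>" by auto
  have ae: "AE t in leb T. w1 t = w2 t" by (rule Suc.IH[OF w1(1) w2(1)])
  have m: "w1 \<in> L2 T" "w2 \<in> L2 T" using w1 w2 has_weak_D_in_L2 by auto
  have neg: "(\<lambda>t. - v2 t) \<in> L2 T" using w2(2) by (simp add: L2_def)
  have "AE t in leb T. v1 t + - v2 t = 0"
  proof (rule L2_orthogonal_test_funs_imp_AE_zero[OF L2_add[OF w1(2) neg]])
    fix \<eta> assume \<eta>: "\<eta> \<in> test_funs T"
    note L = bdd_meas_L2[OF test_fun_bdd_meas(1)[OF \<eta>]] bdd_meas_L2[OF test_fun_bdd_meas(2)[OF \<eta>]]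
    have "L2_inner T w1 (deriv \<eta>) = L2_inner T w2 (deriv \<eta>)"
      unfolding L2_inner_def
      by (rule integral_cong_AE)
        (use L2_integrable_mult[OF m(1) L(2)] L2_integrable_mult[OF m(2) L(2)] ae in auto)
    then have "L2_inner T v1 \<eta> = L2_inner T v2 \<eta>" using w1(3)[OF \<eta>] w2(3)[OF \<eta>] by simp
    then show "L2_inner T (\<lambda>t. v1 t + - v2 t) \<eta> = 0"
      using L2_integrable_mult[OF w1(2) L(1)] L2_integrable_mult[OF w2(2) L(1)]
      by (simp add: L2_inner_def left_diff_distrib Bochner_Integration.integral_diff)
  qed
  then show ?case by eventually_elim simp
qed

lemma weak_D_AE_eq:
  assumes "has_weak_D T n u v"
  shows "weak_D T n u \<in> L2 T" "AE t in leb T. weak_D T n u t = v t"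
proof -
  have *: "has_weak_D T n u (weak_D T n u)"
    unfolding weak_D_def by (rule someI[where P = "has_weak_D T n u", OF assms])
  then show "weak_D T n u \<in> L2 T" by (rule has_weak_D_in_L2)
  show "AE t in leb T. weak_D T n u t = v t" by (rule has_weak_D_unique[OF * assms])
qed

text \<open>The conclusion is equality of functions: the predicates characterizing the derivatives
  coincide, so the choice operator returns the same representative. This allows \<psi>, which is
  identified only almost everywhere, to be exchanged under the derivative.\<close>

lemma weak_D_cong_AE:
  assumes "AE t in leb T. u t = v t" "v \<in> L2 T" "u \<in> L2 T"
  shows "weak_D T n u = weak_D T n v"
proof -
  have "has_weak_D T n u = has_weak_D T n v"
  proof (induction n)
    case 0
    have "(AE t in leb T. w t = u t) \<longleftrightarrow> (AE t in leb T. w t = v t)" for w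
      using assms(1) by (auto elim!: eventually_elim2)
    then show ?case using assms by (auto simp: fun_eq_iff)
  qed (auto simp: fun_eq_iff)
  then show ?thesis by (simp add: weak_D_def)
qed

lemma L2_inner_weak_D:
  assumes "has_weak_D T n u u'" "has_weak_D T m v v'"
  shows "L2_inner T (weak_D T n u) (weak_D T m v) = L2_inner T u' v'"
  unfolding L2_inner_def
proof (rule integral_cong_AE)
  show "AE t in leb T. weak_D T n u t * weak_D T m v t = u' t * v' t"
    using weak_D_AE_eq(2)[OF assms(1)] weak_D_AE_eq(2)[OF assms(2)] by eventually_elim simp
qed (use weak_D_AE_eq(1)[OF assms(1)] weak_D_AE_eq(1)[OF assms(2)] assms[THEN has_weak_D_in_L2] in
  \<open>auto simp: L2_def intro!: borel_measurable_times\<close>)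

section \<open>Primitives and integration by parts\<close>

text \<open>Written with an indicator, it is defined on the whole line and constant on either side
  of the base interval. Hence it is bounded and continuous on all of the reals.\<close>

definition primitive :: "real \<Rightarrow> (real \<Rightarrow> real) \<Rightarrow> real \<Rightarrow> real"
  where "primitive T h t = (LINT r|leb T. indicator {..t} r * h r)"

lemma bdd_meas_indicator_atMost: "bdd_meas T (indicator {..t})"
proof (rule bdd_measI[where B = 1])
  show "indicator {..t} \<in> borel_measurable (leb T)"
    by (intro borel_measurable_leb borel_measurable_indicator) simp
qed (simp add: indicator_def)

lemma primitive_add:
  assumes "bdd_meas T f" "bdd_meas T g"
  shows "primitive T (\<lambda>t. f t + g t) t = primitive T f t + primitive T g t"
  unfolding primitive_def distrib_left
  by (intro Bochner_Integration.integral_add bdd_meas_integrable bdd_meas_mult assms bdd_meas_indicator_atMost)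

lemma primitive_scale: "primitive T (\<lambda>t. c * f t) t = c * primitive T f t"
  unfolding primitive_def by (simp add: mult.left_commute)

lemma primitive_bound:
  assumes "T \<ge> 0" "h \<in> borel_measurable (leb T)" "\<And>t. t \<in> {0..T} \<Longrightarrow> \<bar>h t\<bar> \<le> B"
  shows "\<bar>primitive T h t\<bar> \<le> B * T"
  unfolding primitive_def
proof (rule integral_bdd_meas_le[OF assms(1)])
  have "bdd_meas T h" by (rule bdd_measI[OF assms(2,3)])
  then show "(\<lambda>r. indicator {..t} r * h r) \<in> borel_measurable (leb T)"
    using bdd_meas_mult[OF bdd_meas_indicator_atMost] by (auto simp: bdd_meas_def)
  fix r assume "r \<in> {0..T}"
  then show "\<bar>indicator {..t} r * h r\<bar> \<le> B"
    using assms(3)[of r] by (auto simp: indicator_def)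
qed

lemma primitive_Lipschitz:
  assumes "h \<in> borel_measurable (leb T)" "\<And>t. t \<in> {0..T} \<Longrightarrow> \<bar>h t\<bar> \<le> B" "B \<ge> 0"
  shows "\<bar>primitive T h t - primitive T h s\<bar> \<le> B * \<bar>t - s\<bar>"
proof -
  have bm: "bdd_meas T h" by (rule bdd_measI[OF assms(1,2)])
  have le: "\<bar>primitive T h t - primitive T h s\<bar> \<le> B * (t - s)" if "s \<le> t" for s t
  proof -
    have "primitive T h t - primitive T h s
        = (LINT r|leb T. indicator {..t} r * h r - indicator {..s} r * h r)"
      unfolding primitive_def
      by (intro Bochner_Integration.integral_diff[symmetric] bdd_meas_integrable bdd_meas_mult bm
          bdd_meas_indicator_atMost)
    also have "\<bar>\<dots>\<bar> \<le> (LINT r|leb T. \<bar>indicator {..t} r * h r - indicator {..s} r * h r\<bar>)"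
      by (rule integral_abs_bound)
    also have "\<dots> \<le> (LINT r|leb T. B * indicator {s<..t} r)"
    proof (rule integral_mono)
      show "integrable (leb T) (\<lambda>r. \<bar>indicator {..t} r * h r - indicator {..s} r * h r\<bar>)"
        by (intro integrable_abs bdd_meas_integrable bdd_meas_diff bdd_meas_mult bm bdd_meas_indicator_atMost)
      have "bdd_meas T (\<lambda>r. B * (indicator {..t} r - indicator {..s} r))"
        by (intro bdd_meas_intros bdd_meas_indicator_atMost)
      moreover have "indicator {..t} r - indicator {..s} r = (indicator {s<..t} r :: real)" for r
        using that by (auto simp: indicator_def)
      ultimately show "integrable (leb T) (\<lambda>r. B * indicator {s<..t} r)"
        by (intro bdd_meas_integrable) simp
      fix r assume "r \<in> space (leb T)"
      then show "\<bar>indicator {..t} r * h r - indicator {..s} r * h r\<bar> \<le> B * indicator {s<..t} r"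
        using assms(2)[of r] that by (auto simp: indicator_def)
    qed
    also have "\<dots> = B * measure lebesgue ({s<..t} \<inter> {0..T})"
      by (simp add: measure_restrict_space Int_commute)
    also have "\<dots> \<le> B * measure lebesgue {s..t}"
      by (intro mult_left_mono assms measure_mono_fmeasurable) auto
    also have "\<dots> = B * (t - s)" using that by simp
    finally show ?thesis .
  qed
  show ?thesis
    using le[of s t] le[of t s] by (cases "s \<le> t") (auto simp: abs_minus_commute)
qed

lemma primitive_continuous:
  assumes "bdd_meas T h"
  shows "continuous_on A (primitive T h)"
proof -
  obtain B where "B \<ge> 0" "h \<in> borel_measurable (leb T)" "\<And>t. t \<in> {0..T} \<Longrightarrow> \<bar>h t\<bar> \<le> B"
    using bdd_measE[OF assms] by metis
  then have "B-lipschitz_on A (primitive T h)"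
    using primitive_Lipschitz[of h T B] by (intro lipschitz_onI) (auto simp: dist_real_def)
  then show ?thesis by (rule lipschitz_on_continuous_on)
qed

lemma primitive_0: "primitive T h 0 = 0"
  unfolding primitive_def
proof (rule integral_eq_zero_AE)
  show "AE r in leb T. indicator {..0} r * h r = 0"
    using AE_leb_neq[where T = T and c = 0] AE_space[of "leb T"] by eventually_elim (auto simp: indicator_def)
qed

lemma primitive_T: "primitive T h T = (LINT t|leb T. h t)"
  unfolding primitive_def by (rule Bochner_Integration.integral_cong) (auto simp: indicator_def)

text \<open>Integration by parts against all C1 functions, with boundary terms. Unlike the version
  with compactly supported test functions, it is stable under multiplication by C1 functions and can
  be tested directly with trigonometric functions.\<close>

definition weak_deriv :: "real \<Rightarrow> (real \<Rightarrow> real) \<Rightarrow> (real \<Rightarrow> real) \<Rightarrow> bool"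
  where "weak_deriv T u v \<longleftrightarrow> bdd_meas T u \<and> bdd_meas T v \<and>
    (\<forall>g. g C1_differentiable_on UNIV \<longrightarrow>
      (LINT t|leb T. u t * deriv g t) = u T * g T - u 0 * g 0 - (LINT t|leb T. v t * g t))"

lemma integral_deriv_Icc:
  assumes g: "g C1_differentiable_on UNIV" and "0 \<le> c" "c \<le> d" "d \<le> T"
  shows "(LINT t|leb T. (if t \<in> {c..d} then deriv g t else 0)) = g d - (g c :: real)"
proof -
  have "continuous_on {0..T} (deriv g)"
    using g continuous_on_subset[of UNIV "deriv g"] by (simp add: C1_differentiable_on_UNIV_iff)
  then have "(LINT t|leb T. (if t \<in> {c..d} then deriv g t else 0)) = integral {c..d} (deriv g)"
    using assms by (intro integral_leb_Icc)
  also have "(deriv g has_integral (g d - g c)) {c..d}"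
    using g assms(3)
    by (intro fundamental_theorem_of_calculus)
      (auto simp: C1_differentiable_on_UNIV_iff has_real_derivative_iff_has_vector_derivative
        intro: has_vector_derivative_at_within)
  then have "integral {c..d} (deriv g) = g d - g c" by (rule integral_unique)
  finally show ?thesis .
qed

lemma weak_deriv_one:
  assumes "T \<ge> 0"
  shows "weak_deriv T (\<lambda>t. 1) (\<lambda>t. 0)"
  unfolding weak_deriv_def
proof (intro conjI allI impI bdd_meas_const)
  fix g :: "real \<Rightarrow> real" assume g: "g C1_differentiable_on UNIV"
  have "(LINT t|leb T. 1 * deriv g t) = (LINT t|leb T. (if t \<in> {0..T} then deriv g t else 0))"
    by (rule Bochner_Integration.integral_cong) auto
  also have "\<dots> = g T - g 0" using integral_deriv_Icc[OF g] assms by simp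
  finally show "(LINT t|leb T. 1 * deriv g t) = 1 * g T - 1 * g 0 - (LINT t|leb T. 0 * g t)" by simp
qed

text \<open>The product rule comes from testing \<open>u\<close> with \<open>c * g\<close> in place
  of \<open>g\<close>.\<close>

lemma weak_deriv_mult:
  assumes u: "weak_deriv T u v" and c: "c C1_differentiable_on UNIV"
  shows "weak_deriv T (\<lambda>t. c t * u t) (\<lambda>t. deriv c t * u t + c t * v t)"
proof -
  have bm: "bdd_meas T u" "bdd_meas T v" using u by (auto simp: weak_deriv_def)
  note bc = C1_bdd_meas[OF c]
  show ?thesis unfolding weak_deriv_def
  proof (intro conjI allI impI bdd_meas_intros bm bc)
    fix g :: "real \<Rightarrow> real" assume g: "g C1_differentiable_on UNIV"
    note bg = C1_bdd_meas[OF g]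
    have cg: "(\<lambda>t. c t * g t) C1_differentiable_on UNIV"
      using c g by (rule C1_differentiable_on_mult)
    have dcg: "deriv (\<lambda>t. c t * g t) t = deriv c t * g t + c t * deriv g t" for t
      using c g by (intro DERIV_imp_deriv)
        (auto simp: C1_differentiable_on_UNIV_iff intro!: derivative_eq_intros)
    have eq: "(LINT t|leb T. u t * (deriv c t * g t + c t * deriv g t))
        = u T * (c T * g T) - u 0 * (c 0 * g 0) - (LINT t|leb T. v t * (c t * g t))"
      using u cg dcg unfolding weak_deriv_def by (simp flip: dcg)
    have 1: "(LINT t|leb T. u t * (deriv c t * g t + c t * deriv g t))
        = (LINT t|leb T. deriv c t * u t * g t) + (LINT t|leb T. c t * u t * deriv g t)"
      by (subst Bochner_Integration.integral_add[symmetric])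
        (auto intro!: bdd_meas_integrable bdd_meas_intros bm bc bg simp: algebra_simps)
    have 2: "(LINT t|leb T. (deriv c t * u t + c t * v t) * g t)
        = (LINT t|leb T. deriv c t * u t * g t) + (LINT t|leb T. v t * (c t * g t))"
      by (subst Bochner_Integration.integral_add[symmetric])
        (auto intro!: bdd_meas_integrable bdd_meas_intros bm bc bg simp: algebra_simps)
    show "(LINT t|leb T. c t * u t * deriv g t) = c T * u T * g T - c 0 * u 0 * g 0
        - (LINT t|leb T. (deriv c t * u t + c t * v t) * g t)"
      using eq unfolding 1 2 by (simp add: mult_ac)
  qed
qed

lemma weak_deriv_C1:
  assumes "T \<ge> 0" "c C1_differentiable_on UNIV"
  shows "weak_deriv T c (deriv c)"
  using weak_deriv_mult[OF weak_deriv_one[OF assms(1)] assms(2)] by simp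

lemma weak_deriv_add:
  assumes "weak_deriv T u v" "weak_deriv T x y"
  shows "weak_deriv T (\<lambda>t. u t + x t) (\<lambda>t. v t + y t)"
proof -
  have bm: "bdd_meas T u" "bdd_meas T v" "bdd_meas T x" "bdd_meas T y"
    using assms by (auto simp: weak_deriv_def)
  show ?thesis unfolding weak_deriv_def
  proof (intro conjI allI impI bdd_meas_intros bm)
    fix g :: "real \<Rightarrow> real" assume g: "g C1_differentiable_on UNIV"
    note bg = C1_bdd_meas[OF g]
    have 1: "(LINT t|leb T. (u t + x t) * deriv g t) = (LINT t|leb T. u t * deriv g t) + (LINT t|leb T. x t * deriv g t)"
      and 2: "(LINT t|leb T. (v t + y t) * g t) = (LINT t|leb T. v t * g t) + (LINT t|leb T. y t * g t)"
      unfolding distrib_right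
      by (intro Bochner_Integration.integral_add bdd_meas_integrable bdd_meas_intros bm bg)+
    show "(LINT t|leb T. (u t + x t) * deriv g t)
        = (u T + x T) * g T - (u 0 + x 0) * g 0 - (LINT t|leb T. (v t + y t) * g t)"
    proof -
      have "(LINT t|leb T. u t * deriv g t) = u T * g T - u 0 * g 0 - (LINT t|leb T. v t * g t)"
        "(LINT t|leb T. x t * deriv g t) = x T * g T - x 0 * g 0 - (LINT t|leb T. y t * g t)"
        using assms g unfolding weak_deriv_def by blast+
      then show ?thesis unfolding 1 2 by (simp only:) (simp add: algebra_simps)
    qed
  qed
qed

text \<open>Fubini on the triangle r <= t: integrating the derivative of \<open>g\<close> from
  \<open>r\<close> to the right end leaves g(T) - g(r).\<close>

lemma weak_deriv_primitive:
  assumes T: "T \<ge> 0" and h: "bdd_meas T h"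
  shows "weak_deriv T (primitive T h) h"
  unfolding weak_deriv_def
proof (intro conjI allI impI h)
  show "bdd_meas T (primitive T h)" by (intro bdd_meas_continuous primitive_continuous h)
  fix g :: "real \<Rightarrow> real" assume g: "g C1_differentiable_on UNIV"
  note bg = C1_bdd_meas[OF g]
  obtain a where a: "a \<ge> 0" "h \<in> borel_measurable (leb T)" "\<And>t. t \<in> {0..T} \<Longrightarrow> \<bar>h t\<bar> \<le> a"
    using bdd_measE[OF h] by metis
  obtain b where b: "b \<ge> 0" "deriv g \<in> borel_measurable (leb T)" "\<And>t. t \<in> {0..T} \<Longrightarrow> \<bar>deriv g t\<bar> \<le> b"
    using bdd_measE[OF bg(2)] by metis
  interpret finite_measure "leb T" by (rule finite_measure_leb)
  interpret PP: pair_sigma_finite "leb T" "leb T" ..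
  interpret PF: finite_measure "leb T \<Otimes>\<^sub>M leb T"
    by (intro finite_measure_pair_measure finite_measure_leb)
  note [measurable] = a(2) b(2) id_measurable_leb
  have f [measurable]: "fst \<in> borel_measurable (leb T \<Otimes>\<^sub>M leb T)" "snd \<in> borel_measurable (leb T \<Otimes>\<^sub>M leb T)"
    by (rule measurable_compose[OF measurable_fst id_measurable_leb])
      (rule measurable_compose[OF measurable_snd id_measurable_leb])
  have int: "integrable (leb T \<Otimes>\<^sub>M leb T) (\<lambda>(r, t). (if r \<le> t then h r * deriv g t else 0))"
  proof (rule PF.integrable_const_bound[where B = "a * b"])
    show "(\<lambda>(r, t). (if r \<le> t then h r * deriv g t else 0)) \<in> borel_measurable (leb T \<Otimes>\<^sub>M leb T)"
      unfolding case_prod_beta' by measurable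
    have "\<bar>if r \<le> t then h r * deriv g t else 0\<bar> \<le> a * b" if "r \<in> {0..T}" "t \<in> {0..T}" for r t
      using mult_mono[OF a(3)[OF that(1)] b(3)[OF that(2)] a(1)] a b by (auto simp: abs_mult)
    then show "AE x in leb T \<Otimes>\<^sub>M leb T. norm (case x of (r, t) \<Rightarrow> (if r \<le> t then h r * deriv g t else 0)) \<le> a * b"
      by (intro AE_I2) (auto simp: space_pair_measure)
  qed
  have "(LINT t|leb T. primitive T h t * deriv g t)
      = (LINT t|leb T. LINT r|leb T. (if r \<le> t then h r * deriv g t else 0))"
  proof (rule Bochner_Integration.integral_cong[OF refl])
    fix t
    have "primitive T h t * deriv g t = (LINT r|leb T. indicator {..t} r * h r * deriv g t)"
      unfolding primitive_def by simp
    also have "\<dots> = (LINT r|leb T. (if r \<le> t then h r * deriv g t else 0))"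
      by (rule Bochner_Integration.integral_cong) (auto simp: indicator_def)
    finally show "primitive T h t * deriv g t = (LINT r|leb T. (if r \<le> t then h r * deriv g t else 0))" .
  qed
  also have "\<dots> = (LINT r|leb T. LINT t|leb T. (if r \<le> t then h r * deriv g t else 0))"
    by (rule PP.Fubini_integral[OF int])
  also have "\<dots> = (LINT r|leb T. h r * (g T - g r))"
  proof (rule Bochner_Integration.integral_cong[OF refl])
    fix r assume r: "r \<in> space (leb T)"
    have "(LINT t|leb T. (if r \<le> t then h r * deriv g t else 0))
        = (LINT t|leb T. h r * (if t \<in> {r..T} then deriv g t else 0))"
      by (rule Bochner_Integration.integral_cong) auto
    also have "\<dots> = h r * (g T - g r)"
      using integral_deriv_Icc[OF g, of r T T] r by simp
    finally show "(LINT t|leb T. (if r \<le> t then h r * deriv g t else 0)) = h r * (g T - g r)" .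
  qed
  also have "\<dots> = primitive T h T * g T - (LINT t|leb T. h t * g t)"
    unfolding primitive_T right_diff_distrib
    by (subst Bochner_Integration.integral_diff) (auto intro!: bdd_meas_integrable bdd_meas_intros h bg)
  finally show "(LINT t|leb T. primitive T h t * deriv g t)
      = primitive T h T * g T - primitive T h 0 * g 0 - (LINT t|leb T. h t * g t)"
    by (simp add: primitive_0)
qed

lemma weak_deriv_test_fun:
  assumes "weak_deriv T u v" "\<eta> \<in> test_funs T"
  shows "L2_inner T u (deriv \<eta>) = - L2_inner T v \<eta>"
proof -
  have "\<eta> 0 = 0" "\<eta> T = 0"
    using assms(2) closure_subset[of "{t. \<eta> t \<noteq> 0}"] by (fastforce simp: test_funs_def)+
  then show ?thesis
    using assms by (auto simp: weak_deriv_def test_funs_def L2_inner_def)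
qed

lemma weak_deriv_imp_has_weak_D:
  assumes "weak_deriv T u u1" "weak_deriv T u1 u2"
  shows "has_weak_D T 0 u u" "has_weak_D T 1 u u1" "has_weak_D T 2 u u2"
proof -
  have L: "u \<in> L2 T" "u1 \<in> L2 T" "u2 \<in> L2 T"
    using assms by (auto simp: weak_deriv_def bdd_meas_L2)
  show 0: "has_weak_D T 0 u u" using L by simp
  have 1: "has_weak_D T (Suc 0) u u1"
    using 0 L weak_deriv_test_fun[OF assms(1)] has_weak_D.simps(2)[of T 0 u u1] by blast
  then show "has_weak_D T 1 u u1" by (simp only: One_nat_def)
  have "has_weak_D T (Suc (Suc 0)) u u2"
    using 1 L weak_deriv_test_fun[OF assms(2)] has_weak_D.simps(2)[of T "Suc 0" u u2] by blast
  then show "has_weak_D T 2 u u2" by (simp only: numeral_2_eq_2)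
qed

lemma weak_deriv_imp_Hs:
  assumes "weak_deriv T u u1" "weak_deriv T u1 u2"
    and "continuous_on {0..T} u" "u 0 = u T" "continuous_on {0..T} u1" "u1 0 = u1 T"
  shows "u \<in> Hs T 2"
proof -
  note D = weak_deriv_imp_has_weak_D[OF assms(1,2)]
  have "\<exists>v. has_weak_D T \<alpha> u v \<and> continuous_on {0..T} v \<and> v 0 = v T" if "\<alpha> < 2" for \<alpha>
  proof -
    have "\<alpha> = 0 \<or> \<alpha> = 1" using that by auto
    then show ?thesis using D(1,2) assms(3-6) by blast
  qed
  then show ?thesis using D(3) unfolding Hs_def by blast
qed

lemma Hs_inner_2:
  assumes "weak_deriv T u u1" "weak_deriv T u1 u2" "weak_deriv T v v1" "weak_deriv T v1 v2"
  shows "Hs_inner T 2 u v = L2_inner T u v + L2_inner T u1 v1 + L2_inner T u2 v2"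
proof -
  note D = weak_deriv_imp_has_weak_D[OF assms(1,2)] and E = weak_deriv_imp_has_weak_D[OF assms(3,4)]
  have "Hs_inner T 2 u v = L2_inner T (weak_D T 0 u) (weak_D T 0 v)
      + L2_inner T (weak_D T 1 u) (weak_D T 1 v) + L2_inner T (weak_D T 2 u) (weak_D T 2 v)"
    by (simp add: Hs_inner_def numeral_2_eq_2)
  then show ?thesis
    unfolding L2_inner_weak_D[OF D(1) E(1)] L2_inner_weak_D[OF D(2) E(2)] L2_inner_weak_D[OF D(3) E(3)] .
qed

section \<open>Inverting the linear operator\<close>

lemma L2_inner_commute: "L2_inner T f g = L2_inner T g f"
  by (simp add: L2_inner_def mult.commute)

lemma L2_inner_add_left:
  assumes "f \<in> L2 T" "g \<in> L2 T" "h \<in> L2 T"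
  shows "L2_inner T (\<lambda>t. f t + g t) h = L2_inner T f h + L2_inner T g h"
  using L2_integrable_mult[OF assms(1,3)] L2_integrable_mult[OF assms(2,3)]
  by (simp add: L2_inner_def distrib_right)

lemma L2_inner_scale_left: "L2_inner T (\<lambda>t. c * f t) h = c * L2_inner T f h"
  by (simp add: L2_inner_def mult.assoc)

lemma L2_inner_cong_AE:
  assumes "f \<in> borel_measurable (leb T)" "g \<in> borel_measurable (leb T)" "h \<in> borel_measurable (leb T)"
    and "AE t in leb T. f t = g t"
  shows "L2_inner T f h = L2_inner T g h"
  unfolding L2_inner_def using assms(4)
  by (intro integral_cong_AE borel_measurable_times assms) (auto elim!: eventually_mono)

lemma has_weak_D_imp_L2: "has_weak_D T n u v \<Longrightarrow> u \<in> L2 T"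
  by (induction n arbitrary: v) auto

locale trig_basis =
  fixes T :: real and k :: nat
  assumes T: "T > 0" and k: "k \<ge> 1"
begin

abbreviation "\<phi> \<equiv> phi_cos T k"
abbreviation "\<theta> \<equiv> phi_sin T k"

definition \<omega> :: real where "\<omega> = 2 * pi * real k / T"

lemma \<omega>_pos: "\<omega> > 0"
  using T k by (simp add: \<omega>_def)

lemma sigma_eq: "sigma T k = \<omega>\<^sup>2"
  by (simp add: sigma_def \<omega>_def)

lemma \<phi>_eq: "\<phi> = (\<lambda>t. sqrt (2 / T) * cos (\<omega> * t))"
  and \<theta>_eq: "\<theta> = (\<lambda>t. sqrt (2 / T) * sin (\<omega> * t))"
  by (auto simp: phi_cos_def phi_sin_def \<omega>_def)

lemma deriv_\<phi>: "(\<phi> has_real_derivative - \<omega> * \<theta> t) (at t)"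
  and deriv_\<theta>: "(\<theta> has_real_derivative \<omega> * \<phi> t) (at t)"
  unfolding \<phi>_eq \<theta>_eq by (auto intro!: derivative_eq_intros)

lemma cont_\<phi>: "continuous_on A \<phi>" and cont_\<theta>: "continuous_on A \<theta>"
  unfolding \<phi>_eq \<theta>_eq by (intro continuous_intros)+

lemma square_sum: "(\<phi> t)\<^sup>2 + (\<theta> t)\<^sup>2 = 2 / T"
proof -
  have "(\<phi> t)\<^sup>2 + (\<theta> t)\<^sup>2 = (sqrt (2 / T))\<^sup>2 * ((cos (\<omega> * t))\<^sup>2 + (sin (\<omega> * t))\<^sup>2)"
    by (simp only: \<phi>_eq \<theta>_eq power_mult_distrib distrib_left)
  also have "\<dots> = (sqrt (2 / T))\<^sup>2" by (simp only: sin_cos_squared_add2 mult_1_right)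
  also have "\<dots> = 2 / T" using T by (intro real_sqrt_pow2) simp
  finally show ?thesis .
qed

lemma period: "\<phi> T = \<phi> 0" "\<theta> T = \<theta> 0"
proof -
  have "\<omega> * T = 2 * real k * pi" using T by (simp add: \<omega>_def)
  then show "\<phi> T = \<phi> 0" "\<theta> T = \<theta> 0"
    unfolding \<phi>_eq \<theta>_eq by (simp_all only: cos_2npi sin_2npi) simp_all
qed

lemma bounds: "\<bar>\<phi> t\<bar> \<le> sqrt (2 / T)" "\<bar>\<theta> t\<bar> \<le> sqrt (2 / T)"
  using T by (simp_all add: \<phi>_eq \<theta>_eq abs_mult mult_left_le)

lemma bm_\<phi>: "bdd_meas T \<phi>" and bm_\<theta>: "bdd_meas T \<theta>"
  by (intro bdd_meas_continuous cont_\<phi> cont_\<theta>)+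

text \<open>On kernel coordinates, differentiation is \<omega> times a quarter turn; applied twice
  it is multiplication by -\<omega>^2.\<close>

lemma Lmap_has_derivative:
  "(Lmap T k p has_real_derivative Lmap T k (\<omega> * snd p, - \<omega> * fst p) t) (at t)"
  unfolding Lmap_def using deriv_\<phi>[of t] deriv_\<theta>[of t]
  by (auto intro!: derivative_eq_intros simp: algebra_simps)

lemma cont_Lmap: "continuous_on A (Lmap T k p)"
  unfolding Lmap_def by (intro continuous_intros cont_\<phi> cont_\<theta>)

lemma Lmap_C1: "Lmap T k p C1_differentiable_on UNIV"
  and deriv_Lmap: "deriv (Lmap T k p) = Lmap T k (\<omega> * snd p, - \<omega> * fst p)"
  by (rule C1_differentiable_on_UNIV_I[OF Lmap_has_derivative cont_Lmap])+

lemma Lmap_period: "Lmap T k p T = Lmap T k p 0"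
  by (simp add: Lmap_def period)

lemma bm_Lmap: "bdd_meas T (Lmap T k p)"
  by (intro bdd_meas_continuous cont_Lmap)

lemma Lmap_bound: "\<bar>Lmap T k p t\<bar> \<le> 2 * sqrt (2 / T) * norm p"
proof -
  have "\<bar>fst p * \<phi> t\<bar> \<le> norm p * sqrt (2 / T)"
    unfolding abs_mult by (intro mult_mono bounds) (auto simp: norm_fst_le[of "fst p" "snd p", simplified])
  moreover have "\<bar>snd p * \<theta> t\<bar> \<le> norm p * sqrt (2 / T)"
    unfolding abs_mult by (intro mult_mono bounds) (auto simp: norm_snd_le[of "snd p" "fst p", simplified])
  moreover have "2 * sqrt (2 / T) * norm p = norm p * sqrt (2 / T) + norm p * sqrt (2 / T)"
    by (simp only: mult.commute[of _ "norm p"] mult_2) (simp only: distrib_left)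
  ultimately show ?thesis
    unfolding Lmap_def using abs_triangle_ineq[of "fst p * \<phi> t" "snd p * \<theta> t"] by linarith
qed

lemma Lmap_add: "Lmap T k (p + q) t = Lmap T k p t + Lmap T k q t"
  and Lmap_scale: "Lmap T k (c *\<^sub>R p) t = c * Lmap T k p t"
  by (simp_all add: Lmap_def algebra_simps)

lemma weak_deriv_Lmap: "weak_deriv T (Lmap T k p) (Lmap T k (\<omega> * snd p, - \<omega> * fst p))"
  using weak_deriv_C1[OF less_imp_le[OF T] Lmap_C1] by (simp add: deriv_Lmap)

text \<open>No integral is evaluated: the derivatives of \<phi> \<theta> and of \<phi>^2 integrate
  to zero over a period, which yields equal norms and orthogonality, and the pointwise sum of
  squares fixes the norms.\<close>

lemma orthonormal: "L2_inner T \<phi> \<phi> = 1" "L2_inner T \<theta> \<theta> = 1" "L2_inner T \<phi> \<theta> = 0" "L2_inner T \<theta> \<phi> = 0"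
proof -
  have int0: "(LINT t|leb T. g' t) = g T - g 0"
    if "\<And>t. (g has_real_derivative g' t) (at t)" "continuous_on UNIV g'" for g g' :: "real \<Rightarrow> real"
    using weak_deriv_one[OF less_imp_le[OF T]] C1_differentiable_on_UNIV_I[OF that]
    by (auto simp: weak_deriv_def)
  have 1: "(LINT t|leb T. \<omega> * (\<phi> t * \<phi> t) - \<omega> * (\<theta> t * \<theta> t)) = \<phi> T * \<theta> T - \<phi> 0 * \<theta> 0"
    by (rule int0) (auto intro!: derivative_eq_intros deriv_\<phi> deriv_\<theta> continuous_intros cont_\<phi> cont_\<theta> simp: algebra_simps)
  have 2: "(LINT t|leb T. - 2 * \<omega> * (\<phi> t * \<theta> t)) = \<phi> T * \<phi> T - \<phi> 0 * \<phi> 0"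
    by (rule int0) (auto intro!: derivative_eq_intros deriv_\<phi> deriv_\<theta> continuous_intros cont_\<phi> cont_\<theta> simp: algebra_simps)
  have i: "integrable (leb T) (\<lambda>t. \<phi> t * \<phi> t)" "integrable (leb T) (\<lambda>t. \<theta> t * \<theta> t)"
    by (intro bdd_meas_integrable bdd_meas_mult bm_\<phi> bm_\<theta>)+
  have eq: "L2_inner T \<phi> \<phi> = L2_inner T \<theta> \<theta>"
    using 1 i \<omega>_pos by (simp add: period L2_inner_def flip: right_diff_distrib)
  have "L2_inner T \<phi> \<phi> + L2_inner T \<theta> \<theta> = (LINT t|leb T. \<phi> t * \<phi> t + \<theta> t * \<theta> t)"
    using i by (simp add: L2_inner_def)
  also have "\<dots> = (LINT t|leb T. 2 / T)"
    using square_sum by (simp add: power2_eq_square)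
  also have "\<dots> = 2" using T by (simp add: measure_restrict_space)
  finally show "L2_inner T \<phi> \<phi> = 1" "L2_inner T \<theta> \<theta> = 1" using eq by auto
  show "L2_inner T \<phi> \<theta> = 0" using 2 \<omega>_pos by (simp add: period L2_inner_def)
  then show "L2_inner T \<theta> \<phi> = 0" by (simp add: L2_inner_commute)
qed

definition coords :: "(real \<Rightarrow> real) \<Rightarrow> real \<times> real"
  where "coords h = (L2_inner T h \<phi>, L2_inner T h \<theta>)"

lemma Qproj_eq: "Qproj T k h = Lmap T k (coords h)"
  by (simp add: Qproj_def Lmap_def coords_def)

lemmas L2_basis = bdd_meas_L2[OF bm_\<phi>] bdd_meas_L2[OF bm_\<theta>]

lemma coords_add: "f \<in> L2 T \<Longrightarrow> g \<in> L2 T \<Longrightarrow> coords (\<lambda>t. f t + g t) = coords f + coords g"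
  by (simp add: coords_def L2_inner_add_left L2_basis)

lemma coords_scale: "coords (\<lambda>t. c * f t) = c *\<^sub>R coords f"
  by (simp add: coords_def L2_inner_scale_left)

lemma L2_uminus: "f \<in> L2 T \<Longrightarrow> (\<lambda>t. - f t) \<in> L2 T"
  by (auto simp: L2_def)

lemma coords_diff: "f \<in> L2 T \<Longrightarrow> g \<in> L2 T \<Longrightarrow> coords (\<lambda>t. f t - g t) = coords f - coords g"
  using coords_add[of f "\<lambda>t. - g t"] coords_scale[of "-1" g] L2_uminus[of g] by simp

lemma L2_inner_Lmap: "h \<in> L2 T \<Longrightarrow> L2_inner T (Lmap T k p) h = p \<bullet> coords h"
  using L2_inner_add_left[of "\<lambda>t. fst p * \<phi> t" T "\<lambda>t. snd p * \<theta> t" h]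
    bdd_meas_L2[OF bdd_meas_mult[OF bdd_meas_const bm_\<phi>]] bdd_meas_L2[OF bdd_meas_mult[OF bdd_meas_const bm_\<theta>]]
  by (simp add: Lmap_def[abs_def] L2_inner_scale_left coords_def inner_prod_def L2_inner_commute)

lemma coords_Lmap: "coords (Lmap T k p) = p"
  unfolding coords_def[of "Lmap T k p"]
  by (simp add: L2_inner_Lmap L2_basis coords_def orthonormal inner_prod_def)

lemma coords_bound:
  assumes "h \<in> borel_measurable (leb T)" "\<And>t. t \<in> {0..T} \<Longrightarrow> \<bar>h t\<bar> \<le> B"
  shows "norm (coords h) \<le> 2 * sqrt (2 / T) * T * B"
proof -
  have b: "\<bar>L2_inner T h g\<bar> \<le> B * sqrt (2 / T) * T"
    if "bdd_meas T g" "\<And>t. \<bar>g t\<bar> \<le> sqrt (2 / T)" for g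
    unfolding L2_inner_def
  proof (rule integral_bdd_meas_le)
    show "(\<lambda>t. h t * g t) \<in> borel_measurable (leb T)"
      using assms(1) that(1) by (auto simp: bdd_meas_def)
    show "\<bar>h t * g t\<bar> \<le> B * sqrt (2 / T)" if t: "t \<in> {0..T}" for t
      unfolding abs_mult using assms(2)[OF t] by (intro mult_mono \<open>\<And>t. \<bar>g t\<bar> \<le> sqrt (2 / T)\<close>) auto
  qed (use T in auto)
  have "norm (coords h) \<le> \<bar>L2_inner T h \<phi>\<bar> + \<bar>L2_inner T h \<theta>\<bar>"
    unfolding coords_def using norm_Pair_le[of "L2_inner T h \<phi>" "L2_inner T h \<theta>"] by simp
  also have "\<dots> \<le> B * sqrt (2 / T) * T + B * sqrt (2 / T) * T"
    by (intro add_mono b bm_\<phi> bm_\<theta> bounds)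
  finally show ?thesis by (simp add: mult_ac)
qed

text \<open>The complementary projection I - Q.\<close>

definition res :: "(real \<Rightarrow> real) \<Rightarrow> real \<Rightarrow> real"
  where "res h t = h t - Lmap T k (coords h) t"

lemma bm_res: "bdd_meas T h \<Longrightarrow> bdd_meas T (res h)"
  unfolding res_def[abs_def] by (intro bdd_meas_diff bm_Lmap)

lemma coords_res: "bdd_meas T h \<Longrightarrow> coords (res h) = 0"
  unfolding res_def[abs_def]
  by (simp add: coords_diff bdd_meas_L2 bm_Lmap coords_Lmap)

lemma res_add: "bdd_meas T f \<Longrightarrow> bdd_meas T g \<Longrightarrow> res (\<lambda>t. f t + g t) = (\<lambda>t. res f t + res g t)"
  by (simp add: fun_eq_iff res_def coords_add bdd_meas_L2 Lmap_add)

lemma res_scale: "res (\<lambda>t. c * f t) = (\<lambda>t. c * res f t)"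
  by (simp add: fun_eq_iff res_def coords_scale Lmap_scale right_diff_distrib)

text \<open>Variation of constants: \<open>Vop h\<close> solves \<open>v'' + \<omega>\<^sup>2 v = - h\<close> with zero initial data.\<close>

definition Vop :: "(real \<Rightarrow> real) \<Rightarrow> real \<Rightarrow> real"
  where "Vop h t = - (T / (2 * \<omega>)) * \<theta> t * primitive T (\<lambda>r. \<phi> r * h r) t
    + T / (2 * \<omega>) * \<phi> t * primitive T (\<lambda>r. \<theta> r * h r) t"

text \<open>Termwise derivative of \<open>Vop\<close>; the two contributions containing
  \<open>h\<close> itself cancel. The constant T / (2 \<omega>) in \<open>Vop\<close> is the
  reciprocal of the Wronskian \<omega> (\<phi>^2 + \<theta>^2) = 2 \<omega> / T.\<close>

definition Vop' :: "(real \<Rightarrow> real) \<Rightarrow> real \<Rightarrow> real"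
  where "Vop' h t = - (T / 2) * \<phi> t * primitive T (\<lambda>r. \<phi> r * h r) t
    + - (T / 2) * \<theta> t * primitive T (\<lambda>r. \<theta> r * h r) t"

lemma weak_deriv_trig_primitive:
  assumes h: "bdd_meas T h"
    and c1: "\<And>t. (f has_real_derivative f' t) (at t)" "continuous_on UNIV f'"
    and c2: "\<And>t. (g has_real_derivative g' t) (at t)" "continuous_on UNIV g'"
    and u: "\<And>t. u t = f t * primitive T (\<lambda>r. \<phi> r * h r) t + g t * primitive T (\<lambda>r. \<theta> r * h r) t"
    and v: "\<And>t. v t = f' t * primitive T (\<lambda>r. \<phi> r * h r) t + g' t * primitive T (\<lambda>r. \<theta> r * h r) t
      + (f t * \<phi> t + g t * \<theta> t) * h t"
  shows "weak_deriv T u v"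
proof -
  note J = weak_deriv_primitive[OF less_imp_le[OF T] bdd_meas_mult[OF _ h]]
  note d1 = C1_differentiable_on_UNIV_I[OF c1] and d2 = C1_differentiable_on_UNIV_I[OF c2]
  have "v = (\<lambda>t. (f' t * primitive T (\<lambda>r. \<phi> r * h r) t + f t * (\<phi> t * h t))
       + (g' t * primitive T (\<lambda>r. \<theta> r * h r) t + g t * (\<theta> t * h t)))"
    by (simp add: fun_eq_iff v algebra_simps)
  moreover have "u = (\<lambda>t. f t * primitive T (\<lambda>r. \<phi> r * h r) t + g t * primitive T (\<lambda>r. \<theta> r * h r) t)"
    by (simp add: fun_eq_iff u)
  ultimately show ?thesis
    using weak_deriv_add[OF weak_deriv_mult[OF J[OF bm_\<phi>] d1(1)] weak_deriv_mult[OF J[OF bm_\<theta>] d2(1)]]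
    by (simp add: d1(2) d2(2))
qed

lemma weak_deriv_Vop:
  assumes h: "bdd_meas T h"
  shows "weak_deriv T (Vop h) (Vop' h)"
  by (rule weak_deriv_trig_primitive[OF h, where f = "\<lambda>t. - (T / (2 * \<omega>)) * \<theta> t" and g = "\<lambda>t. T / (2 * \<omega>) * \<phi> t"
        and f' = "\<lambda>t. - (T / 2) * \<phi> t" and g' = "\<lambda>t. - (T / 2) * \<theta> t"])
    (use \<omega>_pos in \<open>auto intro!: derivative_eq_intros deriv_\<phi> deriv_\<theta> continuous_intros cont_\<phi> cont_\<theta>
      simp: Vop_def Vop'_def\<close>)

lemma weak_deriv_Vop':
  assumes h: "bdd_meas T h"
  shows "weak_deriv T (Vop' h) (\<lambda>t. - h t - \<omega>\<^sup>2 * Vop h t)"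
proof (rule weak_deriv_trig_primitive[OF h, where f = "\<lambda>t. - (T / 2) * \<phi> t" and g = "\<lambda>t. - (T / 2) * \<theta> t"
      and f' = "\<lambda>t. T * \<omega> / 2 * \<theta> t" and g' = "\<lambda>t. - (T * \<omega> / 2) * \<phi> t"])
  fix t
  have "- (T / 2) * \<phi> t * \<phi> t + - (T / 2) * \<theta> t * \<theta> t = - (T / 2) * ((\<phi> t)\<^sup>2 + (\<theta> t)\<^sup>2)"
    by (simp add: power2_eq_square algebra_simps)
  then have 1: "- (T / 2) * \<phi> t * \<phi> t + - (T / 2) * \<theta> t * \<theta> t = - 1"
    unfolding square_sum using T by simp
  show "- h t - \<omega>\<^sup>2 * Vop h t = T * \<omega> / 2 * \<theta> t * primitive T (\<lambda>r. \<phi> r * h r) t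
      + - (T * \<omega> / 2) * \<phi> t * primitive T (\<lambda>r. \<theta> r * h r) t
      + (- (T / 2) * \<phi> t * \<phi> t + - (T / 2) * \<theta> t * \<theta> t) * h t"
    unfolding 1 using \<omega>_pos by (simp add: Vop_def power2_eq_square field_simps)
qed (auto intro!: derivative_eq_intros deriv_\<phi> deriv_\<theta> continuous_intros cont_\<phi> cont_\<theta> simp: Vop'_def)

text \<open>Orthogonality of \<open>h\<close> to the kernel is precisely the vanishing of both
  primitives at the right end, so the solvability condition appears as periodicity.\<close>

lemma Vop_boundary:
  "Vop h 0 = 0" "Vop' h 0 = 0"
  "coords h = 0 \<Longrightarrow> Vop h T = 0" "coords h = 0 \<Longrightarrow> Vop' h T = 0"
  by (auto simp: Vop_def Vop'_def primitive_0 primitive_T coords_def L2_inner_def mult.commute zero_prod_def)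

lemma cont_Vop: "bdd_meas T h \<Longrightarrow> continuous_on A (Vop h)"
  and cont_Vop': "bdd_meas T h \<Longrightarrow> continuous_on A (Vop' h)"
  unfolding Vop_def[abs_def] Vop'_def[abs_def]
  by (intro continuous_intros cont_\<phi> cont_\<theta> primitive_continuous bdd_meas_mult bm_\<phi> bm_\<theta>; assumption)+

lemma Vop_add: "bdd_meas T f \<Longrightarrow> bdd_meas T g \<Longrightarrow> Vop (\<lambda>t. f t + g t) t = Vop f t + Vop g t"
  unfolding Vop_def distrib_left
  by (simp add: primitive_add bdd_meas_mult bm_\<phi> bm_\<theta> algebra_simps)

lemma Vop_scale: "Vop (\<lambda>t. c * f t) t = c * Vop f t"
  unfolding Vop_def using primitive_scale[of T c "\<lambda>r. \<phi> r * f r" t] primitive_scale[of T c "\<lambda>r. \<theta> r * f r" t]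
  by (simp add: mult.left_commute algebra_simps)

lemma trig_primitive_bound:
  assumes "h \<in> borel_measurable (leb T)" "\<And>t. t \<in> {0..T} \<Longrightarrow> \<bar>h t\<bar> \<le> B"
  shows "\<bar>primitive T (\<lambda>r. \<phi> r * h r) t\<bar> \<le> sqrt (2 / T) * B * T"
    "\<bar>primitive T (\<lambda>r. \<theta> r * h r) t\<bar> \<le> sqrt (2 / T) * B * T"
proof -
  have m: "\<phi> \<in> borel_measurable (leb T)" "\<theta> \<in> borel_measurable (leb T)"
    using bm_\<phi> bm_\<theta> by (auto simp: bdd_meas_def)
  have "\<bar>\<phi> r * h r\<bar> \<le> sqrt (2 / T) * B" "\<bar>\<theta> r * h r\<bar> \<le> sqrt (2 / T) * B" if "r \<in> {0..T}" for r
    unfolding abs_mult using T by (intro mult_mono bounds assms(2) that; simp)+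
  then show "\<bar>primitive T (\<lambda>r. \<phi> r * h r) t\<bar> \<le> sqrt (2 / T) * B * T"
    "\<bar>primitive T (\<lambda>r. \<theta> r * h r) t\<bar> \<le> sqrt (2 / T) * B * T"
    using T by (auto intro!: primitive_bound borel_measurable_times m assms(1))
qed

lemma Vop_bounds:
  obtains C where "C \<ge> 0"
    "\<And>h B t. h \<in> borel_measurable (leb T) \<Longrightarrow> (\<And>t. t \<in> {0..T} \<Longrightarrow> \<bar>h t\<bar> \<le> B) \<Longrightarrow>
      \<bar>Vop h t\<bar> \<le> C * B \<and> \<bar>Vop' h t\<bar> \<le> C * B"
proof -
  define b where "b = sqrt (2 / T)"
  have b: "b \<ge> 0" using T by (simp add: b_def)
  define C where "C = 2 * (T / (2 * \<omega>) + T / 2) * b * b * T"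
  have tm: "\<bar>c * x * y\<bar> \<le> (T / (2 * \<omega>) + T / 2) * b * (b * B * T)"
    if "\<bar>c\<bar> \<le> T / (2 * \<omega>) + T / 2" "\<bar>x\<bar> \<le> b" "\<bar>y\<bar> \<le> b * B * T" for c x y B
    unfolding abs_mult using that b T \<omega>_pos by (intro mult_mono) auto
  have c: "\<bar>- (T / (2 * \<omega>))\<bar> \<le> T / (2 * \<omega>) + T / 2" "\<bar>T / (2 * \<omega>)\<bar> \<le> T / (2 * \<omega>) + T / 2"
    "\<bar>- (T / 2)\<bar> \<le> T / (2 * \<omega>) + T / 2"
    using T \<omega>_pos by simp_all
  show thesis
  proof (rule that[of C])
    show "C \<ge> 0" unfolding C_def using T \<omega>_pos b by simp
    fix h :: "real \<Rightarrow> real" and B t assume h: "h \<in> borel_measurable (leb T)" "\<And>t. t \<in> {0..T} \<Longrightarrow> \<bar>h t\<bar> \<le> B"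
    note p = trig_primitive_bound[OF h, folded b_def]
    have sum: "\<bar>x + y\<bar> \<le> C * B"
      if "\<bar>x\<bar> \<le> (T / (2 * \<omega>) + T / 2) * b * (b * B * T)" "\<bar>y\<bar> \<le> (T / (2 * \<omega>) + T / 2) * b * (b * B * T)" for x y
    proof -
      have "C * B = (T / (2 * \<omega>) + T / 2) * b * (b * B * T) + (T / (2 * \<omega>) + T / 2) * b * (b * B * T)"
        by (simp add: C_def)
      then show ?thesis using that by linarith
    qed
    show "\<bar>Vop h t\<bar> \<le> C * B \<and> \<bar>Vop' h t\<bar> \<le> C * B"
      unfolding Vop_def Vop'_def by (intro conjI sum tm c p bounds[folded b_def])
  qed
qed

text \<open>The inner projection makes the variation of constants solution periodic; the outer one
  selects, among the solutions differing by kernel elements, the one orthogonal to the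
  kernel.\<close>

definition Kop :: "(real \<Rightarrow> real) \<Rightarrow> real \<Rightarrow> real"
  where "Kop h = res (Vop (res h))"

definition Kop' :: "(real \<Rightarrow> real) \<Rightarrow> real \<Rightarrow> real"
  where "Kop' h t = Vop' (res h) t
    - Lmap T k (\<omega> * snd (coords (Vop (res h))), - \<omega> * fst (coords (Vop (res h)))) t"

lemma bm_Vop: "bdd_meas T h \<Longrightarrow> bdd_meas T (Vop h)"
  by (rule bdd_meas_continuous) (rule cont_Vop)

lemma weak_deriv_uminus_Lmap: "weak_deriv T (\<lambda>t. - Lmap T k p t) (\<lambda>t. - Lmap T k (\<omega> * snd p, - \<omega> * fst p) t)"
  using weak_deriv_Lmap[of "- p"] by (simp add: Lmap_def)

lemma weak_deriv_Kop:
  assumes h: "bdd_meas T h"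
  shows "weak_deriv T (Kop h) (Kop' h)" "weak_deriv T (Kop' h) (\<lambda>t. - res h t - \<omega>\<^sup>2 * Kop h t)"
proof -
  let ?q = "coords (Vop (res h))"
  show "weak_deriv T (Kop h) (Kop' h)"
    using weak_deriv_add[OF weak_deriv_Vop[OF bm_res[OF h]] weak_deriv_uminus_Lmap[of ?q]]
    by (simp add: Kop_def Kop'_def[abs_def] res_def[abs_def])
  let ?q1 = "(\<omega> * snd ?q, - \<omega> * fst ?q)"
  have "weak_deriv T (\<lambda>t. Vop' (res h) t + - Lmap T k ?q1 t)
      (\<lambda>t. (- res h t - \<omega>\<^sup>2 * Vop (res h) t) + - Lmap T k (\<omega> * snd ?q1, - \<omega> * fst ?q1) t)"
    by (rule weak_deriv_add[OF weak_deriv_Vop'[OF bm_res[OF h]] weak_deriv_uminus_Lmap])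
  moreover have "(\<lambda>t. Vop' (res h) t + - Lmap T k ?q1 t) = Kop' h"
    by (simp add: fun_eq_iff Kop'_def)
  moreover have "(\<lambda>t. (- res h t - \<omega>\<^sup>2 * Vop (res h) t) + - Lmap T k (\<omega> * snd ?q1, - \<omega> * fst ?q1) t)
      = (\<lambda>t. - res h t - \<omega>\<^sup>2 * Kop h t)"
    by (simp add: fun_eq_iff Kop_def res_def[of "Vop (res h)"] Lmap_def power2_eq_square algebra_simps)
  ultimately show "weak_deriv T (Kop' h) (\<lambda>t. - res h t - \<omega>\<^sup>2 * Kop h t)" by (simp only:)
qed

lemma cont_Kop: "bdd_meas T h \<Longrightarrow> continuous_on A (Kop h)"
  and cont_Kop': "bdd_meas T h \<Longrightarrow> continuous_on A (Kop' h)"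
  unfolding Kop_def Kop'_def[abs_def] res_def[of "Vop (res h)", abs_def]
  by (intro continuous_intros cont_Vop cont_Vop' bm_res cont_Lmap; assumption)+

lemma Kop_boundary:
  assumes h: "bdd_meas T h"
  shows "Kop h 0 = Kop h T" "Kop' h 0 = Kop' h T"
  using Vop_boundary[of "res h"] coords_res[OF h]
  by (simp_all add: Kop_def Kop'_def res_def[of "Vop (res h)"] Lmap_period)

lemma coords_Kop: "bdd_meas T h \<Longrightarrow> coords (Kop h) = 0"
  unfolding Kop_def by (intro coords_res bm_Vop bm_res)

lemma Kop_add:
  assumes f: "bdd_meas T f" and g: "bdd_meas T g"
  shows "Kop (\<lambda>t. f t + g t) = (\<lambda>t. Kop f t + Kop g t)"
proof -
  have "Vop (\<lambda>t. res f t + res g t) = (\<lambda>t. Vop (res f) t + Vop (res g) t)"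
    using f g by (intro ext Vop_add bm_res)
  then show ?thesis
    unfolding Kop_def res_add[OF f g] using res_add[OF bm_Vop bm_Vop, OF bm_res bm_res, OF f g] by simp
qed

lemma Kop_scale: "Kop (\<lambda>t. c * f t) = (\<lambda>t. c * Kop f t)"
  unfolding Kop_def res_scale Vop_scale[abs_def] ..

text \<open>L2 orthogonality to the kernel implies H2 orthogonality, since the kernel is invariant
  under differentiation. The first-order term is reduced to the zeroth-order one by parts, using
  periodicity; the second derivative is a combination of \<open>res h\<close> and
  \<open>Kop h\<close>, both orthogonal to the kernel.\<close>

lemma Kop_in_Nperp:
  assumes h: "bdd_meas T h"
  shows "Kop h \<in> Nperp T k"
proof -
  note D = weak_deriv_Kop[OF h]
  have mem: "Kop h \<in> Hs T 2"
    by (rule weak_deriv_imp_Hs[OF D cont_Kop[OF h] Kop_boundary(1)[OF h] cont_Kop'[OF h] Kop_boundary(2)[OF h]])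
  have bm: "bdd_meas T (Kop h)" "bdd_meas T (Kop' h)" using D by (auto simp: weak_deriv_def)
  have inner0: "L2_inner T f (Lmap T k q) = 0" if "bdd_meas T f" "coords f = 0" for f q
    using L2_inner_Lmap[OF bdd_meas_L2[OF that(1)], of q] that(2) by (simp add: L2_inner_commute)
  have "Hs_inner T 2 (Kop h) (Lmap T k p) = 0" for p
  proof -
    let ?p1 = "(\<omega> * snd p, - \<omega> * fst p)"
    let ?p2 = "(\<omega> * snd ?p1, - \<omega> * fst ?p1)"
    have "Hs_inner T 2 (Kop h) (Lmap T k p) = L2_inner T (Kop h) (Lmap T k p)
        + L2_inner T (Kop' h) (Lmap T k ?p1)
        + L2_inner T (\<lambda>t. - res h t - \<omega>\<^sup>2 * Kop h t) (Lmap T k ?p2)"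
      by (rule Hs_inner_2[OF D weak_deriv_Lmap weak_deriv_Lmap])
    moreover have "L2_inner T (Kop h) (Lmap T k p) = 0"
      by (rule inner0[OF bm(1) coords_Kop[OF h]])
    moreover have "L2_inner T (Kop' h) (Lmap T k ?p1) = 0"
    proof -
      have "(LINT t|leb T. Kop h t * deriv (Lmap T k ?p1) t)
          = Kop h T * Lmap T k ?p1 T - Kop h 0 * Lmap T k ?p1 0 - (LINT t|leb T. Kop' h t * Lmap T k ?p1 t)"
        using D(1) Lmap_C1 unfolding weak_deriv_def by blast
      moreover have "(LINT t|leb T. Kop h t * deriv (Lmap T k ?p1) t) = 0"
        using inner0[OF bm(1) coords_Kop[OF h]] by (simp add: deriv_Lmap L2_inner_def)
      ultimately show ?thesis by (simp add: L2_inner_def Kop_boundary[OF h] Lmap_period)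
    qed
    moreover have "L2_inner T (\<lambda>t. - res h t - \<omega>\<^sup>2 * Kop h t) (Lmap T k ?p2) = 0"
    proof (rule inner0)
      show "bdd_meas T (\<lambda>t. - res h t - \<omega>\<^sup>2 * Kop h t)"
        by (intro bdd_meas_intros bm bm_res h)
      have "coords (\<lambda>t. - res h t - \<omega>\<^sup>2 * Kop h t) = coords (\<lambda>t. (-1) * res h t) - coords (\<lambda>t. \<omega>\<^sup>2 * Kop h t)"
        using coords_diff[OF bdd_meas_L2[OF bdd_meas_uminus[OF bm_res[OF h]]]
            bdd_meas_L2[OF bdd_meas_mult[OF bdd_meas_const bm(1)]], of "\<omega>\<^sup>2"] by simp
      also have "\<dots> = 0" unfolding coords_scale by (simp add: coords_res[OF h] coords_Kop[OF h])
      finally show "coords (\<lambda>t. - res h t - \<omega>\<^sup>2 * Kop h t) = 0" .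
    qed
    ultimately show ?thesis by simp
  qed
  then show ?thesis using mem by (auto simp: Nperp_def Nspace_def)
qed

lemma res_bound:
  assumes "h \<in> borel_measurable (leb T)" "\<And>t. t \<in> {0..T} \<Longrightarrow> \<bar>h t\<bar> \<le> B"
  shows "\<bar>res h t\<bar> \<le> \<bar>h t\<bar> + 8 * B"
proof -
  have "\<bar>Lmap T k (coords h) t\<bar> \<le> 2 * sqrt (2 / T) * norm (coords h)" by (rule Lmap_bound)
  also have "\<dots> \<le> 2 * sqrt (2 / T) * (2 * sqrt (2 / T) * T * B)"
    using T by (intro mult_left_mono coords_bound[OF assms]) auto
  also have "2 * s * (2 * s * T * B) = 4 * s\<^sup>2 * T * B" for s :: real
    by (simp add: power2_eq_square)
  also have "(sqrt (2 / T))\<^sup>2 = 2 / T" using T by (intro real_sqrt_pow2) simp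
  finally have "\<bar>Lmap T k (coords h) t\<bar> \<le> 8 * B" using T by simp
  then show ?thesis unfolding res_def by linarith
qed

text \<open>The derivatives are included because the H2 norm of fixed points has to be small. The
  last bound is confined to the base interval, as \<open>h\<close> is controlled only there.\<close>

lemma Kop_bounds:
  obtains C where "C \<ge> 0"
    "\<And>h B t. bdd_meas T h \<Longrightarrow> (\<And>t. t \<in> {0..T} \<Longrightarrow> \<bar>h t\<bar> \<le> B) \<Longrightarrow> \<bar>Kop h t\<bar> \<le> C * B \<and>
      \<bar>Kop' h t\<bar> \<le> C * B \<and> (t \<in> {0..T} \<longrightarrow> \<bar>- res h t - \<omega>\<^sup>2 * Kop h t\<bar> \<le> C * B)"
proof -
  obtain C where C: "C \<ge> 0"
    "\<And>h B t. h \<in> borel_measurable (leb T) \<Longrightarrow> (\<And>t. t \<in> {0..T} \<Longrightarrow> \<bar>h t\<bar> \<le> B) \<Longrightarrow>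
      \<bar>Vop h t\<bar> \<le> C * B \<and> \<bar>Vop' h t\<bar> \<le> C * B"
    by (fact Vop_bounds)
  \<comment> \<open>Each of the two projections costs a factor 1 + 8 = 9.\<close>
  define C1 where "C1 = 81 * C"
  define b where "b = sqrt (2 / T)"
  have b: "b \<ge> 0" using T by (simp add: b_def)
  define C2 where "C2 = 9 * C + 2 * b * (\<omega> * (2 * b * T * (9 * C)))"
  define C3 where "C3 = 9 + \<omega>\<^sup>2 * C1"
  have nn: "C1 \<ge> 0" "C2 \<ge> 0" "C3 \<ge> 0" using C b T \<omega>_pos by (auto simp: C1_def C2_def C3_def)
  have *: "\<bar>Kop h t\<bar> \<le> C1 * B \<and> \<bar>Kop' h t\<bar> \<le> C2 * B \<and> (t \<in> {0..T} \<longrightarrow> \<bar>- res h t - \<omega>\<^sup>2 * Kop h t\<bar> \<le> C3 * B)"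
    if h: "bdd_meas T h" and B: "\<And>t. t \<in> {0..T} \<Longrightarrow> \<bar>h t\<bar> \<le> B" for h B t
  proof -
    have hm: "h \<in> borel_measurable (leb T)" using h by (simp add: bdd_meas_def)
    have r: "\<bar>res h t\<bar> \<le> 9 * B" if "t \<in> {0..T}" for t
      using res_bound[OF hm B, of t] B[OF that] by linarith
    have rm: "res h \<in> borel_measurable (leb T)" using bm_res[OF h] by (simp add: bdd_meas_def)
    have V: "\<bar>Vop (res h) t\<bar> \<le> C * (9 * B)" and V': "\<bar>Vop' (res h) t\<bar> \<le> C * (9 * B)" for t
      using C(2)[OF rm r] by blast+
    have Vm: "Vop (res h) \<in> borel_measurable (leb T)" using bm_Vop[OF bm_res[OF h]] by (simp add: bdd_meas_def)
    have K: "\<bar>Kop h t\<bar> \<le> C1 * B" for t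
      using res_bound[OF Vm V, of t] V[of t] unfolding Kop_def C1_def by linarith
    have "norm (\<omega> * snd (coords (Vop (res h))), - \<omega> * fst (coords (Vop (res h)))) = \<omega> * norm (coords (Vop (res h)))"
    proof -
      have "norm (\<omega> * y, - \<omega> * x) = \<omega> * norm (x, y)" for x y
      proof -
        have "(\<omega> * y)\<^sup>2 + (\<omega> * x)\<^sup>2 = \<omega>\<^sup>2 * (x\<^sup>2 + y\<^sup>2)" by (simp add: power_mult_distrib algebra_simps)
        then show ?thesis using \<omega>_pos by (simp add: norm_Pair real_sqrt_mult)
      qed
      then show ?thesis by (metis prod.collapse)
    qed
    moreover have "norm (coords (Vop (res h))) \<le> 2 * b * T * (C * (9 * B))"
      using coords_bound[OF Vm V] by (simp add: b_def)
    ultimately have "norm (\<omega> * snd (coords (Vop (res h))), - \<omega> * fst (coords (Vop (res h))))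
        \<le> \<omega> * (2 * b * T * (C * (9 * B)))"
      using \<omega>_pos by simp
    then have "\<bar>Lmap T k (\<omega> * snd (coords (Vop (res h))), - \<omega> * fst (coords (Vop (res h)))) t\<bar>
        \<le> 2 * b * (\<omega> * (2 * b * T * (C * (9 * B))))"
      using b by (intro order_trans[OF Lmap_bound[folded b_def]] mult_left_mono) auto
    then have K': "\<bar>Kop' h t\<bar> \<le> C * (9 * B) + 2 * b * (\<omega> * (2 * b * T * (C * (9 * B))))"
      using V'[of t] unfolding Kop'_def by linarith
    have "C * (9 * B) + 2 * b * (\<omega> * (2 * b * T * (C * (9 * B)))) = C2 * B"
      by (simp add: C2_def algebra_simps)
    moreover have "\<bar>- res h t - \<omega>\<^sup>2 * Kop h t\<bar> \<le> C3 * B" if "t \<in> {0..T}"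
    proof -
      have "\<bar>\<omega>\<^sup>2 * Kop h t\<bar> \<le> \<omega>\<^sup>2 * (C1 * B)"
        unfolding abs_mult using K[of t] by (intro mult_mono) auto
      then have "\<bar>- res h t - \<omega>\<^sup>2 * Kop h t\<bar> \<le> 9 * B + \<omega>\<^sup>2 * (C1 * B)" using r[OF that] by linarith
      then show ?thesis by (simp add: C3_def algebra_simps)
    qed
    ultimately show ?thesis using K K' by simp
  qed
  have "C1 * B \<le> (C1 + C2 + C3) * B" "C2 * B \<le> (C1 + C2 + C3) * B" "C3 * B \<le> (C1 + C2 + C3) * B" if "0 \<le> B" for B
    using nn that by (intro mult_right_mono; simp)+
  moreover have "B \<ge> 0" if "\<And>t. t \<in> {0..T} \<Longrightarrow> \<bar>h t\<bar> \<le> B" for h :: "real \<Rightarrow> real" and B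
    using that[of 0] T by (meson abs_ge_zero atLeastAtMost_iff less_imp_le order_refl order_trans)
  ultimately show thesis
    using nn * by (intro that[of "C1 + C2 + C3"]) (meson add_nonneg_nonneg order_trans)+
qed

end

section \<open>The bifurcation equation\<close>

locale cubic_problem = trig_basis +
  fixes a :: "real \<Rightarrow> real"
  assumes a_Linf: "a \<in> Linf T" and a_nonneg: "AE t in leb T. a t \<ge> 0"
    and a_nonzero: "\<not> (AE t in leb T. a t = 0)"
    and ac: "coef_a T a k = 3 * coef_c T a k" and bd: "coef_b T a k = coef_d T a k"
    and ae: "coef_a T a k = coef_e T a k" and b_nonzero: "coef_b T a k \<noteq> 0"
begin

abbreviation "A \<equiv> coef_a T a k"
abbreviation "B \<equiv> coef_b T a k"

section \<open>Moments of the weight and positivity of the coefficients\<close>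

definition bound :: real where "bound = (SOME C. C \<ge> 0 \<and> (AE t in leb T. \<bar>a t\<bar> \<le> C))"

text \<open>A representative of \<open>a\<close> that is bounded everywhere, as pointwise estimates
  require.\<close>

definition a0 :: "real \<Rightarrow> real" where "a0 t = (if \<bar>a t\<bar> \<le> bound then a t else 0)"

lemma bound: "bound \<ge> 0" "AE t in leb T. \<bar>a t\<bar> \<le> bound"
proof -
  obtain C where "AE t in leb T. \<bar>a t\<bar> \<le> C" using a_Linf by (auto simp: Linf_def)
  then have "AE t in leb T. \<bar>a t\<bar> \<le> max 0 C" by (auto elim!: eventually_mono)
  then have "\<exists>C. C \<ge> 0 \<and> (AE t in leb T. \<bar>a t\<bar> \<le> C)" by (intro exI[of _ "max 0 C"]) simp
  then show "bound \<ge> 0" "AE t in leb T. \<bar>a t\<bar> \<le> bound"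
    unfolding bound_def by (rule someI2_ex; simp)+
qed

lemma a_meas: "a \<in> borel_measurable (leb T)"
  using a_Linf by (simp add: Linf_def)

lemma a0_eq: "AE t in leb T. a0 t = a t"
  using bound(2) by eventually_elim (simp add: a0_def)

lemma a0_bound: "\<bar>a0 t\<bar> \<le> bound"
  using bound(1) by (simp add: a0_def)

lemma bm_a0: "bdd_meas T a0"
proof (rule bdd_measI[OF _ a0_bound])
  note [measurable] = a_meas
  show "a0 \<in> borel_measurable (leb T)" unfolding a0_def[abs_def] by measurable
qed

lemma integral_a0:
  assumes "g \<in> borel_measurable (leb T)"
  shows "(LINT t|leb T. a t * g t) = (LINT t|leb T. a0 t * g t)"
  using a0_eq bm_a0
  by (intro integral_cong_AE borel_measurable_times a_meas assms)
    (auto simp: bdd_meas_def elim!: eventually_mono)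

lemma bm_trig: "bdd_meas T (\<lambda>t. \<phi> t ^ i * \<theta> t ^ j)"
  by (intro bdd_meas_intros bm_\<phi> bm_\<theta>)

definition moment :: "nat \<Rightarrow> nat \<Rightarrow> real"
  where "moment i j = (LINT t|leb T. a0 t * (\<phi> t ^ i * \<theta> t ^ j))"

lemma integrable_moment: "integrable (leb T) (\<lambda>t. a0 t * (\<phi> t ^ i * \<theta> t ^ j))"
  by (intro bdd_meas_integrable bdd_meas_mult bm_a0 bm_trig)

lemma integral_a_trig: "(LINT t|leb T. a t * (\<phi> t ^ i * \<theta> t ^ j)) = moment i j"
  unfolding moment_def using bm_trig by (intro integral_a0) (auto simp: bdd_meas_def)

lemma moments: "moment 4 0 = A" "moment 3 (Suc 0) = B" "3 * moment 2 2 = A" "moment (Suc 0) 3 = B" "moment 0 4 = A"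
  using ac bd ae integral_a_trig[of 4 0] integral_a_trig[of 3 "Suc 0"] integral_a_trig[of 2 2]
    integral_a_trig[of "Suc 0" 3] integral_a_trig[of 0 4]
  by (simp_all add: coef_a_def coef_b_def coef_c_def coef_d_def coef_e_def mult.assoc)

text \<open>One expansion with two uses: for (u, v) a unit vector it gives a component of the cubic
  map, and for (u, v) = (x, y) = (1, c) it gives the fourth-power integral behind the signs of A +
  2B and A - 2B.\<close>

lemma integral_quartic:
  "(LINT t|leb T. a0 t * (x * \<phi> t + y * \<theta> t) ^ 3 * (u * \<phi> t + v * \<theta> t)) =
    u * (A * x^3 + 3 * B * x^2 * y + A * x * y^2 + B * y^3) +
    v * (B * x^3 + A * x^2 * y + 3 * B * x * y^2 + A * y^3)"
proof -
  have "(LINT t|leb T. a0 t * (x * \<phi> t + y * \<theta> t) ^ 3 * (u * \<phi> t + v * \<theta> t)) =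
    (LINT t|leb T. (u * x^3) * (a0 t * (\<phi> t ^ 4 * \<theta> t ^ 0))
      + (3 * u * x^2 * y + v * x^3) * (a0 t * (\<phi> t ^ 3 * \<theta> t ^ Suc 0))
      + (u * x * y^2 + v * x^2 * y) * (3 * (a0 t * (\<phi> t ^ 2 * \<theta> t ^ 2)))
      + (u * y^3 + 3 * v * x * y^2) * (a0 t * (\<phi> t ^ Suc 0 * \<theta> t ^ 3))
      + (v * y^3) * (a0 t * (\<phi> t ^ 0 * \<theta> t ^ 4)))"
    by (rule Bochner_Integration.integral_cong)
      (simp_all add: power2_eq_square power3_eq_cube power4_eq_xxxx algebra_simps)
  also have "\<dots> = (u * x^3) * moment 4 0 + (3 * u * x^2 * y + v * x^3) * moment 3 (Suc 0)
      + (u * x * y^2 + v * x^2 * y) * (3 * moment 2 2)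
      + (u * y^3 + 3 * v * x * y^2) * moment (Suc 0) 3 + (v * y^3) * moment 0 4"
    unfolding moment_def
    by (simp only: Bochner_Integration.integral_add integral_mult_right_zero
        Bochner_Integration.integrable_add integrable_mult_right integrable_moment)
  also have "\<dots> = u * (A * x^3 + 3 * B * x^2 * y + A * x * y^2 + B * y^3) +
    v * (B * x^3 + A * x^2 * y + 3 * B * x * y^2 + A * y^3)"
    unfolding moments by (simp add: algebra_simps)
  finally show ?thesis .
qed

text \<open>A zero has sine and cosine of equal square, hence the cosine of the doubled angle
  vanishes; there are only countably many such points.\<close>

lemma trig_zero_AE:
  assumes "c = 1 \<or> c = - 1"
  shows "AE t in leb T. \<phi> t + c * \<theta> t \<noteq> 0"
proof -
  define Z where "Z = {t. cos (\<omega> * t) + c * sin (\<omega> * t) = 0}"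
  have "t \<in> range (\<lambda>n::int. of_int n * (pi / 4) / \<omega>)" if "t \<in> Z" for t
  proof -
    have "sin (\<omega> * t) = - c * cos (\<omega> * t)" using that assms by (auto simp: Z_def)
    then have "cos (2 * (\<omega> * t)) = 0" using assms by (auto simp: cos_double)
    then obtain n :: int where "odd n" "2 * (\<omega> * t) = of_int n * (pi / 2)"
      by (auto simp: cos_zero_iff_int)
    then have "t = of_int n * (pi / 4) / \<omega>" using \<omega>_pos by (simp add: field_simps)
    then show ?thesis by blast
  qed
  then have "countable Z" by (intro countable_subset[of Z "range (\<lambda>n::int. of_int n * (pi / 4) / \<omega>)"]) auto
  then have "Z \<in> null_sets lborel" by (rule countable_imp_null_set_lborel)
  then have "AE t in lborel. t \<notin> Z" by (rule AE_not_in)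
  then have "AE t in lebesgue. t \<notin> Z" by (rule AE_completion)
  then have "AE t in leb T. t \<notin> Z" by (subst AE_restrict_space_iff) auto
  moreover have "\<phi> t + c * \<theta> t = sqrt (2 / T) * (cos (\<omega> * t) + c * sin (\<omega> * t))" for t
    by (simp only: \<phi>_eq \<theta>_eq) (simp only: distrib_left mult.left_commute)
  ultimately show ?thesis
    using T by (auto simp: Z_def elim!: eventually_mono)
qed

(* The integral of a * (\<phi> + c \<theta>)^4 equals 4 (A + 2 c B) for c = 1 and c = -1. *)
lemma coefficient_positive:
  assumes c: "c = 1 \<or> c = - 1"
  shows "A + 2 * c * B > 0"
proof (rule ccontr)
  assume neg: "\<not> A + 2 * c * B > 0"
  define q where "q t = a0 t * (\<phi> t + c * \<theta> t) ^ 3 * (\<phi> t + c * \<theta> t)" for t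
  have "(LINT t|leb T. q t) = 4 * (A + 2 * c * B)"
    using integral_quartic[of 1 c 1 c] c by (auto simp: q_def power2_eq_square power3_eq_cube algebra_simps)
  then have le: "(LINT t|leb T. q t) \<le> 0" using neg by simp
  have q: "q t = a0 t * (\<phi> t + c * \<theta> t) ^ 4" for t
    by (simp add: q_def power3_eq_cube power4_eq_xxxx)
  have int: "integrable (leb T) q"
    unfolding q_def[abs_def] by (intro bdd_meas_integrable bdd_meas_intros bm_a0 bm_\<phi> bm_\<theta>)
  have nonneg: "AE t in leb T. 0 \<le> q t"
    using a0_eq a_nonneg by eventually_elim (simp add: q)
  have "(LINT t|leb T. q t) = 0" using le integral_nonneg_AE[OF nonneg] by linarith
  then have "AE t in leb T. q t = 0"
    using integral_nonneg_eq_0_iff_AE[OF int nonneg] by blast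
  with trig_zero_AE[OF c] a0_eq have "AE t in leb T. a t = 0"
    by eventually_elim (auto simp: q)
  then show False using a_nonzero by blast
qed

section \<open>Realization of the cubic system in bounded continuous functions\<close>

lemma Bcontfun_Kop:
  assumes "bdd_meas T h"
  shows "apply_bcontfun (Bcontfun (Kop h)) = Kop h"
proof -
  obtain C where "\<And>h B t. bdd_meas T h \<Longrightarrow> (\<And>t. t \<in> {0..T} \<Longrightarrow> \<bar>h t\<bar> \<le> B) \<Longrightarrow> \<bar>Kop h t\<bar> \<le> C * B"
    using Kop_bounds by metis
  moreover obtain b where "\<And>t. t \<in> {0..T} \<Longrightarrow> \<bar>h t\<bar> \<le> b" using bdd_measE[OF assms] by metis
  ultimately show ?thesis
    using assms by (intro Bcontfun_apply[OF cont_Kop, where B = "C * b"]) auto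
qed

definition LB :: "real \<times> real \<Rightarrow> real \<Rightarrow>\<^sub>C real"
  where "LB p = Bcontfun (Lmap T k p)"

definition K1B :: "(real \<Rightarrow>\<^sub>C real) \<Rightarrow> real \<Rightarrow>\<^sub>C real"
  where "K1B Y = Bcontfun (Kop (apply_bcontfun Y))"

definition K2B :: "(real \<Rightarrow>\<^sub>C real) \<Rightarrow> real \<Rightarrow>\<^sub>C real"
  where "K2B Y = Bcontfun (Kop (\<lambda>t. a0 t * apply_bcontfun Y t))"

definition PB :: "(real \<Rightarrow>\<^sub>C real) \<Rightarrow> real \<times> real"
  where "PB Y = coords (\<lambda>t. a0 t * apply_bcontfun Y t)"

lemma LB_apply: "apply_bcontfun (LB p) = Lmap T k p"
  unfolding LB_def by (rule Bcontfun_apply[OF cont_Lmap, where B = "2 * sqrt (2 / T) * norm p"]) (simp only: real_norm_def Lmap_bound)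

lemma bm_a0Y: "bdd_meas T (\<lambda>t. a0 t * apply_bcontfun Y t)"
  by (intro bdd_meas_mult bm_a0 bdd_meas_bcontfun)

lemma apply_le_norm: "\<bar>apply_bcontfun Y t\<bar> \<le> norm Y"
  using norm_bounded[of Y t] by simp

lemma K1B_apply: "apply_bcontfun (K1B Y) = Kop (apply_bcontfun Y)"
  unfolding K1B_def by (rule Bcontfun_Kop[OF bdd_meas_bcontfun])

lemma K2B_apply: "apply_bcontfun (K2B Y) = Kop (\<lambda>t. a0 t * apply_bcontfun Y t)"
  unfolding K2B_def by (rule Bcontfun_Kop[OF bm_a0Y])

lemma a0Y_le: "\<bar>a0 t * apply_bcontfun Y t\<bar> \<le> bound * norm Y"
  unfolding abs_mult by (intro mult_mono a0_bound apply_le_norm bound) auto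

lemma linear_LB: "bounded_linear LB"
proof (rule bounded_linear_intro[where K = "2 * sqrt (2 / T)"])
  fix p q :: "real \<times> real" and r :: real
  show "LB (p + q) = LB p + LB q" by (rule bcontfun_eqI) (simp add: LB_apply Lmap_add)
  show "LB (r *\<^sub>R p) = r *\<^sub>R LB p" by (rule bcontfun_eqI) (simp add: LB_apply Lmap_scale)
  show "norm (LB p) \<le> norm p * (2 * sqrt (2 / T))"
    by (rule norm_bound) (use Lmap_bound in \<open>simp add: LB_apply mult.commute\<close>)
qed

text \<open>Shared by \<open>K1B\<close> and \<open>K2B\<close>, where \<open>M\<close> is
  evaluation and evaluation followed by multiplication with \<open>a0\<close>.\<close>

lemma linear_Kop:
  fixes M :: "(real \<Rightarrow>\<^sub>C real) \<Rightarrow> real \<Rightarrow> real"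
  assumes bm: "\<And>Y. bdd_meas T (M Y)"
    and add: "\<And>X Y t. M (X + Y) t = M X t + M Y t" and scale: "\<And>r Y t. M (r *\<^sub>R Y) t = r * M Y t"
    and le: "\<And>Y t. \<bar>M Y t\<bar> \<le> c * norm Y"
  shows "bounded_linear (\<lambda>Y. Bcontfun (Kop (M Y)))"
proof -
  obtain C where C: "\<And>h B t. bdd_meas T h \<Longrightarrow> (\<And>t. t \<in> {0..T} \<Longrightarrow> \<bar>h t\<bar> \<le> B) \<Longrightarrow> \<bar>Kop h t\<bar> \<le> C * B"
    using Kop_bounds by metis
  show ?thesis
  proof (rule bounded_linear_intro[where K = "C * c"])
    fix X Y :: "real \<Rightarrow>\<^sub>C real" and r :: real
    have add': "Kop (M (X + Y)) = (\<lambda>t. Kop (M X) t + Kop (M Y) t)"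
      unfolding Kop_add[OF bm bm, symmetric] by (rule arg_cong[where f = Kop]) (rule ext, rule add)
    show "Bcontfun (Kop (M (X + Y))) = Bcontfun (Kop (M X)) + Bcontfun (Kop (M Y))"
      by (rule bcontfun_eqI) (unfold plus_bcontfun.rep_eq Bcontfun_Kop[OF bm], simp only: add')
    have scale': "Kop (M (r *\<^sub>R X)) = (\<lambda>t. r * Kop (M X) t)"
      unfolding Kop_scale[symmetric] by (rule arg_cong[where f = Kop]) (rule ext, rule scale)
    show "Bcontfun (Kop (M (r *\<^sub>R X))) = r *\<^sub>R Bcontfun (Kop (M X))"
      by (rule bcontfun_eqI)
        (unfold scaleR_bcontfun.rep_eq Bcontfun_Kop[OF bm], simp only: scale' real_scaleR_def)
    show "norm (Bcontfun (Kop (M X))) \<le> norm X * (C * c)"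
    proof (rule norm_bound)
      fix t
      have "\<bar>Kop (M X) t\<bar> \<le> C * (c * norm X)" by (rule C[OF bm le])
      then show "norm (apply_bcontfun (Bcontfun (Kop (M X))) t) \<le> norm X * (C * c)"
        unfolding Bcontfun_Kop[OF bm] by (simp add: mult_ac)
    qed
  qed
qed

lemma linear_K1B: "bounded_linear K1B"
  unfolding K1B_def by (rule linear_Kop[where c = 1]) (simp_all add: bdd_meas_bcontfun apply_le_norm)

lemma linear_K2B: "bounded_linear K2B"
  unfolding K2B_def
  by (rule linear_Kop[where c = bound]) (rule bm_a0Y a0Y_le | simp add: distrib_left mult.left_commute)+

lemma linear_PB: "bounded_linear PB"
proof (rule bounded_linear_intro[where K = "2 * sqrt (2 / T) * T * bound"])
  fix X Y :: "real \<Rightarrow>\<^sub>C real" and r :: real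
  show "PB (X + Y) = PB X + PB Y"
    using coords_add[OF bdd_meas_L2[OF bm_a0Y] bdd_meas_L2[OF bm_a0Y], of X Y] by (simp add: PB_def distrib_left)
  show "PB (r *\<^sub>R X) = r *\<^sub>R PB X"
    using coords_scale[of r "\<lambda>t. a0 t * apply_bcontfun X t"] by (simp add: PB_def mult.left_commute)
  show "norm (PB X) \<le> norm X * (2 * sqrt (2 / T) * T * bound)"
  proof -
    have "norm (PB X) \<le> 2 * sqrt (2 / T) * T * (bound * norm X)"
      unfolding PB_def using bm_a0Y[of X] by (intro coords_bound a0Y_le) (simp add: bdd_meas_def)
    then show ?thesis by (simp add: mult_ac)
  qed
qed

lemma PB_cube:
  "PB (LB (x, y) ^ 3) =
    (A * x^3 + 3 * B * x^2 * y + A * x * y^2 + B * y^3,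
     B * x^3 + A * x^2 * y + 3 * B * x * y^2 + A * y^3)"
  using integral_quartic[of x y 1 0] integral_quartic[of x y 0 1]
  by (simp add: PB_def coords_def L2_inner_def power_bcontfun_apply LB_apply Lmap_def)

sublocale cubic_system LB K1B K2B PB A B
proof (rule cubic_system.intro)
  show "A + 2 * B > 0" "A - 2 * B > 0"
    using coefficient_positive[of 1] coefficient_positive[of "-1"] by simp_all
qed (rule linear_LB linear_K1B linear_K2B linear_PB PB_cube b_nonzero)+

section \<open>From fixed points back to the differential equation\<close>

definition rhs :: "real \<Rightarrow> real \<times> real \<Rightarrow> (real \<Rightarrow>\<^sub>C real) \<Rightarrow> real \<Rightarrow> real"
  where "rhs \<tau> p y t = a0 t * (Lmap T k p t + y t) ^ 3 - \<tau> * y t"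

lemma bm_rhs: "bdd_meas T (rhs \<tau> p y)"
  unfolding rhs_def[abs_def]
  by (intro bdd_meas_intros bm_a0 bm_Lmap)

text \<open>Collecting both operators exhibits the fixed point as \<open>Kop\<close> of a single
  bounded function, so it inherits periodicity, orthogonality and two weak derivatives.
  \<open>rhs\<close> contains \<tau> y and not \<tau> (L p + y), because the projection in
  \<open>Kop\<close> removes the kernel part anyway.\<close>

lemma aux_imp_Kop:
  assumes "aux \<tau> p y"
  shows "apply_bcontfun y = Kop (rhs \<tau> p y)"
proof -
  have bmX: "bdd_meas T (\<lambda>t. (-\<tau>) * apply_bcontfun y t)" by (intro bdd_meas_intros)
  have "apply_bcontfun y t = Kop (\<lambda>t. a0 t * ((LB p + y) ^ 3) t) t + (- \<tau>) * Kop (apply_bcontfun y) t" for t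
    using arg_cong[OF assms[unfolded aux_def], of "\<lambda>y. apply_bcontfun y t"]
    by (simp add: K1B_apply K2B_apply)
  also have "Kop (\<lambda>t. a0 t * ((LB p + y) ^ 3) t) t + (- \<tau>) * Kop (apply_bcontfun y) t
      = Kop (\<lambda>t. a0 t * ((LB p + y) ^ 3) t + (- \<tau>) * y t) t" for t
    unfolding Kop_add[OF bm_a0Y bmX] Kop_scale ..
  also have "(\<lambda>t. a0 t * ((LB p + y) ^ 3) t + (- \<tau>) * y t) = rhs \<tau> p y"
    by (simp add: fun_eq_iff rhs_def power_bcontfun_apply LB_apply)
  finally show ?thesis by (rule ext)
qed

lemma coords_rhs:
  assumes "aux \<tau> p y"
  shows "coords (rhs \<tau> p y) = red \<tau> p y + \<tau> *\<^sub>R p"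
proof -
  have y0: "coords (apply_bcontfun y) = 0"
    using aux_imp_Kop[OF assms] coords_Kop[OF bm_rhs] by simp
  have "coords (rhs \<tau> p y) = coords (\<lambda>t. a0 t * ((LB p + y) ^ 3) t) - coords (\<lambda>t. \<tau> * y t)"
    unfolding rhs_def[abs_def]
    using coords_diff[OF bdd_meas_L2[OF bm_a0Y[of "(LB p + y) ^ 3"]]
        bdd_meas_L2[OF bdd_meas_mult[OF bdd_meas_const bdd_meas_bcontfun]], of \<tau> y]
    by (simp add: power_bcontfun_apply LB_apply)
  then show ?thesis by (simp add: coords_scale y0 red_def PB_def)
qed

lemma sum_has_weak_D:
  assumes "aux \<tau> p y"
  shows "has_weak_D T 2 (\<lambda>t. Lmap T k p t + y t)
    (\<lambda>t. - \<omega>\<^sup>2 * (Lmap T k p t + y t) - res (rhs \<tau> p y) t)"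
proof -
  let ?p1 = "(\<omega> * snd p, - \<omega> * fst p)"
  note y = aux_imp_Kop[OF assms]
  note D = weak_deriv_Kop[OF bm_rhs[of \<tau> p y]]
  have "has_weak_D T 2 (\<lambda>t. Lmap T k p t + Kop (rhs \<tau> p y) t)
      (\<lambda>t. Lmap T k (\<omega> * snd ?p1, - \<omega> * fst ?p1) t + (- res (rhs \<tau> p y) t - \<omega>\<^sup>2 * Kop (rhs \<tau> p y) t))"
    by (rule weak_deriv_imp_has_weak_D(3)[OF weak_deriv_add[OF weak_deriv_Lmap D(1)] weak_deriv_add[OF weak_deriv_Lmap D(2)]])
  also have "(\<lambda>t. Lmap T k (\<omega> * snd ?p1, - \<omega> * fst ?p1) t + (- res (rhs \<tau> p y) t - \<omega>\<^sup>2 * Kop (rhs \<tau> p y) t))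
      = (\<lambda>t. - \<omega>\<^sup>2 * (Lmap T k p t + Kop (rhs \<tau> p y) t) - res (rhs \<tau> p y) t)"
    by (simp add: fun_eq_iff Lmap_def power2_eq_square algebra_simps)
  finally show ?thesis by (simp only: y[symmetric])
qed

text \<open>For a solution of the auxiliary equation only the kernel component of the operator
  survives. The function \<open>u\<close> is any L2 function equal to \<open>y\<close> almost
  everywhere, so that \<psi> can be inserted for it.\<close>

lemma FF_AE:
  assumes "aux \<tau> p y" and u: "u \<in> L2 T" "AE t in leb T. u t = y t"
  shows "AE t in leb T. FF T a (\<omega>\<^sup>2 - \<tau>) (\<lambda>t. Lmap T k p t + u t) t = Lmap T k (red \<tau> p y) t"
    "FF T a (\<omega>\<^sup>2 - \<tau>) (\<lambda>t. Lmap T k p t + u t) \<in> borel_measurable (leb T)"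
proof -
  note D = sum_has_weak_D[OF assms(1)]
  have L: "(\<lambda>t. Lmap T k p t + y t) \<in> L2 T" "(\<lambda>t. Lmap T k p t + u t) \<in> L2 T"
    by (intro L2_add bdd_meas_L2 bm_Lmap bdd_meas_bcontfun u(1))+
  have eq: "weak_D T 2 (\<lambda>t. Lmap T k p t + u t) = weak_D T 2 (\<lambda>t. Lmap T k p t + y t)"
    by (rule weak_D_cong_AE) (use u(2) L in \<open>auto elim!: eventually_mono\<close>)
  show "AE t in leb T. FF T a (\<omega>\<^sup>2 - \<tau>) (\<lambda>t. Lmap T k p t + u t) t = Lmap T k (red \<tau> p y) t"
    using weak_D_AE_eq(2)[OF D] u(2) a0_eq
  proof eventually_elim
    case (elim t)
    have "res (rhs \<tau> p y) t = rhs \<tau> p y t - Lmap T k (red \<tau> p y) t - \<tau> * Lmap T k p t"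
      by (simp add: res_def coords_rhs[OF assms(1)] Lmap_add Lmap_scale)
    moreover have "weak_D T 2 (\<lambda>t. Lmap T k p t + u t) t
        = - \<omega>\<^sup>2 * (Lmap T k p t + y t) - res (rhs \<tau> p y) t"
      using elim(1) by (simp only: eq)
    ultimately show ?case unfolding FF_def using elim(2,3) by (simp add: rhs_def algebra_simps)
  qed
  have "weak_D T 2 (\<lambda>t. Lmap T k p t + u t) \<in> borel_measurable (leb T)"
    using weak_D_AE_eq(1)[OF D] by (simp add: eq L2_def)
  then show "FF T a (\<omega>\<^sup>2 - \<tau>) (\<lambda>t. Lmap T k p t + u t) \<in> borel_measurable (leb T)"
    unfolding FF_def using u(1) bm_Lmap[of p] a_meas
    by (intro borel_measurable_add borel_measurable_times borel_measurable_power borel_measurable_const)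
      (simp_all add: L2_def bdd_meas_def)
qed

lemma coords_FF:
  assumes "aux \<tau> p y" and u: "u \<in> L2 T" "AE t in leb T. u t = y t"
  shows "coords (FF T a (\<omega>\<^sup>2 - \<tau>) (\<lambda>t. Lmap T k p t + u t)) = red \<tau> p y"
proof -
  have m: "\<phi> \<in> borel_measurable (leb T)" "\<theta> \<in> borel_measurable (leb T)"
    "Lmap T k (red \<tau> p y) \<in> borel_measurable (leb T)"
    using bm_\<phi> bm_\<theta> bm_Lmap by (auto simp: bdd_meas_def)
  have "coords (FF T a (\<omega>\<^sup>2 - \<tau>) (\<lambda>t. Lmap T k p t + u t)) = coords (Lmap T k (red \<tau> p y))"
    unfolding coords_def L2_inner_cong_AE[OF FF_AE(2)[OF assms] m(3) m(1) FF_AE(1)[OF assms]]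
      L2_inner_cong_AE[OF FF_AE(2)[OF assms] m(3) m(2) FF_AE(1)[OF assms]] ..
  then show ?thesis by (simp add: coords_Lmap)
qed

lemma aux_imp_aux_eq:
  assumes "aux \<tau> p y"
  shows "aux_eq T a k (\<omega>\<^sup>2 - \<tau>) (Lmap T k p) (apply_bcontfun y)"
proof -
  have y: "apply_bcontfun y \<in> L2 T" "AE t in leb T. apply_bcontfun y t = y t"
    by (simp_all add: bdd_meas_L2 bdd_meas_bcontfun)
  show ?thesis
    unfolding aux_eq_def Qproj_eq coords_FF[OF assms y]
    using FF_AE(1)[OF assms y] by (auto elim!: eventually_mono)
qed

lemma HH_eq_red:
  assumes "aux \<tau> p y" and "\<psi> (\<omega>\<^sup>2 - \<tau>) (Lmap T k p) \<in> L2 T"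
    and "AE t in leb T. \<psi> (\<omega>\<^sup>2 - \<tau>) (Lmap T k p) t = y t"
  shows "HH T a k \<psi> (\<omega>\<^sup>2 - \<tau>) p = red \<tau> p y"
proof -
  have "HH T a k \<psi> (\<omega>\<^sup>2 - \<tau>) p
      = coords (Lmap T k (coords (FF T a (\<omega>\<^sup>2 - \<tau>) (\<lambda>t. Lmap T k p t + \<psi> (\<omega>\<^sup>2 - \<tau>) (Lmap T k p) t))))"
    by (simp add: HH_def Let_def Qproj_eq coords_def)
  then show ?thesis by (simp add: coords_Lmap coords_FF[OF assms])
qed

section \<open>Smallness in H2 and identification with the given reduction\<close>

lemma Hs_norm_Lmap: "Hs_norm T 2 (Lmap T k p) = sqrt (1 + \<omega>\<^sup>2 + \<omega>^4) * norm p"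
proof -
  have LL: "L2_inner T (Lmap T k p) (Lmap T k q) = p \<bullet> q" for p q
    using L2_inner_Lmap[OF bdd_meas_L2[OF bm_Lmap]] by (simp add: coords_Lmap)
  have "Hs_inner T 2 (Lmap T k p) (Lmap T k p) = (1 + \<omega>\<^sup>2 + \<omega>^4) * (p \<bullet> p)"
    by (subst Hs_inner_2[OF weak_deriv_Lmap weak_deriv_Lmap weak_deriv_Lmap weak_deriv_Lmap])
      (simp add: LL inner_prod_def power2_eq_square power4_eq_xxxx algebra_simps)
  then show ?thesis by (simp add: Hs_norm_def real_sqrt_mult norm_eq_sqrt_inner)
qed

lemma rhs_bound:
  assumes "\<bar>\<tau>\<bar> \<le> 1" "norm p \<le> 1" "norm y \<le> norm p"
  shows "\<bar>rhs \<tau> p y t\<bar> \<le> (bound * (2 * sqrt (2 / T) + 1) ^ 3 + 1) * norm p"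
proof -
  define b where "b = 2 * sqrt (2 / T) + 1"
  have b: "b \<ge> 0" using T by (simp add: b_def)
  have "\<bar>Lmap T k p t + y t\<bar> \<le> b * norm p"
    using Lmap_bound[of p t] apply_le_norm[of y t] assms(3)
    unfolding b_def distrib_right by linarith
  then have "\<bar>Lmap T k p t + y t\<bar> ^ 3 \<le> (b * norm p) ^ 3" by (intro power_mono) auto
  also have "\<dots> \<le> b ^ 3 * norm p"
    unfolding power_mult_distrib using b assms(2)
    by (intro mult_left_mono) (auto simp: power_le_one power_decreasing[of 1 3 "norm p", simplified])
  finally have "\<bar>a0 t * (Lmap T k p t + y t) ^ 3\<bar> \<le> bound * (b ^ 3 * norm p)"
    unfolding abs_mult power_abs by (intro mult_mono a0_bound bound) auto
  moreover have "\<bar>\<tau> * y t\<bar> \<le> 1 * norm p"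
    unfolding abs_mult using apply_le_norm[of y t] assms by (intro mult_mono) auto
  ultimately show ?thesis
    unfolding rhs_def b_def distrib_right mult.assoc by linarith
qed

text \<open>The uniqueness neighbourhood of the reduction is measured in H2, the contraction in the
  sup norm. Sup bounds on \<open>y\<close> and its first two derivatives bridge the two; each
  contributes at most M^2 T, hence the factor 3 T.\<close>

lemma Hs_norm_solution:
  obtains C where "\<And>\<tau> p y. \<bar>\<tau>\<bar> \<le> 1 \<Longrightarrow> norm p \<le> 1 \<Longrightarrow> norm y \<le> norm p \<Longrightarrow> aux \<tau> p y \<Longrightarrow>
    Hs_norm T 2 (apply_bcontfun y) \<le> C * norm p"
proof -
  obtain C where C: "C \<ge> 0"
    "\<And>h B t. bdd_meas T h \<Longrightarrow> (\<And>t. t \<in> {0..T} \<Longrightarrow> \<bar>h t\<bar> \<le> B) \<Longrightarrow> \<bar>Kop h t\<bar> \<le> C * B \<and>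
      \<bar>Kop' h t\<bar> \<le> C * B \<and> (t \<in> {0..T} \<longrightarrow> \<bar>- res h t - \<omega>\<^sup>2 * Kop h t\<bar> \<le> C * B)"
    by (fact Kop_bounds)
  define D where "D = bound * (2 * sqrt (2 / T) + 1) ^ 3 + 1"
  have "D \<ge> 0" using bound(1) T by (simp add: D_def)
  show thesis
  proof (rule that[of "sqrt (3 * T) * (C * D)"])
    fix \<tau> p y assume h: "\<bar>\<tau>\<bar> \<le> 1" "norm p \<le> 1" "norm y \<le> norm p" "aux \<tau> p y"
    let ?h = "rhs \<tau> p y"
    define M where "M = C * (D * norm p)"
    have "M \<ge> 0" using C \<open>D \<ge> 0\<close> by (simp add: M_def)
    have hb: "\<bar>?h t\<bar> \<le> D * norm p" for t unfolding D_def by (rule rhs_bound[OF h(1-3)])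
    have sq: "L2_inner T f f \<le> M\<^sup>2 * T" if "bdd_meas T f" "\<And>t. t \<in> {0..T} \<Longrightarrow> \<bar>f t\<bar> \<le> M" for f
    proof -
      have "\<bar>f t * f t\<bar> \<le> M\<^sup>2" if "t \<in> {0..T}" for t
        unfolding abs_mult power2_eq_square using \<open>M \<ge> 0\<close> that \<open>\<And>t. t \<in> {0..T} \<Longrightarrow> \<bar>f t\<bar> \<le> M\<close>
        by (intro mult_mono) auto
      then have "\<bar>LINT t|leb T. f t * f t\<bar> \<le> M\<^sup>2 * T"
        using T bdd_meas_mult[OF that(1) that(1)] by (intro integral_bdd_meas_le) (auto simp: bdd_meas_def)
      then show ?thesis by (simp add: L2_inner_def)
    qed
    note D' = weak_deriv_Kop[OF bm_rhs[of \<tau> p y]]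
    have "Hs_inner T 2 (apply_bcontfun y) (apply_bcontfun y) = L2_inner T (Kop ?h) (Kop ?h)
        + L2_inner T (Kop' ?h) (Kop' ?h)
        + L2_inner T (\<lambda>t. - res ?h t - \<omega>\<^sup>2 * Kop ?h t) (\<lambda>t. - res ?h t - \<omega>\<^sup>2 * Kop ?h t)"
      unfolding aux_imp_Kop[OF h(4)] by (rule Hs_inner_2[OF D' D'])
    also have "\<dots> \<le> M\<^sup>2 * T + M\<^sup>2 * T + M\<^sup>2 * T"
    proof (intro add_mono sq)
      show "bdd_meas T (Kop ?h)" "bdd_meas T (Kop' ?h)" "bdd_meas T (\<lambda>t. - res ?h t - \<omega>\<^sup>2 * Kop ?h t)"
        using D' unfolding weak_deriv_def by blast+
      fix t assume "t \<in> {0..T}"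
      then show "\<bar>Kop ?h t\<bar> \<le> M" "\<bar>Kop' ?h t\<bar> \<le> M" "\<bar>- res ?h t - \<omega>\<^sup>2 * Kop ?h t\<bar> \<le> M"
        using C(2)[OF bm_rhs hb] unfolding M_def by blast+
    qed
    finally have "Hs_inner T 2 (apply_bcontfun y) (apply_bcontfun y) \<le> 3 * T * M\<^sup>2" by simp
    then have "Hs_norm T 2 (apply_bcontfun y) \<le> sqrt (3 * T * M\<^sup>2)"
      unfolding Hs_norm_def by (rule real_sqrt_le_mono)
    also have "\<dots> = sqrt (3 * T) * M" using \<open>M \<ge> 0\<close> by (simp add: real_sqrt_mult)
    finally show "Hs_norm T 2 (apply_bcontfun y) \<le> sqrt (3 * T) * (C * D) * norm p"
      by (simp add: M_def mult.assoc)
  qed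
qed

text \<open>The small fixed point lies in \<open>Nperp\<close>, is small in H2 and solves the
  auxiliary equation, so local uniqueness identifies it with \<psi> almost everywhere. The reduced
  map can then be read off from the abstract system.\<close>

lemma LS_reduction_eq_red:
  assumes LS: "LS_reduction T a k I NN \<psi>"
  obtains r where "r > 0"
    "\<And>p. norm p < r \<Longrightarrow> p \<in> Omega T k NN"
    "\<And>\<tau>. \<bar>\<tau>\<bar> < r \<Longrightarrow> \<omega>\<^sup>2 - \<tau> \<in> I"
    "\<And>\<tau> p. \<bar>\<tau>\<bar> < r \<Longrightarrow> norm p < r \<Longrightarrow> \<exists>y. norm y \<le> norm p \<and> aux \<tau> p y"
    "\<And>\<tau> p y. \<bar>\<tau>\<bar> < r \<Longrightarrow> norm p < r \<Longrightarrow> norm y \<le> norm p \<Longrightarrow> aux \<tau> p y \<Longrightarrow>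
      HH T a k \<psi> (\<omega>\<^sup>2 - \<tau>) p = red \<tau> p y"
proof -
  from LS have I: "open I" "\<omega>\<^sup>2 \<in> I" and NN: "open_in_N T k NN" "(\<lambda>t. 0) \<in> NN"
    and perp: "\<And>\<mu> x. \<mu> \<in> I \<Longrightarrow> x \<in> NN \<Longrightarrow> \<psi> \<mu> x \<in> Nperp T k"
    unfolding LS_reduction_def sigma_eq by blast+
  from LS obtain r1 where r1: "r1 > 0" and uniq: "\<And>\<mu> x y. \<mu> \<in> I \<Longrightarrow> x \<in> NN \<Longrightarrow> y \<in> Nperp T k \<Longrightarrow>
      \<bar>\<mu> - \<omega>\<^sup>2\<bar> < r1 \<Longrightarrow> Hs_norm T 2 x < r1 \<Longrightarrow> Hs_norm T 2 y < r1 \<Longrightarrow> aux_eq T a k \<mu> x y \<Longrightarrow>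
      AE t in leb T. y t = \<psi> \<mu> x t"
    unfolding LS_reduction_def sigma_eq by blast
  obtain r2 where r2: "r2 > 0" "\<And>\<mu>. \<bar>\<mu> - \<omega>\<^sup>2\<bar> < r2 \<Longrightarrow> \<mu> \<in> I"
    using I unfolding open_dist dist_real_def by blast
  obtain r3 where r3: "r3 > 0" "\<And>w. w \<in> Nspace T k \<Longrightarrow> Hs_norm T 2 w < r3 \<Longrightarrow> w \<in> NN"
    using NN unfolding open_in_N_def by (force simp: fun_eq_iff)
  obtain C1 r4 where "C1 > 0" and r4: "r4 > 0"
    "\<And>\<tau> p. \<bar>\<tau>\<bar> < r4 \<Longrightarrow> norm p < r4 \<Longrightarrow> \<exists>!y. norm y \<le> norm p \<and> aux \<tau> p y"
    and "\<And>\<tau> p y. \<bar>\<tau>\<bar> < r4 \<Longrightarrow> norm p < r4 \<Longrightarrow> norm y \<le> norm p \<Longrightarrow> aux \<tau> p y \<Longrightarrow> norm y \<le> C1 * norm p ^ 3"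
    by (fact small_solution)
  obtain C where C: "\<And>\<tau> p y. \<bar>\<tau>\<bar> \<le> 1 \<Longrightarrow> norm p \<le> 1 \<Longrightarrow> norm y \<le> norm p \<Longrightarrow> aux \<tau> p y \<Longrightarrow>
      Hs_norm T 2 (apply_bcontfun y) \<le> C * norm p"
    by (fact Hs_norm_solution)
  define E where "E = max 1 (max C (sqrt (1 + \<omega>\<^sup>2 + \<omega>^4)))"
  have E: "E \<ge> 1" "C \<le> E" "sqrt (1 + \<omega>\<^sup>2 + \<omega>^4) \<le> E" by (auto simp: E_def)
  \<comment> \<open>Dividing by \<open>E\<close>, which dominates both H2 constants, keeps
    \<open>L p\<close> and \<open>y\<close> inside the uniqueness neighbourhood (\<open>r1\<close>)
    and \<open>L p\<close> inside \<open>NN\<close> (\<open>r3\<close>).\<close>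
  define r where "r = Min {1, r1, r2, r4, r1 / E, r3 / E}"
  have r: "r > 0" "r \<le> 1" "r \<le> r1" "r \<le> r2" "r \<le> r4" "r \<le> r1 / E" "r \<le> r3 / E"
    using r1 r2 r3 r4 E by (auto simp: r_def)
  have small: "c * norm p < r1 \<and> c * norm p < r3" if "c \<le> E" "norm p < r" for c and p :: "real \<times> real"
  proof -
    have "c * norm p \<le> E * norm p" using that by (intro mult_right_mono) auto
    also have "\<dots> < E * r" using that E by simp
    finally have "c * norm p < E * r" .
    moreover have "E * r \<le> E * (r1 / E)" "E * r \<le> E * (r3 / E)" using r E by (intro mult_left_mono; simp)+
    ultimately show ?thesis using E by auto
  qed
  have NNp: "Lmap T k p \<in> NN" if "norm p < r" for p
    using small[OF E(3) that] by (intro r3(2)) (auto simp: Hs_norm_Lmap Nspace_def)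
  have inI: "\<omega>\<^sup>2 - \<tau> \<in> I" if "\<bar>\<tau>\<bar> < r" for \<tau>
    using that r by (intro r2(2)) simp
  show thesis
  proof (rule that[OF r(1)])
    show "p \<in> Omega T k NN" if "norm p < r" for p
      using NNp[OF that] by (simp add: Omega_def)
    show "\<omega>\<^sup>2 - \<tau> \<in> I" if "\<bar>\<tau>\<bar> < r" for \<tau> by (rule inI[OF that])
    show "\<exists>y. norm y \<le> norm p \<and> aux \<tau> p y" if "\<bar>\<tau>\<bar> < r" "norm p < r" for \<tau> p
      using r4(2)[of \<tau> p] that r by auto
    fix \<tau> p y assume h: "\<bar>\<tau>\<bar> < r" "norm p < r" "norm y \<le> norm p" "aux \<tau> p y"
    have ae: "AE t in leb T. apply_bcontfun y t = \<psi> (\<omega>\<^sup>2 - \<tau>) (Lmap T k p) t"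
    proof (rule uniq[OF inI[OF h(1)] NNp[OF h(2)]])
      show "apply_bcontfun y \<in> Nperp T k"
        unfolding aux_imp_Kop[OF h(4)] by (rule Kop_in_Nperp[OF bm_rhs])
      show "\<bar>\<omega>\<^sup>2 - \<tau> - \<omega>\<^sup>2\<bar> < r1" using h(1) r by simp
      show "Hs_norm T 2 (Lmap T k p) < r1"
        using small[OF E(3) h(2)] by (simp add: Hs_norm_Lmap)
      have "Hs_norm T 2 (apply_bcontfun y) \<le> C * norm p"
        using C[OF _ _ h(3,4)] h(1,2) r by simp
      then show "Hs_norm T 2 (apply_bcontfun y) < r1"
        using small[OF E(2) h(2)] by simp
      show "aux_eq T a k (\<omega>\<^sup>2 - \<tau>) (Lmap T k p) (apply_bcontfun y)"
        by (rule aux_imp_aux_eq[OF h(4)])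
    qed
    have "\<psi> (\<omega>\<^sup>2 - \<tau>) (Lmap T k p) \<in> Hs T 2"
      using perp[OF inI[OF h(1)] NNp[OF h(2)]] by (simp add: Nperp_def)
    then have L: "\<psi> (\<omega>\<^sup>2 - \<tau>) (Lmap T k p) \<in> L2 T"
      unfolding Hs_def using has_weak_D_imp_L2 by blast
    show "HH T a k \<psi> (\<omega>\<^sup>2 - \<tau>) p = red \<tau> p y"
      by (rule HH_eq_red[where \<psi> = \<psi>, OF h(4) L]) (use ae in \<open>auto elim!: eventually_mono\<close>)
  qed
qed

lemma zw_bar_eq: "zw_bar T a k = zb"
  by (simp add: fun_eq_iff zw_bar_def zb_def Let_def)

lemma ff_sigma_zb:
  assumes "i \<in> {1..4}"
  shows "ff T a k \<psi> (\<omega>\<^sup>2) (zb i) = 0"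
proof -
  have "cubic_part T a k (zb i) = PB (LB (zb i) ^ 3)"
    by (cases "zb i") (simp add: cubic_part_def Let_def PB_cube)
  then show ?thesis using zb_fixed[OF assms] by (simp add: ff_def sigma_eq)
qed

end

theorem theorem3p17:
  fixes T :: real and a :: "real \<Rightarrow> real" and k :: nat
    and I :: "real set" and NN :: "(real \<Rightarrow> real) set"
    and \<psi> :: "real \<Rightarrow> (real \<Rightarrow> real) \<Rightarrow> (real \<Rightarrow> real)"
  assumes "T > 0"
    and "a \<in> Linf T"
    and "AE t in leb T. a t \<ge> 0"
    and "\<not> (AE t in leb T. a t = 0)"
    and "k \<ge> 1"
    and "coef_a T a k = 3 * coef_c T a k"
    and "coef_b T a k = coef_d T a k"
    and "coef_a T a k = coef_e T a k"
    and "coef_b T a k \<noteq> 0"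
    and "LS_reduction T a k I NN \<psi>"
  shows "coef_a T a k + 2 * coef_b T a k > 0 \<and> coef_a T a k - 2 * coef_b T a k > 0 \<and>
    (\<exists>(\<epsilon> :: nat \<Rightarrow> real) (U :: nat \<Rightarrow> (real \<times> real) set) (g :: nat \<Rightarrow> real \<Rightarrow> real \<times> real).
       (\<forall>i\<in>{1..4}.
          \<epsilon> i > 0 \<and> open (U i) \<and> zw_bar T a k i \<in> U i \<and>
          g i ` {sigma T k - \<epsilon> i<..sigma T k} \<subseteq> U i \<and>
          C1_within {sigma T k - \<epsilon> i<..sigma T k} (g i) \<and>
          g i (sigma T k) = zw_bar T a k i \<and>
          (\<forall>\<mu>\<in>{sigma T k - \<epsilon> i<..sigma T k}.
             \<mu> \<in> I \<and> sqrt (sigma T k - \<mu>) *\<^sub>R g i \<mu> \<in> Omega T k NN \<and>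
             ff T a k \<psi> \<mu> (g i \<mu>) = 0)) \<and>
       (\<exists>\<delta>>0. \<exists>V. open V \<and> (0, 0) \<in> V \<and> V \<subseteq> Omega T k NN \<and>
          {sigma T k - \<delta><..sigma T k} \<subseteq> I \<and> (\<forall>i\<in>{1..4}. \<delta> \<le> \<epsilon> i) \<and>
          (\<forall>\<mu>\<in>{sigma T k - \<delta><..<sigma T k}.
             {p \<in> V. p \<noteq> (0, 0) \<and> HH T a k \<psi> \<mu> p = (0, 0)}
               = (\<lambda>i. sqrt (sigma T k - \<mu>) *\<^sub>R g i \<mu>) ` {1..4} \<and>
             inj_on (\<lambda>i. sqrt (sigma T k - \<mu>) *\<^sub>R g i \<mu>) {1..4})))"
proof -
  interpret cubic_problem T k a
    using assms by unfold_locales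
  obtain r0 where r0: "r0 > 0"
    and Om: "\<And>p. norm p < r0 \<Longrightarrow> p \<in> Omega T k NN"
    and inI: "\<And>\<tau>. \<bar>\<tau>\<bar> < r0 \<Longrightarrow> \<omega>\<^sup>2 - \<tau> \<in> I"
    and ex: "\<And>\<tau> p. \<bar>\<tau>\<bar> < r0 \<Longrightarrow> norm p < r0 \<Longrightarrow> \<exists>y. norm y \<le> norm p \<and> aux \<tau> p y"
    and HH: "\<And>\<tau> p y. \<bar>\<tau>\<bar> < r0 \<Longrightarrow> norm p < r0 \<Longrightarrow> norm y \<le> norm p \<Longrightarrow> aux \<tau> p y \<Longrightarrow>
      HH T a k \<psi> (\<omega>\<^sup>2 - \<tau>) p = red \<tau> p y"
    by (fact LS_reduction_eq_red[OF assms(10)])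
  obtain r \<epsilon> z v where r: "0 < r" "r \<le> r0" and \<epsilon>: "0 < \<epsilon>" "\<epsilon> \<le> r0"
    and z0: "\<And>i. i \<in> {1..4} \<Longrightarrow> z i 0 = zb i"
    and dz: "\<And>i \<tau>. i \<in> {1..4} \<Longrightarrow> \<bar>\<tau>\<bar> < \<epsilon> \<Longrightarrow> (z i has_vector_derivative v i \<tau>) (at \<tau>)"
    and cv: "\<And>i. i \<in> {1..4} \<Longrightarrow> continuous_on {-\<epsilon><..<\<epsilon>} (v i)"
    and zeros: "\<And>\<tau>. 0 < \<tau> \<Longrightarrow> \<tau> < \<epsilon> \<Longrightarrow>
      {p. norm p < r \<and> p \<noteq> 0 \<and> (\<exists>y. norm y \<le> norm p \<and> aux \<tau> p y \<and> red \<tau> p y = 0)}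
        = (\<lambda>i. sqrt \<tau> *\<^sub>R z i \<tau>) ` {1..4}"
    and inj: "\<And>\<tau>. 0 < \<tau> \<Longrightarrow> \<tau> < \<epsilon> \<Longrightarrow> inj_on (\<lambda>i. sqrt \<tau> *\<^sub>R z i \<tau>) {1..4}"
    by (fact four_branches[OF r0])
  define g where "g i \<mu> = z i (\<omega>\<^sup>2 - \<mu>)" for i \<mu>
  define S where "S = {\<omega>\<^sup>2 - \<epsilon><..\<omega>\<^sup>2}"
  have branches: "{p \<in> ball 0 r. p \<noteq> (0, 0) \<and> HH T a k \<psi> \<mu> p = (0, 0)}
      = (\<lambda>i. sqrt (\<omega>\<^sup>2 - \<mu>) *\<^sub>R g i \<mu>) ` {1..4}"
    "inj_on (\<lambda>i. sqrt (\<omega>\<^sup>2 - \<mu>) *\<^sub>R g i \<mu>) {1..4}" if "\<mu> \<in> {\<omega>\<^sup>2 - \<epsilon><..<\<omega>\<^sup>2}" for \<mu>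
  proof -
    define \<tau> where "\<tau> = \<omega>\<^sup>2 - \<mu>"
    have \<tau>: "0 < \<tau>" "\<tau> < \<epsilon>" "\<bar>\<tau>\<bar> < r0" using that \<epsilon> by (auto simp: \<tau>_def)
    have \<mu>: "\<mu> = \<omega>\<^sup>2 - \<tau>" by (simp add: \<tau>_def)
    \<comment> \<open>A small solution \<open>y\<close> exists, and the reduced map equals
      \<open>red\<close> for every such \<open>y\<close>; hence vanishing of the reduced map and
      existence of a \<open>y\<close> with \<open>red\<close> zero are equivalent.\<close>
    have "HH T a k \<psi> \<mu> p = 0 \<longleftrightarrow> (\<exists>y. norm y \<le> norm p \<and> aux \<tau> p y \<and> red \<tau> p y = 0)" if "norm p < r" for p
    proof -
      have p: "norm p < r0" using that r by simp
      show ?thesis using ex[OF \<tau>(3) p] HH[OF \<tau>(3) p] unfolding \<mu> by metis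
    qed
    then have "{p \<in> ball 0 r. p \<noteq> (0, 0) \<and> HH T a k \<psi> \<mu> p = (0, 0)}
      = {p. norm p < r \<and> p \<noteq> 0 \<and> (\<exists>y. norm y \<le> norm p \<and> aux \<tau> p y \<and> red \<tau> p y = 0)}"
      unfolding zero_prod_def[symmetric] by auto
    then show "{p \<in> ball 0 r. p \<noteq> (0, 0) \<and> HH T a k \<psi> \<mu> p = (0, 0)}
      = (\<lambda>i. sqrt (\<omega>\<^sup>2 - \<mu>) *\<^sub>R g i \<mu>) ` {1..4}"
      unfolding g_def \<tau>_def[symmetric] zeros[OF \<tau>(1,2)] .
    show "inj_on (\<lambda>i. sqrt (\<omega>\<^sup>2 - \<mu>) *\<^sub>R g i \<mu>) {1..4}"
      unfolding g_def \<tau>_def[symmetric] by (rule inj[OF \<tau>(1,2)])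
  qed
  have solution: "\<mu> \<in> I \<and> sqrt (\<omega>\<^sup>2 - \<mu>) *\<^sub>R g i \<mu> \<in> Omega T k NN \<and> ff T a k \<psi> \<mu> (g i \<mu>) = 0"
    if i: "i \<in> {1..4}" and \<mu>: "\<mu> \<in> S" for i \<mu>
  proof (cases "\<mu> = \<omega>\<^sup>2")
    case True
    then show ?thesis
      using inI[of 0] Om[of 0] r0 z0[OF i] ff_sigma_zb[OF i] by (simp add: g_def)
  next
    case False
    then have \<mu>': "\<mu> \<in> {\<omega>\<^sup>2 - \<epsilon><..<\<omega>\<^sup>2}" using \<mu> by (auto simp: S_def)
    have "sqrt (\<omega>\<^sup>2 - \<mu>) *\<^sub>R g i \<mu> \<in> {p \<in> ball 0 r. p \<noteq> (0, 0) \<and> HH T a k \<psi> \<mu> p = (0, 0)}"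
      unfolding branches(1)[OF \<mu>'] using i by blast
    then have "norm (sqrt (\<omega>\<^sup>2 - \<mu>) *\<^sub>R g i \<mu>) < r" "HH T a k \<psi> \<mu> (sqrt (\<omega>\<^sup>2 - \<mu>) *\<^sub>R g i \<mu>) = 0"
      unfolding zero_prod_def[symmetric] by (simp_all add: dist_norm)
    moreover have "\<mu> \<in> I" using inI[of "\<omega>\<^sup>2 - \<mu>"] \<mu>' \<epsilon> by auto
    ultimately show ?thesis using Om \<mu>' r by (simp add: ff_def sigma_eq)
  qed
  have C1: "C1_within S (g i)" if i: "i \<in> {1..4}" for i
    unfolding C1_within_def
  proof (intro exI conjI ballI)
    show "continuous_on S (\<lambda>\<mu>. - v i (\<omega>\<^sup>2 - \<mu>))"
      by (intro continuous_on_minus continuous_on_compose2[OF cv[OF i]] continuous_intros)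
        (use \<epsilon> in \<open>auto simp: S_def\<close>)
    fix \<mu> assume "\<mu> \<in> S"
    then have "\<bar>\<omega>\<^sup>2 - \<mu>\<bar> < \<epsilon>" using \<epsilon> by (auto simp: S_def)
    note d = dz[OF i this]
    \<comment> \<open>The curve is differentiable on both sides of \<tau> = 0, so at the endpoint
      the one-sided derivative is a restriction of a two-sided one; the sign comes from \<tau> =
      \<omega>^2 - \<mu>.\<close>
    have "((\<lambda>\<mu>. \<omega>\<^sup>2 - \<mu>) has_vector_derivative - 1) (at \<mu>)"
      by (auto intro!: derivative_eq_intros)
    from vector_diff_chain_at[OF this d]
    have "(g i has_vector_derivative - v i (\<omega>\<^sup>2 - \<mu>)) (at \<mu>)"
      by (simp add: g_def[abs_def] o_def)
    then show "(g i has_vector_derivative - v i (\<omega>\<^sup>2 - \<mu>)) (at \<mu> within S)"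
      by (rule has_vector_derivative_at_within)
  qed
  show ?thesis
    unfolding sigma_eq zw_bar_eq
  \<comment> \<open>One \<epsilon> serves all four branches and the whole plane serves as each
    \<open>U i\<close>; the exact count is localized by the ball of radius \<open>r\<close> taken
    for \<open>V\<close>.\<close>
  proof (intro conjI pos1 pos2 exI[of _ "\<lambda>_. \<epsilon>"] exI[of _ "\<lambda>_. UNIV"] exI[of _ g] exI[of _ \<epsilon>]
      exI[of _ "ball 0 r"] ballI open_UNIV UNIV_I subset_UNIV open_ball order_refl \<epsilon>(1)
      C1[unfolded S_def] branches)
    show "g i (\<omega>\<^sup>2) = zb i" if "i \<in> {1..4}" for i using z0[OF that] by (simp add: g_def)
    show "\<mu> \<in> I" "sqrt (\<omega>\<^sup>2 - \<mu>) *\<^sub>R g i \<mu> \<in> Omega T k NN" "ff T a k \<psi> \<mu> (g i \<mu>) = 0"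
      if "i \<in> {1..4}" "\<mu> \<in> {\<omega>\<^sup>2 - \<epsilon><..\<omega>\<^sup>2}" for i \<mu>
      using solution[of i \<mu>] that by (auto simp: S_def)
    show "(0, 0) \<in> ball (0 :: real \<times> real) r" using r by (simp flip: zero_prod_def)
    show "ball 0 r \<subseteq> Omega T k NN" using Om r by auto
    show "{\<omega>\<^sup>2 - \<epsilon><..\<omega>\<^sup>2} \<subseteq> I" using solution[of 1] by (auto simp: S_def)
  qed
qed

end
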